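(* Let $\lambda>0$, $q\in(0,1)$, let $N\ge 1$ be an integer, and let $\alpha=\frac{2N-q(2N+\lambda)}{N(1-q)}$. Then the inequality $$I_\lambda[\rho]\ \ge\ \mathcal C_{N,\lambda,q}\left(\int_{\mathbb R^N}\rho(x)\,dx\right)^{\alpha}\left(\int_{\mathbb R^N}\rho(x)^q\,dx\right)^{(2-\alpha)/q}$$ holds for every nonnegative function $\rho\in L^1\cap L^q(\mathbb R^N)$, $\rho\not\equiv0$, with a positive constant $\mathcal C_{N,\lambda,q}$ (that is, the infimum $\mathcal C_{N,\lambda,q}$ defined in the context is positive), if and only if $q>N/(N+\lambda)$. Moreover, when $q>N/(N+\lambda)$, if either $N\in\{1,2\}$, or $N\ge3$ and $q\ge\min\{1-2/N,\ 2N/(2N+\lambda)\}$, then the equality $$I_\lambda[\rho]\ =\ \mathcal C_{N,\lambda,q}\left(\int_{\mathbb R^N}\rho(x)\,dx\right)^{\alpha}\left(\int_{\mathbb R^N}\rho(x)^q\,dx\right)^{(2-\alpha)/q},$$ with $\mathcal C_{N,\lambda,q}$ equal to that infimum, is achieved by some radial nonnegative function $\rho\in L^1\cap L^q(\mathbb R^N)$, $\rho\not\equiv 0$.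
   Context: For $p>0$, $\rho\in L^p(\mathbb R^N)$ means that $\rho$ is measurable and $\int_{\mathbb R^N}|\rho|^p\,dx<\infty$ (also when $p<1$). For measurable $\rho\ge0$ on $\mathbb R^N$, $$I_\lambda[\rho]:=\iint_{\mathbb R^N\times\mathbb R^N}\rho(x)\,|x-y|^\lambda\,\rho(y)\,dx\,dy\in[0,+\infty].$$ The optimal constant is $$\mathcal C_{N,\lambda,q}:=\inf\left\{\frac{I_\lambda[\rho]}{\left(\int_{\mathbb R^N}\rho\,dx\right)^{\alpha}\left(\int_{\mathbb R^N}\rho^q\,dx\right)^{(2-\alpha)/q}}:\ 0\le\rho\in L^1\cap L^q(\mathbb R^N),\ \rho\not\equiv0\right\}.$$ *)

theory Defs
  imports "HOL-Analysis.Analysis"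
begin

definition Lp :: "real \<Rightarrow> (real ^ 'n::finite \<Rightarrow> real) set" where
  "Lp p = {\<rho>. \<rho> \<in> borel_measurable lebesgue \<and>
               (\<integral>\<^sup>+ x. ennreal (\<bar>\<rho> x\<bar> powr p) \<partial>lebesgue) < \<infinity>}"

text \<open>
  The energy is valued in the extended nonnegative reals, as it may be infinite on
  \<^term>\<open>Lp 1 \<inter> Lp q\<close>.
\<close>

definition energy :: "real \<Rightarrow> (real ^ 'n::finite \<Rightarrow> real) \<Rightarrow> ennreal" where
  "energy lam \<rho> =
     (\<integral>\<^sup>+ (x, y). ennreal (\<rho> x * norm (x - y) powr lam * \<rho> y) \<partial>(lebesgue \<Otimes>\<^sub>M lebesgue))"

text \<open>
  The condition that the density does not vanish identically is meant in the sense of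
  functions modulo null sets.
\<close>

definition densities :: "real \<Rightarrow> (real ^ 'n::finite \<Rightarrow> real) set" where
  "densities q =
     {\<rho> \<in> Lp 1 \<inter> Lp q. (\<forall>x. 0 \<le> \<rho> x) \<and> \<not> (AE x in lebesgue. \<rho> x = 0)}"

definition hls_exponent :: "nat \<Rightarrow> real \<Rightarrow> real \<Rightarrow> real" where
  "hls_exponent N lam q = (2 * real N - q * (2 * real N + lam)) / (real N * (1 - q))"

text \<open>
  On \<^term>\<open>densities q\<close> both integrals below are finite and positive, so this is a positive real
  number, whatever the sign of the exponent \<open>\<alpha>\<close>.
\<close>

definition norm_product :: "real \<Rightarrow> real \<Rightarrow> (real ^ 'n::finite \<Rightarrow> real) \<Rightarrow> real" where
  "norm_product lam q \<rho> =
     (let \<alpha> = hls_exponent CARD('n) lam q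
      in (\<integral>x. \<rho> x \<partial>lebesgue) powr \<alpha> * (\<integral>x. \<rho> x powr q \<partial>lebesgue) powr ((2 - \<alpha>) / q))"

definition optimal_constant :: "'n::finite itself \<Rightarrow> real \<Rightarrow> real \<Rightarrow> ennreal" where
  "optimal_constant _ lam q =
     (INF \<rho> \<in> (densities q :: (real ^ 'n \<Rightarrow> real) set).
        energy lam \<rho> / ennreal (norm_product lam q \<rho>))"

definition radial :: "(real ^ 'n::finite \<Rightarrow> real) \<Rightarrow> bool" where
  "radial \<rho> \<longleftrightarrow> (\<exists>f. \<forall>x. \<rho> x = f (norm x))"

end

theory Submission
  imports Defs "HOL-Probability.Helly_Selection" "HOL-Complex_Analysis.Great_Picard"
begin

text \<open>
  Two-point symmetrization (polarization) does not increase the energy, and minimising the second moment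
  among the functions of the same distribution and no larger energy yields a radially decreasing rearrangement; so the infimum can be
  computed over radially decreasing functions. By Helly's selection theorem a normalised minimising sequence of such
  functions converges almost everywhere, and for \<open>q > N / (N + lam)\<close> only mass, no \<open>q\<close>-mass, can be lost, namely to a
  point mass \<open>M\<close> at the origin. The limit attains the infimum of the relaxed functional
  \<open>I[\<rho>] + 2 M \<integral>|x|\<^bsup>lam\<^esup> \<rho>\<close>, which gives positivity of the constant. The relaxed
  inequality with \<open>M \<longlonglongrightarrow> \<infinity>\<close> shows that the constant vanishes for \<open>q \<le> N / (N + lam)\<close>. Under the extra condition
  on \<open>q\<close>, either \<open>\<alpha> \<le> 0\<close> and dropping the point mass lowers the functional, or a first variation at the
  origin contradicts the integrability of \<open>\<rho>\<close>; in both cases \<open>M = 0\<close> and the minimiser is a function.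
\<close>

section \<open>Lebesgue measure: isometries, scaling, powers of the norm\<close>

text \<open>The exponents \<open>al\<close> and \<open>th\<close> are the ones for which both sides
  behave alike under dilations and under multiplication of the density by a constant. After both
  integrals are normalised to 1, only compactness is at stake. The obstacle is \<open>q < 1\<close>:
  mass that concentrates at a point has vanishing self-interaction and vanishing
  \<open>q\<close>-mass, so no available bound prevents it. Escape to infinity is controlled. A
  radially decreasing function of mass 1 with bounded moment lies below multiples of both
  \<open>norm x powr - N\<close> and \<open>norm x powr - (N + lam)\<close>. The \<open>q\<close>-th
  power of the first is integrable at the origin because \<open>q < 1\<close>, that of the second at
  infinity precisely when \<open>q * (N + lam) > N\<close>. This is the origin of the threshold, and
  truncations of the second profile are the test functions for necessity. The rearranged function is
  not constructed from level sets: it is the minimiser over a class closed under polarization and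
  compact by Arzela-Ascoli, so only continuous functions of compact support are ever
  symmetrized.\<close>

lemma lborel_distr_isometry:
  fixes T :: "'a::euclidean_space \<Rightarrow> 'a"
  assumes iso: "\<And>x y. dist (T x) (T y) = dist x y" and inv: "\<And>x. T (T x) = x"
  shows "distr lborel borel T = lborel"
proof -
  have "continuous_on UNIV T"
    unfolding continuous_on_iff using iso by auto
  then have T[measurable]: "T \<in> borel \<rightarrow>\<^sub>M borel"
    by (rule borel_measurable_continuous_onI)
  have ball: "T -` ball c r = ball (T c) r" for c r
  proof (rule set_eqI)
    fix x
    have "dist c (T x) = dist (T c) x" using iso[of "T c" x] inv[of c] by simp
    then show "x \<in> T -` ball c r \<longleftrightarrow> x \<in> ball (T c) r" by simp
  qed
  have eq: "emeasure lborel (T -` U) = emeasure lborel U" if "open U" for U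
  proof -
    \<comment> \<open>The balls inside \<open>U\<close> form a fine cover, so Vitali's theorem
      exhausts \<open>U\<close> up to a null set by countably many disjoint balls. The measure of a
      ball depends on its radius only, and an isometry keeps the radius.\<close>
    define K where "K = {(c::'a, r). 0 < r \<and> ball c r \<subseteq> U}"
    have "\<exists>i. i \<in> K \<and> x \<in> ball (fst i) (snd i) \<and> snd i < d" if x: "x \<in> U" and d: "0 < d" for x d
    proof -
      obtain e where e: "e > 0" "ball x e \<subseteq> U" using \<open>open U\<close> x by (meson openE)
      let ?r = "min e (d/2)"
      have "(x, ?r) \<in> K" using e d unfolding K_def by auto
      moreover have "x \<in> ball (fst (x, ?r)) (snd (x, ?r))" "snd (x, ?r) < d" using e d by auto
      ultimately show ?thesis by blast
    qed
    then obtain C where C: "countable C" "C \<subseteq> K"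
      and pw: "pairwise (\<lambda>i j. disjnt (ball (fst i) (snd i)) (ball (fst j) (snd j))) C"
      and neg: "negligible (U - (\<Union>i\<in>C. ball (fst i) (snd i)))"
      using Vitali_covering_theorem_balls[of U K fst snd] by blast
    let ?B = "\<lambda>i::'a \<times> real. ball (fst i) (snd i)"
    let ?V = "\<Union>i\<in>C. ?B i"
    have VU: "?V \<subseteq> U" using C(2) unfolding K_def by force
    have Vopen: "open ?V" by auto
    have disj: "disjoint_family_on ?B C"
      using pw unfolding disjoint_family_on_def pairwise_def disjnt_def by auto
    have disj': "disjoint_family_on (\<lambda>i. T -` ?B i) C"
      using disj unfolding disjoint_family_on_def by (simp add: vimage_Int[symmetric])
    have null: "emeasure lborel A = 0" if "negligible A" "A \<in> sets borel" for A :: "'a set"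
      using that by (metis emeasure_lborel_countable negligible_iff_null_sets null_setsD1 null_sets_completion_iff sets_lborel)
    have "emeasure lborel U = emeasure lborel ?V + emeasure lborel (U - ?V)"
      using VU Vopen \<open>open U\<close> by (subst plus_emeasure) (auto simp: Un_absorb1)
    then have 1: "emeasure lborel U = emeasure lborel ?V"
      using null[OF neg] Vopen \<open>open U\<close> by auto
    \<comment> \<open>The uncovered remainder stays null because an isometry is Lipschitz.
      Involutivity identifies this image with the preimage that the pushforward measure
      sees.\<close>
    have negT: "negligible (T ` (U - ?V))"
      by (rule negligible_locally_Lipschitz_image[OF _ neg])
        (use iso in \<open>auto intro!: exI[of _ UNIV] exI[of _ 1] simp: dist_norm[symmetric]\<close>)
    have Tim: "T ` A = T -` A" for A using inv by (auto simp: image_iff) (metis inv)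
    have mT: "T -` A \<in> sets borel" if "A \<in> sets borel" for A
      using measurable_sets[OF T that] by simp
    have "emeasure lborel (T -` U) = emeasure lborel (T -` ?V) + emeasure lborel (T -` (U - ?V))"
      using VU Vopen \<open>open U\<close> by (subst plus_emeasure) (auto intro!: mT arg_cong[where f="emeasure lborel"])
    moreover have "emeasure lborel (T -` (U - ?V)) = 0"
      by (rule null) (use negT Tim Vopen \<open>open U\<close> in \<open>auto intro!: mT\<close>)
    ultimately have 2: "emeasure lborel (T -` U) = emeasure lborel (T -` ?V)" by simp
    have "emeasure lborel (T -` ?V) = emeasure lborel (\<Union>i\<in>C. T -` ?B i)" by (simp add: vimage_UN)
    also have "\<dots> = (\<integral>\<^sup>+i. emeasure lborel (T -` ?B i) \<partial>count_space C)"
      by (rule emeasure_UN_countable) (use C disj' in \<open>auto intro!: mT\<close>)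
    also have "\<dots> = (\<integral>\<^sup>+i. emeasure lborel (?B i) \<partial>count_space C)"
    proof (rule nn_integral_cong)
      fix i assume "i \<in> space (count_space C)"
      then have "0 < snd i" using C(2) unfolding K_def by auto
      then show "emeasure lborel (T -` ?B i) = emeasure lborel (?B i)"
        by (simp add: ball emeasure_ball)
    qed
    also have "\<dots> = emeasure lborel ?V"
      by (rule emeasure_UN_countable[symmetric]) (use C disj in auto)
    finally show ?thesis using 1 2 by simp
  qed
  have "lborel = distr lborel borel T"
  proof (rule lborel_eqI)
    fix l u :: 'a assume lu: "\<And>b. b \<in> Basis \<Longrightarrow> l \<bullet> b \<le> u \<bullet> b"
    have "emeasure (distr lborel borel T) (box l u) = emeasure lborel (box l u)"
      using eq[OF open_box] by (simp add: emeasure_distr)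
    also have "\<dots> = (\<Prod>b\<in>Basis. (u - l) \<bullet> b)" using lu by (simp add: emeasure_lborel_box inner_diff_left)
    finally show "emeasure (distr lborel borel T) (box l u) = (\<Prod>b\<in>Basis. (u - l) \<bullet> b)" .
  qed simp
  then show ?thesis by simp
qed

lemma nn_integral_isometry:
  fixes T :: "'a::euclidean_space \<Rightarrow> 'a"
  assumes iso: "\<And>x y. dist (T x) (T y) = dist x y" and inv: "\<And>x. T (T x) = x"
    and f[measurable]: "f \<in> borel_measurable borel"
  shows "(\<integral>\<^sup>+x. f (T x) \<partial>lborel) = (\<integral>\<^sup>+x. f x \<partial>lborel)"
proof -
  have "continuous_on UNIV T"
    unfolding continuous_on_iff using iso by auto
  then have T[measurable]: "T \<in> borel \<rightarrow>\<^sub>M borel"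
    by (rule borel_measurable_continuous_onI)
  have "(\<integral>\<^sup>+x. f x \<partial>lborel) = (\<integral>\<^sup>+x. f x \<partial>distr lborel borel T)"
    using lborel_distr_isometry[OF iso inv] by simp
  also have "\<dots> = (\<integral>\<^sup>+x. f (T x) \<partial>lborel)" by (rule nn_integral_distr) auto
  finally show ?thesis by simp
qed

lemma nn_integral_scaleR:
  fixes f :: "'a::euclidean_space \<Rightarrow> ennreal"
  assumes [measurable]: "f \<in> borel_measurable borel" and c: "c > 0"
  shows "(\<integral>\<^sup>+x. f (c *\<^sub>R x) \<partial>lborel) = ennreal (1 / c ^ DIM('a)) * (\<integral>\<^sup>+x. f x \<partial>lborel)"
proof -
  have "(\<integral>\<^sup>+x. f x \<partial>lborel) = (\<integral>\<^sup>+x. f x \<partial>density (distr lborel borel (\<lambda>x. 0 + c *\<^sub>R x)) (\<lambda>_. \<bar>c\<bar> ^ DIM('a)))"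
    using lborel_affine[of c "0::'a"] c by simp
  also have "\<dots> = ennreal (c ^ DIM('a)) * (\<integral>\<^sup>+x. f (c *\<^sub>R x) \<partial>lborel)"
    using c by (simp add: nn_integral_density nn_integral_distr nn_integral_cmult ennreal_power)
  finally have "ennreal (1 / c ^ DIM('a)) * (\<integral>\<^sup>+x. f x \<partial>lborel)
      = (ennreal (1 / c ^ DIM('a)) * ennreal (c ^ DIM('a))) * (\<integral>\<^sup>+x. f (c *\<^sub>R x) \<partial>lborel)"
    by (simp add: mult.assoc)
  also have "ennreal (1 / c ^ DIM('a)) * ennreal (c ^ DIM('a)) = 1"
    using c by (simp flip: ennreal_mult)
  finally show ?thesis by simp
qed

section \<open>Integrals of powers of the norm over dyadic annuli\<close>

definition annulus :: "real \<Rightarrow> real \<Rightarrow> 'a::real_normed_vector set" where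
  "annulus r s = {x. r < norm x \<and> norm x \<le> s}"

lemma annulus_measurable[measurable]: "annulus r s \<in> sets borel"
  unfolding annulus_def by measurable

lemma emeasure_annulus:
  assumes "0 \<le> r" "r \<le> s"
  shows "emeasure lborel (annulus r s :: 'a::euclidean_space set)
    = ennreal (unit_ball_vol DIM('a) * (s ^ DIM('a) - r ^ DIM('a)))"
proof -
  have eq: "annulus r s = cball 0 s - cball (0::'a) r" unfolding annulus_def by auto
  have "emeasure lborel (cball 0 s - cball (0::'a) r) = emeasure lborel (cball (0::'a) s) - emeasure lborel (cball (0::'a) r)"
    by (rule emeasure_Diff) (use assms emeasure_lborel_cball_finite in \<open>auto simp: less_top[symmetric]\<close>)
  also have "\<dots> = ennreal (unit_ball_vol DIM('a) * s ^ DIM('a)) - ennreal (unit_ball_vol DIM('a) * r ^ DIM('a))"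
    using assms by (simp add: emeasure_cball)
  also have "\<dots> = ennreal (unit_ball_vol DIM('a) * (s ^ DIM('a) - r ^ DIM('a)))"
    using assms by (subst ennreal_minus) (auto simp: right_diff_distrib)
  finally show ?thesis unfolding eq .
qed

text \<open>Majorisation by a step function: the \<open>j\<close>-th annulus contributes at most
  \<open>c j\<close> times the volume of the ball of radius \<open>s j\<close>. Overlapping annuli
  do no harm to an upper bound.\<close>

lemma nn_integral_annuli_finite:
  fixes h :: "'a::euclidean_space \<Rightarrow> real"
  assumes r: "\<And>j. 0 \<le> r j" "\<And>j. r j \<le> s j" and c: "\<And>j. 0 \<le> c j"
    and h: "\<And>x. x \<in> S \<Longrightarrow> h x \<le> 0 \<or> (\<exists>j. x \<in> annulus (r j) (s j) \<and> h x \<le> c j)"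
    and sm: "summable (\<lambda>j. c j * s j ^ DIM('a))"
  shows "(\<integral>\<^sup>+x. ennreal (h x) * indicator S x \<partial>lborel) < \<infinity>"
proof -
  let ?w = "unit_ball_vol DIM('a)"
  have "(\<integral>\<^sup>+x. ennreal (h x) * indicator S x \<partial>lborel)
      \<le> (\<integral>\<^sup>+x. (\<Sum>j. ennreal (c j) * indicator (annulus (r j) (s j)) x) \<partial>(lborel::'a measure))"
  proof (rule nn_integral_mono)
    fix x :: 'a
    show "ennreal (h x) * indicator S x \<le> (\<Sum>j. ennreal (c j) * indicator (annulus (r j) (s j)) x)"
    proof (cases "x \<in> S \<and> \<not> h x \<le> 0")
      case True
      then obtain j where j: "x \<in> annulus (r j) (s j)" "h x \<le> c j" using h by blast
      have "ennreal (h x) * indicator S x \<le> (\<Sum>i\<in>{j}. ennreal (c i) * indicator (annulus (r i) (s i)) x)"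
        using True j by (auto simp: ennreal_leI)
      also have "\<dots> \<le> (\<Sum>j. ennreal (c j) * indicator (annulus (r j) (s j)) x)"
        by (rule sum_le_suminf) auto
      finally show ?thesis .
    qed (auto simp: ennreal_neg indicator_def)
  qed
  also have "\<dots> = (\<Sum>j. ennreal (c j) * emeasure lborel (annulus (r j) (s j) :: 'a set))"
    by (subst nn_integral_suminf) (auto simp: nn_integral_cmult_indicator)
  also have "\<dots> \<le> (\<Sum>j. ennreal (?w * (c j * s j ^ DIM('a))))"
  proof (rule suminf_le)
    fix j
    have "ennreal (c j) * emeasure lborel (annulus (r j) (s j) :: 'a set)
        = ennreal (c j * (?w * (s j ^ DIM('a) - r j ^ DIM('a))))"
      using r c by (simp add: emeasure_annulus ennreal_mult'[symmetric])
    also have "\<dots> \<le> ennreal (?w * (c j * s j ^ DIM('a)))"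
      using r c by (intro ennreal_leI) (auto simp: algebra_simps intro!: mult_nonneg_nonneg)
    finally show "ennreal (c j) * emeasure lborel (annulus (r j) (s j) :: 'a set) \<le> ennreal (?w * (c j * s j ^ DIM('a)))" .
  qed auto
  also have "\<dots> < \<infinity>"
  proof -
    have "0 \<le> s j" for j using r order_trans by blast
    then have "(\<Sum>j. ennreal (?w * (c j * s j ^ DIM('a)))) = ennreal (\<Sum>j. ?w * (c j * s j ^ DIM('a)))"
      using c by (intro suminf_ennreal2 summable_mult sm) auto
    then show ?thesis by simp
  qed
  finally show ?thesis .
qed

text \<open>Each of the first \<open>n\<close> disjoint annuli contributes at least the same amount.
  Keeping \<open>n\<close> finite serves both uses: divergence near the origin and a quantitative
  lower bound on a bounded region.\<close>

lemma nn_integral_annuli_ge: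
  fixes h :: "'a::euclidean_space \<Rightarrow> real"
  assumes r: "\<And>j. 0 \<le> r j" "\<And>j. r j \<le> s j" and c: "\<And>j. 0 \<le> c j"
    and h: "\<And>j x. j < n \<Longrightarrow> x \<in> annulus (r j) (s j) \<Longrightarrow> x \<in> S \<and> c j \<le> h x"
    and disj: "\<And>i j x. x \<in> annulus (r i) (s i) \<Longrightarrow> x \<in> (annulus (r j) (s j) :: 'a set) \<Longrightarrow> i = j"
    and d: "\<And>j. d \<le> c j * (s j ^ DIM('a) - r j ^ DIM('a))"
  shows "ennreal (real n * (unit_ball_vol DIM('a) * d)) \<le> (\<integral>\<^sup>+x. ennreal (h x) * indicator S x \<partial>lborel)"
proof -
  let ?w = "unit_ball_vol DIM('a)"
  have "ennreal (real n * (?w * d)) = (\<Sum>j<n. ennreal (?w * d))"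
    by (simp add: ennreal_mult' ennreal_of_nat_eq_real_of_nat)
  also have "\<dots> \<le> (\<Sum>j<n. ennreal (c j) * emeasure lborel (annulus (r j) (s j) :: 'a set))"
  proof (rule sum_mono)
    fix j
    have "ennreal (?w * d) \<le> ennreal (?w * (c j * (s j ^ DIM('a) - r j ^ DIM('a))))"
      using d by (intro ennreal_leI mult_left_mono) auto
    also have "\<dots> = ennreal (c j) * emeasure lborel (annulus (r j) (s j) :: 'a set)"
      using r c by (simp add: emeasure_annulus ennreal_mult'[symmetric] mult_ac)
    finally show "ennreal (?w * d) \<le> ennreal (c j) * emeasure lborel (annulus (r j) (s j) :: 'a set)" .
  qed
  also have "\<dots> = (\<integral>\<^sup>+x. (\<Sum>j<n. ennreal (c j) * indicator (annulus (r j) (s j)) x) \<partial>(lborel::'a measure))"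
    by (subst nn_integral_sum) (auto simp: nn_integral_cmult_indicator)
  also have "\<dots> \<le> (\<integral>\<^sup>+x. ennreal (h x) * indicator S x \<partial>lborel)"
  proof (rule nn_integral_mono)
    fix x :: 'a
    show "(\<Sum>j<n. ennreal (c j) * indicator (annulus (r j) (s j)) x) \<le> ennreal (h x) * indicator S x"
    proof (cases "\<exists>i<n. x \<in> annulus (r i) (s i)")
      case True
      then obtain i where i: "i < n" "x \<in> annulus (r i) (s i)" by auto
      have "(\<Sum>j<n. ennreal (c j) * indicator (annulus (r j) (s j)) x) = (\<Sum>j<n. if j = i then ennreal (c i) else 0)"
        using i disj by (intro sum.cong) (auto simp: indicator_def)
      also have "\<dots> = ennreal (c i)" using i by simp
      also have "\<dots> \<le> ennreal (h x) * indicator S x" using h[OF i] by (simp add: ennreal_leI)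
      finally show ?thesis .
    qed (auto simp: indicator_def)
  qed
  finally show ?thesis .
qed

lemma dyadic_exists:
  fixes t :: real assumes "0 < t"
  shows "\<exists>k::int. 2 powr k < t \<and> t \<le> 2 powr (k + 1)"
proof -
  define k where "k = \<lceil>log 2 t\<rceil> - 1"
  have "k < log 2 t" "log 2 t \<le> k + 1" unfolding k_def by linarith+
  then show ?thesis using assms
    by (intro exI[of _ k]) (simp add: less_log_iff log_le_iff)
qed

lemma nn_integral_norm_powr_near:
  assumes a: "0 \<le> a" "a < real DIM('a::euclidean_space)"
  shows "(\<integral>\<^sup>+x. ennreal (norm x powr - a) * indicator (cball 0 1) (x::'a) \<partial>lborel) < \<infinity>"
proof (rule nn_integral_annuli_finite[where r="\<lambda>j. 2 powr (- real j - 1)" and s="\<lambda>j. 2 powr (- real j)"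
      and c="\<lambda>j. 2 powr (a * (real j + 1))"])
  fix x :: 'a assume x: "x \<in> cball 0 1"
  \<comment> \<open>The first alternative is there for the origin, where \<open>0 powr - a\<close>
    is 0 by convention and no annulus contains the point.\<close>
  show "norm x powr - a \<le> 0 \<or> (\<exists>j. x \<in> annulus (2 powr (- real j - 1)) (2 powr - real j) \<and> norm x powr - a \<le> 2 powr (a * (real j + 1)))"
  proof (cases "x = 0")
    case False
    then obtain k :: int where k: "2 powr k < norm x" "norm x \<le> 2 powr (k + 1)"
      using dyadic_exists[of "norm x"] by auto
    have "2 powr k < 2 powr (0::real)" using k x by simp
    then have "k < 0" using powr_less_cancel_iff[of 2 "real_of_int k" 0] by simp
    then have "k = - int (nat (- k - 1)) - 1" by simp
    then obtain j :: nat where j: "k = - int j - 1" by blast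
    have "norm x powr - a \<le> (2 powr (- real j - 1)) powr - a"
      using k a unfolding j by (intro powr_mono2') auto
    also have "\<dots> = 2 powr (a * (real j + 1))" by (simp add: powr_powr algebra_simps)
    finally show ?thesis using k unfolding j annulus_def by auto
  qed auto
next
  have "2 powr (a * (real j + 1)) * (2 powr - real j) ^ DIM('a) = 2 powr a * (2 powr (a - DIM('a))) ^ j" for j
    by (simp add: powr_power powr_add[symmetric] algebra_simps)
  moreover have "2 powr (a - DIM('a)) < 1" using a by (simp add: powr_less_one)
  ultimately show "summable (\<lambda>j. 2 powr (a * (real j + 1)) * (2 powr - real j) ^ DIM('a))"
    by (auto intro!: summable_mult summable_geometric)
qed auto

lemma nn_integral_norm_powr_far:
  assumes a: "a > real DIM('a::euclidean_space)"
  shows "(\<integral>\<^sup>+x. ennreal (norm x powr - a) * indicator (- cball 0 1) (x::'a) \<partial>lborel) < \<infinity>"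
proof (rule nn_integral_annuli_finite[where r="\<lambda>j. 2 powr (real j)" and s="\<lambda>j. 2 powr (real j + 1)"
      and c="\<lambda>j. 2 powr (- a * real j)"])
  fix x :: 'a assume x: "x \<in> - cball 0 1"
  then have "norm x > 1" by auto
  then have "x \<noteq> 0" by auto
  then obtain k :: int where k: "2 powr k < norm x" "norm x \<le> 2 powr (k + 1)"
    using dyadic_exists[of "norm x"] by auto
  have "2 powr (0::real) < 2 powr (k + 1)" using k \<open>norm x > 1\<close> by simp
  then have "k + 1 > 0" using powr_less_cancel_iff[of 2 0 "real_of_int k + 1"] by (simp del: powr_zero_eq_one)
  then have "k = int (nat k)" by simp
  then obtain j :: nat where j: "k = int j" by blast
  have "norm x powr - a \<le> (2 powr (real j)) powr - a"
    using k a unfolding j by (intro powr_mono2') auto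
  also have "\<dots> = 2 powr (- a * real j)" by (simp add: powr_powr algebra_simps)
  finally show "norm x powr - a \<le> 0 \<or> (\<exists>j. x \<in> annulus (2 powr real j) (2 powr (real j + 1)) \<and> norm x powr - a \<le> 2 powr (- a * real j))"
    using k unfolding j annulus_def by auto
next
  have "2 powr (- a * real j) * (2 powr (real j + 1)) ^ DIM('a) = 2 powr DIM('a) * (2 powr (DIM('a) - a)) ^ j" for j
    by (simp add: powr_power powr_add[symmetric] algebra_simps)
  moreover have "2 powr (DIM('a) - a) < 1" using a by (simp add: powr_less_one)
  ultimately show "summable (\<lambda>j. 2 powr (- a * real j) * (2 powr (real j + 1)) ^ DIM('a))"
    by (auto intro!: summable_mult summable_geometric)
qed (use a in auto)

lemma dyadic_unique:
  fixes i j :: real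
  assumes "2 powr i < t" "t \<le> 2 powr (i + 1)" "2 powr j < t" "t \<le> 2 powr (j + 1)"
  shows "i < j + 1" "j < i + 1"
proof -
  have "2 powr i < 2 powr (j + 1)" "2 powr j < 2 powr (i + 1)" using assms by linarith+
  then show "i < j + 1" "j < i + 1" using powr_less_cancel_iff[of 2] by auto
qed

lemma nn_integral_norm_powr_near_infinite:
  assumes a: "a \<ge> real DIM('a::euclidean_space)"
  shows "(\<integral>\<^sup>+x. ennreal (norm x powr - a) * indicator (cball 0 1) (x::'a) \<partial>lborel) = \<infinity>"
proof -
  let ?J = "\<integral>\<^sup>+x. ennreal (norm x powr - a) * indicator (cball 0 1) (x::'a) \<partial>lborel"
  define d :: real where "d = unit_ball_vol DIM('a) * (1 - 2 powr - real DIM('a))"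
  have d: "d > 0" unfolding d_def by (intro mult_pos_pos) (auto simp: powr_less_one)
  have "ennreal (real n * d) \<le> ?J" for n
    unfolding d_def
  proof (rule nn_integral_annuli_ge[where r="\<lambda>j. 2 powr (- real j - 1)" and s="\<lambda>j. 2 powr (- real j)"
      and c="\<lambda>j. 2 powr (a * real j)"])
    fix j and x :: 'a assume "x \<in> annulus (2 powr (- real j - 1)) (2 powr - real j)"
    then have x: "2 powr (- real j - 1) < norm x" "norm x \<le> 2 powr (- real j)" unfolding annulus_def by auto
    have "2 powr - real j \<le> 2 powr 0" by (rule powr_mono) auto
    with x have 1: "norm x \<le> 1" by simp
    have x0: "norm x > 0" by (rule le_less_trans[OF _ x(1)]) simp
    have "2 powr (a * real j) = (2 powr (- real j)) powr - a" by (simp add: powr_powr algebra_simps)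
    also have "\<dots> \<le> norm x powr - a" using x x0 a by (intro powr_mono2') auto
    finally show "x \<in> cball 0 1 \<and> 2 powr (a * real j) \<le> norm x powr - a" using 1 by simp
  next
    fix i j and x :: 'a
    assume "x \<in> annulus (2 powr (- real i - 1)) (2 powr - real i)" "x \<in> annulus (2 powr (- real j - 1)) (2 powr - real j)"
    then show "i = j" using dyadic_unique[of "- real i - 1" "norm x" "- real j - 1"]
      unfolding annulus_def by (auto simp: algebra_simps)
  next
    fix j
    \<comment> \<open>Value times volume on the \<open>j\<close>-th annulus scales like
      \<open>2 powr ((a - DIM('a)) * real j)\<close>, which does not decay exactly because
      \<open>a\<close> is at least the dimension.\<close>
    have "1 - 2 powr - real DIM('a) \<le> 2 powr ((a - DIM('a)) * real j) * (1 - 2 powr - real DIM('a))"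
    proof -
      have "1 \<le> 2 powr ((a - DIM('a)) * real j)" using a by (intro ge_one_powr_ge_zero) auto
      moreover have "0 \<le> 1 - 2 powr - real DIM('a)"
        using less_imp_le[OF powr_less_one[of 2 "- real DIM('a)"]] by simp
      ultimately show ?thesis using mult_right_mono[of 1] by fastforce
    qed
    also have "\<dots> = 2 powr (a * real j) * ((2 powr - real j) ^ DIM('a) - (2 powr (- real j - 1)) ^ DIM('a))"
      by (simp add: powr_power powr_add[symmetric] algebra_simps)
    finally show "1 - 2 powr - real DIM('a) \<le> 2 powr (a * real j) * ((2 powr - real j) ^ DIM('a) - (2 powr (- real j - 1)) ^ DIM('a))" .
  qed auto
  then have le: "ennreal (real n * d) \<le> ?J" for n .
  show ?thesis
  proof (rule ccontr)
    assume "?J \<noteq> \<infinity>"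
    then obtain r where r: "r \<ge> 0" "?J = ennreal r" by (cases ?J) auto
    obtain n :: nat where "r < real n * d" using d reals_Archimedean3 by blast
    with le[of n] r show False by (simp add: ennreal_le_iff)
  qed
qed

text \<open>Logarithmic divergence: at the critical power all dyadic annuli carry a comparable
  amount, so the integral grows linearly in their number. This makes the test functions of
  \<open>exponent_necessary\<close> arbitrarily large.\<close>

lemma nn_integral_norm_powr_critical:
  "ennreal (real n * (unit_ball_vol DIM('a) * (1 - 2 powr - real DIM('a::euclidean_space))))
    \<le> (\<integral>\<^sup>+x. ennreal (norm x powr - real DIM('a)) * indicator (annulus 1 (2 powr n)) (x::'a) \<partial>lborel)"
proof (rule nn_integral_annuli_ge[where r="\<lambda>j. 2 powr (real j)" and s="\<lambda>j. 2 powr (real j + 1)"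
      and c="\<lambda>j. 2 powr (- real DIM('a) * (real j + 1))"])
  fix j and x :: 'a assume j: "j < n" and "x \<in> annulus (2 powr (real j)) (2 powr (real j + 1))"
  then have x: "2 powr (real j) < norm x" "norm x \<le> 2 powr (real j + 1)" unfolding annulus_def by auto
  have "2 powr 0 \<le> 2 powr (real j)" by (rule powr_mono) auto
  with x have 1: "norm x > 1" by simp
  have "2 powr (real j + 1) \<le> 2 powr n" using j by (intro powr_mono) auto
  with x have 2: "norm x \<le> 2 powr n" by linarith
  have "2 powr (- real DIM('a) * (real j + 1)) = (2 powr (real j + 1)) powr - real DIM('a)" by (simp add: powr_powr algebra_simps)
  also have "\<dots> \<le> norm x powr - real DIM('a)" using x 1 by (intro powr_mono2') auto
  finally show "x \<in> annulus 1 (2 powr n) \<and> 2 powr (- real DIM('a) * (real j + 1)) \<le> norm x powr - real DIM('a)"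
    using 1 2 unfolding annulus_def by simp
next
  fix i j and x :: 'a
  assume "x \<in> annulus (2 powr (real i)) (2 powr (real i + 1))" "x \<in> annulus (2 powr (real j)) (2 powr (real j + 1))"
  then show "i = j" using dyadic_unique[of "real i" "norm x" "real j"]
    unfolding annulus_def by (auto simp: algebra_simps)
qed (auto simp: powr_power powr_add[symmetric] algebra_simps)

section \<open>Polarization\<close>

text \<open>The bilinear form is needed for cross terms between a density and an approximate point
  mass. Iterated Borel integrals give direct access to Fatou's lemma and to substitutions;
  \<open>energy_eq_bienergy\<close> links them to \<open>energy\<close>.\<close>

definition bienergy :: "real \<Rightarrow> ('a::euclidean_space \<Rightarrow> real) \<Rightarrow> ('a \<Rightarrow> real) \<Rightarrow> ennreal" where
  "bienergy lam f g = (\<integral>\<^sup>+x. \<integral>\<^sup>+y. ennreal (f x * norm (x - y) powr lam * g y) \<partial>lborel \<partial>lborel)"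

text \<open>For a unit vector \<open>a\<close>, this is the reflection in the hyperplane
  \<open>a \<bullet> x = b\<close>.\<close>

definition reflect :: "'a::real_inner \<Rightarrow> real \<Rightarrow> 'a \<Rightarrow> 'a" where
  "reflect a b x = x - (2 * (a \<bullet> x - b)) *\<^sub>R a"

lemma inner_reflect: "norm a = 1 \<Longrightarrow> a \<bullet> reflect a b x - b = - (a \<bullet> x - b)"
  by (simp add: reflect_def inner_diff_right power2_norm_eq_inner[symmetric])

lemma reflect_reflect[simp]: "norm a = 1 \<Longrightarrow> reflect a b (reflect a b x) = x"
  by (simp only: reflect_def[of a b "reflect a b x"] inner_reflect mult_minus_right scaleR_minus_left)
    (simp add: reflect_def)

lemma reflect_fixed: "a \<bullet> x = b \<Longrightarrow> reflect a b x = x"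
  by (simp add: reflect_def)

text \<open>The one computation behind all facts on reflections. The sign of the product tells
  whether \<open>x\<close> and \<open>y\<close> lie on the same side of the hyperplane, hence which
  of \<open>y\<close> and its mirror image is nearer to \<open>x\<close>; the isometry property and
  the change of norm follow from the same identity.\<close>

lemma dist_reflect_sq:
  "norm a = 1 \<Longrightarrow> (dist x (reflect a b y))\<^sup>2 = (dist x y)\<^sup>2 + 4 * (a \<bullet> x - b) * (a \<bullet> y - b)"
proof -
  assume a: "norm a = 1"
  define c where "c = 2 * (a \<bullet> y - b)"
  have "x - reflect a b y = (x - y) + c *\<^sub>R a" by (simp add: reflect_def c_def)
  then have "(norm (x - reflect a b y))\<^sup>2 = ((x - y) + c *\<^sub>R a) \<bullet> ((x - y) + c *\<^sub>R a)"
    by (simp only: power2_norm_eq_inner)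
  also have "\<dots> = (x - y) \<bullet> (x - y) + 2 * c * (a \<bullet> (x - y)) + c\<^sup>2 * (a \<bullet> a)"
    by (simp only: inner_add_left inner_add_right inner_scaleR_left inner_scaleR_right inner_commute[of "x - y" a])
      (simp add: power2_eq_square algebra_simps)
  also have "\<dots> = (norm (x - y))\<^sup>2 + 2 * c * (a \<bullet> (x - y)) + c\<^sup>2"
    using a by (simp add: power2_norm_eq_inner[symmetric])
  finally have "(norm (x - reflect a b y))\<^sup>2 = (norm (x - y))\<^sup>2 + 2 * c * (a \<bullet> (x - y)) + c\<^sup>2" .
  then show ?thesis unfolding c_def dist_norm
    by (simp add: inner_diff_right power2_eq_square algebra_simps)
qed

lemma dist_reflect:
  assumes "norm a = 1" shows "dist (reflect a b x) (reflect a b y) = dist x y"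
proof -
  have "(dist (reflect a b x) (reflect a b y))\<^sup>2 = (dist (reflect a b x) y)\<^sup>2 + 4 * (a \<bullet> reflect a b x - b) * (a \<bullet> y - b)"
    by (rule dist_reflect_sq[OF assms])
  also have "(dist (reflect a b x) y)\<^sup>2 = (dist y x)\<^sup>2 + 4 * (a \<bullet> y - b) * (a \<bullet> x - b)"
    using dist_reflect_sq[OF assms, of y b x] by (simp add: dist_commute)
  finally have "(dist (reflect a b x) (reflect a b y))\<^sup>2 = (dist x y)\<^sup>2"
    unfolding inner_reflect[OF assms] by (simp add: dist_commute algebra_simps)
  then show ?thesis by simp
qed

lemma dist_reflect_swap:
  assumes "norm a = 1" shows "dist (reflect a b x) y = dist x (reflect a b y)"
  using dist_reflect[OF assms, of b x "reflect a b y"] assms by simp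

lemma norm_reflect_sq:
  assumes "norm a = 1" shows "(norm (reflect a b x))\<^sup>2 = (norm x)\<^sup>2 + 4 * b * (b - a \<bullet> x)"
  using dist_reflect_sq[OF assms, of 0 b x] by (simp add: algebra_simps)

lemma reflect_borel[measurable]: "reflect a b \<in> borel \<rightarrow>\<^sub>M (borel :: 'a::euclidean_space measure)"
  unfolding reflect_def by (intro borel_measurable_continuous_onI continuous_intros)

lemma continuous_on_reflect[continuous_intros]:
  "continuous_on S f \<Longrightarrow> continuous_on S (\<lambda>x. reflect a b (f x))"
  unfolding reflect_def by (intro continuous_intros)

lemma nn_integral_reflect:
  assumes "norm (a::'a::euclidean_space) = 1" "f \<in> borel_measurable borel"
  shows "(\<integral>\<^sup>+x. f (reflect a b x) \<partial>lborel) = (\<integral>\<^sup>+x. f x \<partial>lborel)"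
  by (rule nn_integral_isometry) (use assms dist_reflect in auto)

text \<open>Two-point symmetrization: in each mirror pair the larger value goes to the half space
  \<open>a \<bullet> x < b\<close>, which contains the origin when \<open>b > 0\<close>.\<close>

definition polarize :: "'a::real_inner \<Rightarrow> real \<Rightarrow> ('a \<Rightarrow> real) \<Rightarrow> 'a \<Rightarrow> real" where
  "polarize a b g x = (if a \<bullet> x < b then max (g x) (g (reflect a b x)) else min (g x) (g (reflect a b x)))"

lemma polarize_reflect:
  assumes "norm a = 1"
  shows "polarize a b g (reflect a b x)
    = (if a \<bullet> x < b then min (g x) (g (reflect a b x)) else max (g x) (g (reflect a b x)))"
proof (cases "a \<bullet> x = b")
  case True
  then show ?thesis by (simp add: reflect_fixed polarize_def)
next
  case False
  then show ?thesis using inner_reflect[OF assms, of b x] assms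
    by (auto simp: polarize_def max.commute min.commute)
qed

lemma polarize_borel[measurable]:
  fixes g :: "'a::euclidean_space \<Rightarrow> real"
  assumes [measurable]: "g \<in> borel_measurable borel"
  shows "polarize a b g \<in> borel_measurable borel"
  unfolding polarize_def by measurable

lemma polarize_nonneg: "(\<And>x. 0 \<le> g x) \<Longrightarrow> 0 \<le> polarize a b g x"
  by (auto simp: polarize_def intro: max.coboundedI1)

text \<open>The four products add up to \<open>(A + B) * (C + D)\<close>, which sorting the pairs
  leaves unchanged. Sorting makes \<open>A * C + B * D\<close> as large as possible, so weight moves
  from \<open>l\<close> to the smaller \<open>k\<close>.\<close>

lemma rearrangement_two_points:
  fixes A B C D k l :: real
  assumes "k \<le> l"
  shows "(max A B * max C D + min A B * min C D) * k + (max A B * min C D + min A B * max C D) * l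
    \<le> (A * C + B * D) * k + (A * D + B * C) * l"
proof -
  have 1: "0 \<le> (l - k) * ((B - A) * (C - D))" if "A \<le> B" "D \<le> C"
    using assms that by (intro mult_nonneg_nonneg) auto
  have 2: "0 \<le> (l - k) * ((A - B) * (D - C))" if "B \<le> A" "C \<le> D"
    using assms that by (intro mult_nonneg_nonneg) auto
  show ?thesis
    using 1 2 by (cases "A \<le> B"; cases "C \<le> D") (auto simp: max_def min_def algebra_simps)
qed

text \<open>Averaging over the four ways of reflecting \<open>x\<close> and \<open>y\<close> leaves
  only two kernel values, at distances \<open>x\<close> to \<open>y\<close> and \<open>x\<close> to
  the mirror image of \<open>y\<close>. The folded integrands can then be compared pointwise by
  \<open>rearrangement_two_points\<close>, since the kernel increases with distance. Nothing is
  subtracted, so infinite energies are covered.\<close>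

lemma bienergy_polarize_le:
  fixes g :: "'a::euclidean_space \<Rightarrow> real"
  assumes a: "norm a = 1" and g[measurable]: "g \<in> borel_measurable borel" and g0: "\<And>x. 0 \<le> g x" and lam: "lam > 0"
  shows "bienergy lam (polarize a b g) (polarize a b g) \<le> bienergy lam g g"
proof -
  let ?s = "reflect a b" and ?K = "\<lambda>x y::'a. norm (x - y) powr lam"
  have K1: "?K (?s x) (?s y) = ?K x y" and K2: "?K (?s x) y = ?K x (?s y)" for x y
    using dist_reflect[OF a, of b x y] dist_reflect_swap[OF a, of b x y] by (simp_all add: dist_norm)
  define S where "S h x y = (h x * h y + h (?s x) * h (?s y)) * ?K x y + (h x * h (?s y) + h (?s x) * h y) * ?K x (?s y)"
    for h :: "'a \<Rightarrow> real" and x y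
  have rx: "(\<integral>\<^sup>+x. f (?s x) \<partial>lborel) = (\<integral>\<^sup>+x. f x \<partial>lborel)" if "f \<in> borel_measurable borel" for f :: "'a \<Rightarrow> ennreal"
    using nn_integral_reflect[OF a that] .
  have four: "4 * bienergy lam h h = (\<integral>\<^sup>+x. \<integral>\<^sup>+y. ennreal (S h x y) \<partial>lborel \<partial>lborel)"
    if [measurable]: "h \<in> borel_measurable borel" and h0: "\<And>x. 0 \<le> h x" for h
  proof -
    let ?I = "bienergy lam h h"
    have i1: "?I = (\<integral>\<^sup>+x. \<integral>\<^sup>+y. ennreal (h x * h y * ?K x y) \<partial>lborel \<partial>lborel)"
      unfolding bienergy_def by (simp add: mult_ac)
    have i2: "?I = (\<integral>\<^sup>+x. \<integral>\<^sup>+y. ennreal (h x * h (?s y) * ?K x (?s y)) \<partial>lborel \<partial>lborel)"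
      unfolding i1 by (subst rx[symmetric]) auto
    have "?I = (\<integral>\<^sup>+x. \<integral>\<^sup>+y. ennreal (h (?s x) * h y * ?K (?s x) y) \<partial>lborel \<partial>lborel)"
      unfolding i1 by (rule rx[symmetric]) measurable
    then have i3: "?I = (\<integral>\<^sup>+x. \<integral>\<^sup>+y. ennreal (h (?s x) * h y * ?K x (?s y)) \<partial>lborel \<partial>lborel)"
      unfolding K2 .
    have "?I = (\<integral>\<^sup>+x. \<integral>\<^sup>+y. ennreal (h (?s x) * h (?s y) * ?K (?s x) (?s y)) \<partial>lborel \<partial>lborel)"
      unfolding i2 by (rule rx[symmetric]) measurable
    then have i4: "?I = (\<integral>\<^sup>+x. \<integral>\<^sup>+y. ennreal (h (?s x) * h (?s y) * ?K x y) \<partial>lborel \<partial>lborel)"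
      unfolding K1 .
    have "4 * ?I = ?I + ?I + ?I + ?I"
    proof -
      have "(4::ennreal) = 1 + 1 + 1 + 1" by simp
      then show ?thesis by (simp only: distrib_right mult_1)
    qed
    also have "\<dots> = (\<integral>\<^sup>+x. (\<integral>\<^sup>+y. ennreal (h x * h y * ?K x y) + ennreal (h (?s x) * h (?s y) * ?K x y)
       + ennreal (h x * h (?s y) * ?K x (?s y)) + ennreal (h (?s x) * h y * ?K x (?s y)) \<partial>lborel) \<partial>lborel)"
      apply (subst (1) i1, subst (1) i4, subst (1) i2, subst (1) i3)
      apply (simp add: nn_integral_add)
      done
    also have "\<dots> = (\<integral>\<^sup>+x. \<integral>\<^sup>+y. ennreal (S h x y) \<partial>lborel \<partial>lborel)"
      unfolding S_def using h0
      by (intro nn_integral_cong) (simp add: ennreal_plus[symmetric] algebra_simps del: ennreal_plus)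
    finally show ?thesis .
  qed
  have le: "S (polarize a b g) x y \<le> S g x y" for x y
  proof -
    let ?A = "g x" and ?B = "g (?s x)" and ?C = "g y" and ?D = "g (?s y)"
    let ?k = "?K x y" and ?l = "?K x (?s y)"
    have d: "(dist x (?s y))\<^sup>2 = (dist x y)\<^sup>2 + 4 * ((a \<bullet> x - b) * (a \<bullet> y - b))"
      using dist_reflect_sq[OF a, of x b y] by (simp add: mult_ac)
    have kl: "?k \<le> ?l" if "0 \<le> (a \<bullet> x - b) * (a \<bullet> y - b)"
    proof -
      have "(dist x y)\<^sup>2 \<le> (dist x (?s y))\<^sup>2" using d that by linarith
      then show ?thesis using lam by (auto simp: dist_norm intro!: powr_mono2)
    qed
    have lk: "?l \<le> ?k" if "(a \<bullet> x - b) * (a \<bullet> y - b) \<le> 0"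
    proof -
      have "(dist x (?s y))\<^sup>2 \<le> (dist x y)\<^sup>2" using d that by linarith
      then show ?thesis using lam by (auto simp: dist_norm intro!: powr_mono2)
    qed
    note px = polarize_def[of a b g x] polarize_reflect[OF a, of b g x] polarize_def[of a b g y] polarize_reflect[OF a, of b g y]
    consider "a \<bullet> x < b" "a \<bullet> y < b" | "a \<bullet> x < b" "\<not> a \<bullet> y < b" | "\<not> a \<bullet> x < b" "a \<bullet> y < b" | "\<not> a \<bullet> x < b" "\<not> a \<bullet> y < b"
      by blast
    then show ?thesis
    proof cases
      case 1
      then have "?k \<le> ?l" by (intro kl mult_nonpos_nonpos) auto
      from rearrangement_two_points[OF this, of ?A ?B ?C ?D] show ?thesis
        unfolding S_def px using 1 by (simp add: algebra_simps)
    next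
      case 2
      \<comment> \<open>For points on different sides the mirror image of \<open>y\<close> is the
        nearer one, so the roles of the kernels, and with them \<open>?C\<close> and
        \<open>?D\<close>, are exchanged.\<close>
      then have "?l \<le> ?k" by (intro lk mult_nonpos_nonneg) auto
      from rearrangement_two_points[OF this, of ?A ?B ?D ?C] show ?thesis
        unfolding S_def px using 2 by (simp add: algebra_simps max.commute[of ?C] min.commute[of ?C])
    next
      case 3
      then have "?l \<le> ?k" by (intro lk mult_nonneg_nonpos) auto
      from rearrangement_two_points[OF this, of ?A ?B ?D ?C] show ?thesis
        unfolding S_def px using 3 by (simp add: algebra_simps max.commute[of ?C] min.commute[of ?C])
    next
      case 4
      then have "?k \<le> ?l" by (intro kl mult_nonneg_nonneg) auto
      from rearrangement_two_points[OF this, of ?A ?B ?C ?D] show ?thesis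
        unfolding S_def px using 4 by (simp add: algebra_simps)
    qed
  qed
  have "4 * bienergy lam (polarize a b g) (polarize a b g) \<le> 4 * bienergy lam g g"
    unfolding four[OF g g0] four[OF polarize_borel[OF g] polarize_nonneg[OF g0]]
    by (intro nn_integral_mono ennreal_leI le)
  then show ?thesis by (subst (asm) ennreal_mult_le_mult_iff) auto
qed

lemma nn_integral_add_reflect:
  fixes f :: "'a::euclidean_space \<Rightarrow> ennreal"
  assumes "norm a = 1" and [measurable]: "f \<in> borel_measurable borel"
  shows "(\<integral>\<^sup>+x. f x + f (reflect a b x) \<partial>lborel) = 2 * (\<integral>\<^sup>+x. f x \<partial>lborel)"
  using nn_integral_reflect[of a f b] assms by (subst nn_integral_add) (auto simp: mult_2)

text \<open>Polarization only permutes the two values in each mirror pair. A general \<phi> treats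
  the mass and the \<open>q\<close>-mass at once.\<close>

lemma nn_integral_polarize:
  fixes g :: "'a::euclidean_space \<Rightarrow> real" and \<phi> :: "real \<Rightarrow> ennreal"
  assumes a: "norm a = 1" and [measurable]: "g \<in> borel_measurable borel" "\<phi> \<in> borel_measurable borel"
  shows "(\<integral>\<^sup>+x. \<phi> (polarize a b g x) \<partial>lborel) = (\<integral>\<^sup>+x. \<phi> (g x) \<partial>lborel)"
proof -
  have "2 * (\<integral>\<^sup>+x. \<phi> (polarize a b g x) \<partial>lborel)
      = (\<integral>\<^sup>+x. \<phi> (polarize a b g x) + \<phi> (polarize a b g (reflect a b x)) \<partial>lborel)"
    by (rule nn_integral_add_reflect[OF a, symmetric]) measurable
  also have "\<dots> = (\<integral>\<^sup>+x. \<phi> (g x) + \<phi> (g (reflect a b x)) \<partial>lborel)"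
    unfolding polarize_reflect[OF a]
    by (intro nn_integral_cong) (auto simp: polarize_def max_def min_def add.commute)
  also have "\<dots> = 2 * (\<integral>\<^sup>+x. \<phi> (g x) \<partial>lborel)"
    by (rule nn_integral_add_reflect[OF a]) measurable
  finally show ?thesis by (simp add: ennreal_mult_cancel_left)
qed

text \<open>If \<open>x\<close> and \<open>y\<close> lie on different sides, the mirror image of
  \<open>y\<close> is at least as close to \<open>x\<close> as \<open>y\<close> is. All values that
  enter the maxima and minima are therefore within \<open>e\<close> of each other in matching pairs.
  This keeps polarized functions in an equicontinuous class.\<close>

lemma polarize_modulus:
  assumes a: "norm a = 1" and g: "\<And>x y. dist x y \<le> d \<Longrightarrow> \<bar>g x - g y\<bar> \<le> e" and xy: "dist x y \<le> d"
  shows "\<bar>polarize a b g x - polarize a b g y\<bar> \<le> e"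
proof -
  let ?s = "reflect a b"
  have 1: "\<bar>g x - g y\<bar> \<le> e" "\<bar>g (?s x) - g (?s y)\<bar> \<le> e"
    using g xy dist_reflect[OF a] by auto
  show ?thesis
  proof (cases "(a \<bullet> x < b) = (a \<bullet> y < b)")
    case True
    then show ?thesis using 1 by (auto simp: polarize_def max_def min_def)
  next
    case False
    then have "(a \<bullet> x - b) * (a \<bullet> y - b) \<le> 0"
      by (auto simp: mult_le_0_iff)
    then have "(dist x (?s y))\<^sup>2 \<le> (dist x y)\<^sup>2"
      using dist_reflect_sq[OF a, of x b y] by (simp add: mult.assoc del: right_diff_distrib_numeral left_diff_distrib_numeral)
    then have "dist x (?s y) \<le> d" using xy by (auto intro: order_trans[rotated])
    then have 2: "\<bar>g x - g (?s y)\<bar> \<le> e" "\<bar>g (?s x) - g y\<bar> \<le> e"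
      using g dist_reflect_swap[OF a, of b x y] by auto
    then show ?thesis using False 1 by (auto simp: polarize_def max_def min_def)
  qed
qed

text \<open>For \<open>b > 0\<close> a point on the origin's side has norm at most that of its
  mirror image, so nonzero values never move outward.\<close>

lemma polarize_support:
  assumes a: "norm a = 1" and b: "b > 0" and g: "\<And>x. norm x > R \<Longrightarrow> g x = 0" "\<And>x. 0 \<le> g x" and x: "norm x > R" "R \<ge> 0"
  shows "polarize a b g x = 0"
proof (cases "a \<bullet> x < b")
  case True
  then have "(norm x)\<^sup>2 \<le> (norm (reflect a b x))\<^sup>2"
    using norm_reflect_sq[OF a, of b x] b by simp
  then have "norm x \<le> norm (reflect a b x)" by simp
  then show ?thesis using True g(1) x by (simp add: polarize_def)
next
  case False
  then show ?thesis using g x by (simp add: polarize_def min_absorb1)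
qed

section \<open>Symmetrization\<close>

lemma uniformly_continuous_modulus:
  fixes f :: "'a::metric_space \<Rightarrow> real"
  assumes f: "uniformly_continuous_on UNIV f" and e: "e > 0"
  obtains d where "d > 0" "\<And>x y. dist x y \<le> d \<Longrightarrow> \<bar>f x - f y\<bar> \<le> e"
proof -
  obtain d where d: "d > 0" "\<And>x y. dist x y < d \<Longrightarrow> dist (f x) (f y) < e"
    using f e unfolding uniformly_continuous_on_def by (metis UNIV_I dist_commute)
  have "\<bar>f x - f y\<bar> \<le> e" if "dist x y \<le> d / 2" for x y
    using d(2)[of x y] that d(1) by (auto simp: dist_real_def)
  then show ?thesis using that[of "d/2"] d(1) by auto
qed

lemma uniformly_continuous_compact_support:
  fixes f :: "'a::euclidean_space \<Rightarrow> real"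
  assumes f: "continuous_on UNIV f" and s: "\<And>x. norm x > R \<Longrightarrow> f x = 0"
  shows "uniformly_continuous_on UNIV f"
  unfolding uniformly_continuous_on_def
proof (intro allI impI)
  fix e :: real assume e: "e > 0"
  have "uniformly_continuous_on (cball 0 (R + 1)) f"
    by (rule compact_uniformly_continuous) (use f continuous_on_subset in auto)
  then obtain d where d: "d > 0" "\<And>x y. x \<in> cball 0 (R+1) \<Longrightarrow> y \<in> cball 0 (R+1) \<Longrightarrow> dist y x < d \<Longrightarrow> dist (f y) (f x) < e"
    using e unfolding uniformly_continuous_on_def by metis
  have "dist (f y) (f x) < e" if xy: "dist y x < min d 1" for x y
  proof (cases "x \<in> cball 0 (R+1) \<and> y \<in> cball 0 (R+1)")
    case True
    then show ?thesis using d xy by auto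
  next
    case False
    have "norm x \<le> norm y + dist y x" "norm y \<le> norm x + dist y x"
      using norm_triangle_sub[of x y] norm_triangle_sub[of y x] by (auto simp: dist_norm norm_minus_commute)
    then have "norm x > R" "norm y > R" using False xy by auto
    then show ?thesis using s e by auto
  qed
  then show "\<exists>d>0. \<forall>x\<in>UNIV. \<forall>x'\<in>UNIV. dist x' x < d \<longrightarrow> dist (f x') (f x) < e"
    using d(1) by (intro exI[of _ "min d 1"]) auto
qed

lemma compact_support_nn_integral_bound:
  "(\<integral>\<^sup>+x. ennreal B * indicator (cball 0 R) (x::'a::euclidean_space) \<partial>lborel) < \<infinity>"
  using emeasure_lborel_cball_finite[of "0::'a" R]
  by (simp add: nn_integral_cmult_indicator ennreal_mult_less_top)

lemma nn_integral_compact_support_limit: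
  fixes u :: "nat \<Rightarrow> 'a::euclidean_space \<Rightarrow> real"
  assumes [measurable]: "\<And>n. u n \<in> borel_measurable borel" "v \<in> borel_measurable borel"
    and lim: "AE x in lborel. (\<lambda>n. u n x) \<longlonglongrightarrow> v x"
    and B: "\<And>n x. u n x \<le> B" and s: "\<And>n x. norm x > R \<Longrightarrow> u n x = 0"
  shows "(\<lambda>n. \<integral>\<^sup>+x. ennreal (u n x) \<partial>lborel) \<longlonglongrightarrow> (\<integral>\<^sup>+x. ennreal (v x) \<partial>lborel)"
proof (rule nn_integral_dominated_convergence[where w="\<lambda>x. ennreal B * indicator (cball 0 R) x"])
  show "AE x in lborel. ennreal (u j x) \<le> ennreal B * indicator (cball 0 R) x" for j
    using B s by (auto simp: indicator_def intro!: ennreal_leI)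
  show "AE x in lborel. (\<lambda>i. ennreal (u i x)) \<longlonglongrightarrow> ennreal (v x)"
    using lim by eventually_elim (auto intro: tendsto_ennrealI)
next
  have "cball 0 R \<in> sets (borel :: 'a measure)" by auto
  then show "(\<lambda>x::'a. ennreal B * indicator (cball 0 R) x) \<in> borel_measurable lborel" by measurable
qed (use compact_support_nn_integral_bound[of B R] in auto)

lemma bienergy_Fatou:
  fixes u :: "nat \<Rightarrow> 'a::euclidean_space \<Rightarrow> real"
  assumes [measurable]: "\<And>n. u n \<in> borel_measurable borel" and u0: "\<And>n x. 0 \<le> u n x"
    and lim: "AE x in lborel. (\<lambda>n. u n x) \<longlonglongrightarrow> v x"
  shows "bienergy lam v v \<le> liminf (\<lambda>n. bienergy lam (u n) (u n))"
proof -
  have "bienergy lam v v \<le> (\<integral>\<^sup>+x. liminf (\<lambda>n. \<integral>\<^sup>+y. ennreal (u n x * norm (x - y) powr lam * u n y) \<partial>lborel) \<partial>lborel)"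
    unfolding bienergy_def
  proof (rule nn_integral_mono_AE, use lim in eventually_elim)
    fix x assume x: "(\<lambda>n. u n x) \<longlonglongrightarrow> v x"
    have "(\<integral>\<^sup>+y. ennreal (v x * norm (x - y) powr lam * v y) \<partial>lborel)
      = (\<integral>\<^sup>+y. liminf (\<lambda>n. ennreal (u n x * norm (x - y) powr lam * u n y)) \<partial>lborel)"
    proof (rule nn_integral_cong_AE, use lim in eventually_elim)
      fix y assume y: "(\<lambda>n. u n y) \<longlonglongrightarrow> v y"
      have "(\<lambda>n. ennreal (u n x * norm (x - y) powr lam * u n y)) \<longlonglongrightarrow> ennreal (v x * norm (x - y) powr lam * v y)"
        by (intro tendsto_ennrealI tendsto_mult x y tendsto_const)
      then show "ennreal (v x * norm (x - y) powr lam * v y) = liminf (\<lambda>n. ennreal (u n x * norm (x - y) powr lam * u n y))"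
        by (intro lim_imp_Liminf[symmetric]) auto
    qed
    also have "\<dots> \<le> liminf (\<lambda>n. \<integral>\<^sup>+y. ennreal (u n x * norm (x - y) powr lam * u n y) \<partial>lborel)"
      by (rule nn_integral_liminf) measurable
    finally show "(\<integral>\<^sup>+y. ennreal (v x * norm (x - y) powr lam * v y) \<partial>lborel)
      \<le> liminf (\<lambda>n. \<integral>\<^sup>+y. ennreal (u n x * norm (x - y) powr lam * u n y) \<partial>lborel)" .
  qed
  also have "\<dots> \<le> liminf (\<lambda>n. bienergy lam (u n) (u n))"
    unfolding bienergy_def by (rule nn_integral_liminf) measurable
  finally show ?thesis .
qed

text \<open>Among the functions that share the modulus of continuity, the support radius and the distribution
  of \<open>f\<close> and have no larger energy, one minimises the second moment; no polarization with respect to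
  a half space around the origin can lower that moment further, and this forces radial monotonicity.\<close>

theorem symmetrization:
  fixes f :: "'a::euclidean_space \<Rightarrow> real"
  assumes fc: "continuous_on UNIV f" and f0: "\<And>x. 0 \<le> f x" and fs: "\<And>x. norm x > R \<Longrightarrow> f x = 0" and R: "R \<ge> 0"
    and lam: "lam > 0" and q: "q > 0"
  obtains g :: "'a \<Rightarrow> real" where "continuous_on UNIV g" "\<And>x. 0 \<le> g x" "\<And>x. norm x > R \<Longrightarrow> g x = 0"
    "\<And>x y. norm x \<le> norm y \<Longrightarrow> g y \<le> g x"
    "(\<integral>\<^sup>+x. ennreal (g x) \<partial>lborel) = (\<integral>\<^sup>+x. ennreal (f x) \<partial>lborel)"
    "(\<integral>\<^sup>+x. ennreal (g x powr q) \<partial>lborel) = (\<integral>\<^sup>+x. ennreal (f x powr q) \<partial>lborel)"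
    "bienergy lam g g \<le> bienergy lam f f"
proof -
  have fu: "uniformly_continuous_on UNIV f" by (rule uniformly_continuous_compact_support[OF fc fs])
  have "compact (f ` cball 0 R)" by (intro compact_continuous_image continuous_on_subset[OF fc]) auto
  then obtain B0 where B0: "\<And>x. x \<in> cball 0 R \<Longrightarrow> norm (f x) \<le> B0"
    by (metis bounded_iff compact_imp_bounded imageI)
  define B where "B = max B0 0"
  have fB: "f x \<le> B" for x using B0[of x] fs[of x] unfolding B_def by (cases "norm x > R") auto
  \<comment> \<open>Quantifying over all pairs \<open>d\<close>, \<open>e\<close> valid for
    \<open>f\<close> imposes its whole modulus of continuity without naming one. Every condition in
    \<open>S\<close> survives polarization and pointwise limits.\<close>
  define S where "S = {g::'a \<Rightarrow> real. (\<forall>x. 0 \<le> g x) \<and> (\<forall>x. g x \<le> B) \<and> (\<forall>x. norm x > R \<longrightarrow> g x = 0) \<and>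
    (\<forall>d e. (\<forall>x y. dist x y \<le> d \<longrightarrow> \<bar>f x - f y\<bar> \<le> e) \<longrightarrow> (\<forall>x y. dist x y \<le> d \<longrightarrow> \<bar>g x - g y\<bar> \<le> e)) \<and>
    (\<integral>\<^sup>+x. ennreal (g x) \<partial>lborel) = (\<integral>\<^sup>+x. ennreal (f x) \<partial>lborel) \<and>
    (\<integral>\<^sup>+x. ennreal (g x powr q) \<partial>lborel) = (\<integral>\<^sup>+x. ennreal (f x powr q) \<partial>lborel) \<and>
    bienergy lam g g \<le> bienergy lam f f}"
  have fS: "f \<in> S" unfolding S_def using f0 fB fs by auto
  have equi: "\<exists>d>0. \<forall>g\<in>S. \<forall>x y. dist x y \<le> d \<longrightarrow> \<bar>g x - g y\<bar> \<le> e" if "e > 0" for e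
  proof -
    obtain d where d: "d > 0" "\<And>x y. dist x y \<le> d \<Longrightarrow> \<bar>f x - f y\<bar> \<le> e"
      using uniformly_continuous_modulus[OF fu \<open>e > 0\<close>] by metis
    then show ?thesis unfolding S_def by (intro exI[of _ d]) blast
  qed
  have Sc: "continuous_on UNIV g" if "g \<in> S" for g
    unfolding continuous_on_iff
  proof (intro ballI allI impI)
    fix x :: 'a and e :: real assume "e > 0"
    then obtain d where "d > 0" "\<And>x y. dist x y \<le> d \<Longrightarrow> \<bar>g x - g y\<bar> \<le> e / 2" using equi[of "e/2"] \<open>g \<in> S\<close> by auto
    then show "\<exists>d>0. \<forall>x'\<in>UNIV. dist x' x < d \<longrightarrow> dist (g x') (g x) < e"
      using \<open>e > 0\<close> by (intro exI[of _ d]) (auto simp: dist_real_def intro: le_less_trans[of _ "e / 2"])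
  qed
  have Sm: "g \<in> borel_measurable borel" if "g \<in> S" for g
    using Sc[OF that] by (rule borel_measurable_continuous_onI)
  have pol: "polarize a b g \<in> S" if g: "g \<in> S" and a: "norm a = 1" and b: "b > 0" for a b g
  proof -
    note [measurable] = Sm[OF g]
    have g0: "\<And>x. 0 \<le> g x" and gB: "\<And>x. g x \<le> B" and gs: "\<And>x. norm x > R \<Longrightarrow> g x = 0"
      and gm: "\<And>d e. (\<And>x y. dist x y \<le> d \<Longrightarrow> \<bar>f x - f y\<bar> \<le> e) \<Longrightarrow> (\<And>x y. dist x y \<le> d \<Longrightarrow> \<bar>g x - g y\<bar> \<le> e)"
      and gi: "(\<integral>\<^sup>+x. ennreal (g x) \<partial>lborel) = (\<integral>\<^sup>+x. ennreal (f x) \<partial>lborel)"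
        "(\<integral>\<^sup>+x. ennreal (g x powr q) \<partial>lborel) = (\<integral>\<^sup>+x. ennreal (f x powr q) \<partial>lborel)"
        "bienergy lam g g \<le> bienergy lam f f"
      using g unfolding S_def by blast+
    show ?thesis
      unfolding S_def mem_Collect_eq
    proof (intro conjI allI impI)
      fix x :: 'a
      show "0 \<le> polarize a b g x" by (rule polarize_nonneg[OF g0])
      show "polarize a b g x \<le> B" using gB by (auto simp: polarize_def intro: min.coboundedI1)
      show "norm x > R \<Longrightarrow> polarize a b g x = 0" by (rule polarize_support[OF a b gs g0 _ R]) auto
    next
      fix d e :: real and x y :: 'a
      assume h: "\<forall>x y. dist x y \<le> d \<longrightarrow> \<bar>f x - f y\<bar> \<le> e" "dist x y \<le> d"
      show "\<bar>polarize a b g x - polarize a b g y\<bar> \<le> e"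
        by (rule polarize_modulus[OF a gm]) (use h in auto)
    next
      show "(\<integral>\<^sup>+x. ennreal (polarize a b g x) \<partial>lborel) = (\<integral>\<^sup>+x. ennreal (f x) \<partial>lborel)"
        using nn_integral_polarize[OF a, of g ennreal b] gi by simp
      show "(\<integral>\<^sup>+x. ennreal (polarize a b g x powr q) \<partial>lborel) = (\<integral>\<^sup>+x. ennreal (f x powr q) \<partial>lborel)"
        using nn_integral_polarize[OF a, of g "\<lambda>t. ennreal (t powr q)" b] gi by simp
      show "bienergy lam (polarize a b g) (polarize a b g) \<le> bienergy lam f f"
        using bienergy_polarize_le[where g=g, OF a _ g0 lam, where b=b] gi by auto
    qed
  qed
  define J where "J g = (\<integral>\<^sup>+x. ennreal ((norm x)\<^sup>2 * g x) \<partial>lborel)" for g :: "'a \<Rightarrow> real"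
  have Jbound: "(norm x)\<^sup>2 * g x \<le> R\<^sup>2 * B" if "g \<in> S" for g and x :: 'a
  proof (cases "norm x > R")
    case False
    then show ?thesis using that unfolding S_def by (intro mult_mono power_mono) (auto simp: B_def)
  qed (use that R in \<open>auto simp: S_def B_def\<close>)
  have Jfin: "J g < \<infinity>" if "g \<in> S" for g
  proof -
    have "J g \<le> (\<integral>\<^sup>+x. ennreal (R\<^sup>2 * B) * indicator (cball 0 R) (x::'a) \<partial>lborel)"
      unfolding J_def using Jbound[OF that] that
      by (intro nn_integral_mono) (auto simp: indicator_def S_def intro!: ennreal_leI)
    then show ?thesis using compact_support_nn_integral_bound[of "R\<^sup>2 * B" R] by (rule le_less_trans)
  qed
  have "\<exists>F::nat \<Rightarrow> ennreal. decseq F \<and> range F \<subseteq> J ` S \<and> Inf (J ` S) = (INF i. F i)"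
    using fS by (intro ennreal_Inf_countable_INF) auto
  then obtain F :: "nat \<Rightarrow> ennreal" where F: "decseq F" "range F \<subseteq> J ` S" "Inf (J ` S) = (INF i. F i)" by blast
  have "\<forall>n. \<exists>g. g \<in> S \<and> F n = J g" using F(2) by (metis imageE range_subsetD)
  then obtain G where G: "\<And>n. G n \<in> S" "\<And>n. F n = J (G n)" by metis
  have JG: "(\<lambda>n. J (G n)) \<longlonglongrightarrow> Inf (J ` S)" using LIMSEQ_INF[OF F(1)] unfolding F(3) G(2) .
  obtain h k where hk: "strict_mono (k :: nat \<Rightarrow> nat)"
    "\<And>e. 0 < e \<Longrightarrow> \<exists>N. \<forall>n x. n \<ge> N \<and> x \<in> cball 0 R \<longrightarrow> norm (G (k n) x - h x) < e"
  proof (rule Arzela_Ascoli[of "cball 0 R" G B])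
    show "norm (G n x) \<le> B" for n x using G(1)[of n] unfolding S_def by auto
    show "\<exists>d>0. \<forall>n y. y \<in> cball 0 R \<and> norm (x - y) < d \<longrightarrow> norm (G n x - G n y) < e" if "0 < e" for x e
    proof -
      obtain d where d: "d > 0" "\<forall>g\<in>S. \<forall>x y. dist x y \<le> d \<longrightarrow> \<bar>g x - g y\<bar> \<le> e / 2" using equi[of "e/2"] \<open>0 < e\<close> by auto
      have "norm (G n x - G n y) < e" if "norm (x - y) < d" for n y
      proof -
        have "\<bar>G n x - G n y\<bar> \<le> e / 2" using d(2) G(1)[of n] that by (auto simp: dist_norm)
        then show ?thesis using \<open>0 < e\<close> by simp
      qed
      then show ?thesis using d(1) by blast
    qed
  qed auto
  define g where "g x = (if norm x \<le> R then h x else 0)" for x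
  have lim: "(\<lambda>n. G (k n) x) \<longlonglongrightarrow> g x" for x
  proof (cases "norm x \<le> R")
    case True
    show ?thesis
    proof (rule LIMSEQ_I)
      fix e :: real assume "e > 0"
      then show "\<exists>no. \<forall>n\<ge>no. norm (G (k n) x - g x) < e" using hk(2)[of e] True unfolding g_def by force
    qed
  next
    case False
    then have "G (k n) x = 0" for n using G(1)[of "k n"] unfolding S_def by auto
    then show ?thesis using False unfolding g_def by simp
  qed
  have GS: "\<And>n x. 0 \<le> G n x" "\<And>n x. G n x \<le> B" "\<And>n x. norm x > R \<Longrightarrow> G n x = 0"
    "\<And>n d e x y. (\<forall>x y. dist x y \<le> d \<longrightarrow> \<bar>f x - f y\<bar> \<le> e) \<Longrightarrow> dist x y \<le> d \<Longrightarrow> \<bar>G n x - G n y\<bar> \<le> e"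
    "\<And>n. (\<integral>\<^sup>+x. ennreal (G n x) \<partial>lborel) = (\<integral>\<^sup>+x. ennreal (f x) \<partial>lborel)"
    "\<And>n. (\<integral>\<^sup>+x. ennreal (G n x powr q) \<partial>lborel) = (\<integral>\<^sup>+x. ennreal (f x powr q) \<partial>lborel)"
    "\<And>n. bienergy lam (G n) (G n) \<le> bienergy lam f f"
    using G(1) unfolding S_def by blast+
  have [measurable]: "G n \<in> borel_measurable borel" for n by (rule Sm[OF G(1)])
  have [measurable]: "g \<in> borel_measurable borel" by (rule borel_measurable_LIMSEQ_real[OF lim]) auto
  have gS: "g \<in> S"
    unfolding S_def mem_Collect_eq
  proof (intro conjI allI impI)
    fix x :: 'a
    show "0 \<le> g x" by (rule LIMSEQ_le_const[OF lim]) (use GS in auto)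
    show "g x \<le> B" by (rule LIMSEQ_le_const2[OF lim]) (use GS in auto)
    show "norm x > R \<Longrightarrow> g x = 0" unfolding g_def by auto
  next
    fix d e :: real and x y :: 'a
    assume h: "\<forall>x y. dist x y \<le> d \<longrightarrow> \<bar>f x - f y\<bar> \<le> e" "dist x y \<le> d"
    have "(\<lambda>n. \<bar>G (k n) x - G (k n) y\<bar>) \<longlonglongrightarrow> \<bar>g x - g y\<bar>" by (intro tendsto_intros lim)
    then show "\<bar>g x - g y\<bar> \<le> e"
      by (rule LIMSEQ_le_const2) (use GS(4)[OF h(1)] h(2) in blast)
  next
    have "(\<lambda>n. \<integral>\<^sup>+x. ennreal (G (k n) x) \<partial>lborel) \<longlonglongrightarrow> (\<integral>\<^sup>+x. ennreal (g x) \<partial>lborel)"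
      by (rule nn_integral_compact_support_limit[where B=B and R=R]) (use GS lim in auto)
    then show "(\<integral>\<^sup>+x. ennreal (g x) \<partial>lborel) = (\<integral>\<^sup>+x. ennreal (f x) \<partial>lborel)"
      unfolding GS by (simp add: LIMSEQ_const_iff)
    have "(\<lambda>n. G (k n) x powr q) \<longlonglongrightarrow> g x powr q" for x
      by (rule tendsto_powr'[OF lim tendsto_const]) (use GS q in auto)
    then have "(\<lambda>n. \<integral>\<^sup>+x. ennreal (G (k n) x powr q) \<partial>lborel) \<longlonglongrightarrow> (\<integral>\<^sup>+x. ennreal (g x powr q) \<partial>lborel)"
      by (intro nn_integral_compact_support_limit[where B="B powr q" and R=R]) (use GS q in \<open>auto intro: powr_mono2\<close>)
    then show "(\<integral>\<^sup>+x. ennreal (g x powr q) \<partial>lborel) = (\<integral>\<^sup>+x. ennreal (f x powr q) \<partial>lborel)"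
      unfolding GS by (simp add: LIMSEQ_const_iff)
    have "bienergy lam g g \<le> liminf (\<lambda>n. bienergy lam (G (k n)) (G (k n)))"
      by (rule bienergy_Fatou) (use GS lim in auto)
    also have "\<dots> \<le> liminf (\<lambda>n::nat. bienergy lam f f)"
      by (intro Liminf_mono) (use GS in auto)
    finally show "bienergy lam g g \<le> bienergy lam f f" by (simp add: Liminf_const)
  qed
  have Jg: "J g \<le> J u" if "u \<in> S" for u
  proof -
    have "(\<lambda>n. J (G (k n))) \<longlonglongrightarrow> J g"
      unfolding J_def
    proof (rule nn_integral_compact_support_limit[where B="R\<^sup>2 * B" and R=R])
      show "AE x in lborel. (\<lambda>n. (norm x)\<^sup>2 * G (k n) x) \<longlonglongrightarrow> (norm x)\<^sup>2 * g x"
        by (intro AE_I2 tendsto_intros lim)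
    qed (use Jbound[OF G(1)] GS in auto)
    moreover have "(\<lambda>n. J (G (k n))) \<longlonglongrightarrow> Inf (J ` S)"
      using LIMSEQ_subseq_LIMSEQ[OF JG hk(1)] by (simp add: o_def)
    ultimately have "J g = Inf (J ` S)" by (rule LIMSEQ_unique)
    then show ?thesis using that by (simp add: Inf_lower)
  qed
  have mono: "g y \<le> g x" if xy: "norm x < norm y" for x y
  proof (rule ccontr)
    assume neg: "\<not> g y \<le> g x"
    have ne: "norm (y - x) > 0" using xy by auto
    \<comment> \<open>The hyperplane is the perpendicular bisector of the segment from
      \<open>x\<close> to \<open>y\<close>. That the origin lies on the side of \<open>x\<close>,
      that is \<open>b > 0\<close>, expresses \<open>norm x < norm y\<close>.\<close>
    define a where "a = (1 / norm (y - x)) *\<^sub>R (y - x)"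
    define b where "b = ((norm y)\<^sup>2 - (norm x)\<^sup>2) / (2 * norm (y - x))"
    have a: "norm a = 1" unfolding a_def using ne by simp
    have "(norm x)\<^sup>2 < (norm y)\<^sup>2" using xy by (simp add: power_strict_mono)
    then have b: "b > 0" unfolding b_def using ne by simp
    have ax: "a \<bullet> x - b = - norm (y - x) / 2"
    proof -
      have "a \<bullet> x = ((y - x) \<bullet> x) / norm (y - x)" unfolding a_def by simp
      moreover have "(norm (y - x))\<^sup>2 = (norm y)\<^sup>2 - (norm x)\<^sup>2 - 2 * ((y - x) \<bullet> x)"
        unfolding power2_norm_eq_inner by (simp add: inner_diff_left inner_diff_right inner_commute)
      ultimately show ?thesis unfolding b_def using ne by (simp add: field_simps power2_eq_square)
    qed
    have sx: "reflect a b x = y"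
      unfolding reflect_def ax using ne by (simp add: a_def)
    let ?p = "polarize a b g" and ?s = "reflect a b"
    have pS: "?p \<in> S" by (rule pol[OF gS a b])
    note [measurable] = Sm[OF gS] Sm[OF pS]
    define u where "u w x = (norm x)\<^sup>2 * w x + (norm (?s x))\<^sup>2 * w (?s x)" for w :: "'a \<Rightarrow> real" and x
    have uJ: "(\<integral>\<^sup>+x. ennreal (u w x) \<partial>lborel) = 2 * J w" if w: "w \<in> S" for w
    proof -
      note [measurable] = Sm[OF w]
      have w0: "0 \<le> w x" for x using w unfolding S_def by auto
      have "2 * J w = (\<integral>\<^sup>+x. ennreal ((norm x)\<^sup>2 * w x) + ennreal ((norm (?s x))\<^sup>2 * w (?s x)) \<partial>lborel)"
        unfolding J_def by (rule nn_integral_add_reflect[OF a, symmetric]) measurable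
      then show ?thesis unfolding u_def using w0 by simp
    qed
    have [measurable]: "u g \<in> borel_measurable borel" "u ?p \<in> borel_measurable borel"
      unfolding u_def by measurable
    \<comment> \<open>Both branches are nonnegative, since polarization places the larger value of
      each pair at the point of smaller norm.\<close>
    have diff: "u g z - u ?p z = (if a \<bullet> z < b then 4 * b * (b - a \<bullet> z) * (max (g z) (g (?s z)) - g z)
        else 4 * b * (a \<bullet> z - b) * (max (g z) (g (?s z)) - g (?s z)))" for z
    proof -
      have n: "(norm (?s z))\<^sup>2 = (norm z)\<^sup>2 + 4 * b * (b - a \<bullet> z)" by (rule norm_reflect_sq[OF a])
      show ?thesis
        unfolding u_def polarize_reflect[OF a] n by (auto simp: polarize_def max_def min_def algebra_simps)
    qed
    have le: "u ?p z \<le> u g z" for z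
    proof -
      have "0 \<le> u g z - u ?p z" unfolding diff using b by (auto intro!: mult_nonneg_nonneg)
      then show ?thesis by simp
    qed
    have cu: "continuous_on UNIV (u g)" "continuous_on UNIV (u ?p)"
    proof -
      have "continuous_on UNIV (u w)" if "w \<in> S" for w
      proof -
        have "continuous_on UNIV (\<lambda>x. w (?s x))"
          by (rule continuous_on_compose2[OF Sc[OF that]]) (auto intro!: continuous_intros)
        then show ?thesis unfolding u_def by (intro continuous_intros Sc[OF that])
      qed
      then show "continuous_on UNIV (u g)" "continuous_on UNIV (u ?p)" using gS pS by auto
    qed
    have "a \<bullet> x < b" using ax ne by linarith
    moreover have "g x < g (?s x)" using neg sx by auto
    ultimately have pos: "u ?p x < u g x"
      using diff[of x] b by (smt (verit, best) mult_pos_pos)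
    have "2 * J ?p < \<infinity>" using Jfin[OF pS] by (simp add: ennreal_mult_less_top)
    have up0: "0 \<le> u ?p z" for z using pS unfolding u_def S_def by auto
    have "(\<integral>\<^sup>+x. ennreal (u g x - u ?p x) \<partial>lborel) = (\<integral>\<^sup>+x. ennreal (u g x) - ennreal (u ?p x) \<partial>lborel)"
      by (intro nn_integral_cong ennreal_minus[symmetric] up0)
    also have "\<dots> = 2 * J g - 2 * J ?p"
      unfolding uJ[OF gS, symmetric] uJ[OF pS, symmetric]
      by (rule nn_integral_diff) (use le uJ[OF pS] \<open>2 * J ?p < \<infinity>\<close> in \<open>auto intro!: ennreal_leI\<close>)
    also have "\<dots> = 0"
    proof -
      have "2 * J g \<le> 2 * J ?p" by (intro mult_left_mono Jg[OF pS]) auto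
      then show ?thesis using \<open>2 * J ?p < \<infinity>\<close> by (auto intro: diff_eq_0_ennreal)
    qed
    finally have "AE z in lborel. ennreal (u g z - u ?p z) = 0"
      by (subst (asm) nn_integral_0_iff_AE) auto
    then have "AE z in lborel. \<not> (u ?p z < u g z)"
      by eventually_elim (auto simp: ennreal_eq_0_iff)
    then have "{z. u ?p z < u g z} \<in> null_sets lborel"
      by (subst (asm) AE_iff_null) auto
    then have "negligible {z. u ?p z < u g z}"
      by (simp add: negligible_iff_null_sets null_sets_completion_iff null_sets_completionI)
    \<comment> \<open>Minimality makes the two moments equal, so the pointwise gain vanishes almost
      everywhere. By continuity a strict gain at the single point \<open>x\<close> would spread to
      an open set, which is not null.\<close>
    moreover have "open {z. u ?p z < u g z}" by (rule open_Collect_less[OF cu(2,1)])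
    ultimately show False using pos open_not_negligible by blast
  qed
  \<comment> \<open>For equal norms, \<open>x\<close> is approached along its ray by points of
    smaller norm. Used in both directions, this gives equality on spheres, hence radial symmetry at
    every point.\<close>
  have mono': "g y \<le> g x" if xy: "norm x \<le> norm y" for x y
  proof (cases "x = 0")
    case True
    show ?thesis
    proof (cases "y = 0")
      case False
      then show ?thesis using True by (intro mono) auto
    qed (use True in auto)
  next
    case False
    have "(\<lambda>n. g ((1 - 1 / real (Suc n)) *\<^sub>R x)) \<longlonglongrightarrow> g ((1 - 0) *\<^sub>R x)"
    proof (rule continuous_on_tendsto_compose[OF Sc[OF gS]])
      show "(\<lambda>n. (1 - 1 / real (Suc n)) *\<^sub>R x) \<longlonglongrightarrow> (1 - 0) *\<^sub>R x"
        by (intro tendsto_intros LIMSEQ_Suc[OF lim_1_over_n])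
    qed auto
    moreover have "g y \<le> g ((1 - 1 / real (Suc n)) *\<^sub>R x)" for n
    proof (rule mono)
      have "\<bar>1 - 1 / real (Suc n)\<bar> * norm x < 1 * norm x"
        using False by (intro mult_strict_right_mono) (auto simp: field_simps)
      then show "norm ((1 - 1 / real (Suc n)) *\<^sub>R x) < norm y" using xy by simp
    qed
    ultimately show ?thesis by (intro LIMSEQ_le_const) auto
  qed
  show ?thesis
    by (rule that[of g]) (use gS Sc[OF gS] mono' in \<open>auto simp: S_def\<close>)
qed

section \<open>Admissible densities and their approximation\<close>

text \<open>The Borel counterpart of \<open>densities\<close>, on any Euclidean space. The two
  notions are matched by \<open>admissible_densities\<close> and
  \<open>densities_admissible\<close>.\<close>

definition admissible :: "real \<Rightarrow> ('a::euclidean_space \<Rightarrow> real) \<Rightarrow> bool" where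
  "admissible q f \<longleftrightarrow> f \<in> borel_measurable borel \<and> (\<forall>x. 0 \<le> f x) \<and> integrable lborel f \<and>
     integrable lborel (\<lambda>x. f x powr q) \<and> \<not> (AE x in lborel. f x = 0)"

definition mass :: "('a::euclidean_space \<Rightarrow> real) \<Rightarrow> real" where
  "mass f = (\<integral>x. f x \<partial>lborel)"

lemma mass_nonneg: "(\<And>x. 0 \<le> f x) \<Longrightarrow> 0 \<le> mass f"
  unfolding mass_def by (rule Bochner_Integration.integral_nonneg) auto

lemma mass_pos:
  assumes "integrable lborel f" "\<And>x. 0 \<le> f x" "\<not> (AE x in lborel. f x = 0)"
  shows "0 < mass f"
proof -
  have "mass f \<noteq> 0" using integral_nonneg_eq_0_iff_AE[of lborel f] assms unfolding mass_def by auto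
  then show ?thesis using mass_nonneg[of f] assms(2) by force
qed

lemma admissible_pos:
  assumes "admissible q f" shows "0 < mass f" "0 < mass (\<lambda>x. f x powr q)"
proof -
  show "0 < mass f" using assms unfolding admissible_def by (intro mass_pos) auto
  have "\<not> (AE x in lborel. f x powr q = 0)" using assms unfolding admissible_def by auto
  then show "0 < mass (\<lambda>x. f x powr q)" using assms unfolding admissible_def by (intro mass_pos) auto
qed

lemma integrable_compact_support:
  fixes u :: "'a::euclidean_space \<Rightarrow> real"
  assumes [measurable]: "u \<in> borel_measurable borel" and u: "\<And>x. 0 \<le> u x" "\<And>x. u x \<le> B" "\<And>x. norm x > R \<Longrightarrow> u x = 0"
  shows "integrable lborel u"
proof (rule integrableI_bounded)
  have "(\<integral>\<^sup>+x. ennreal (norm (u x)) \<partial>lborel) \<le> (\<integral>\<^sup>+x. ennreal B * indicator (cball 0 R) (x::'a) \<partial>lborel)"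
    using u by (intro nn_integral_mono) (auto simp: indicator_def intro!: ennreal_leI)
  then show "(\<integral>\<^sup>+x. ennreal (norm (u x)) \<partial>lborel) < \<infinity>"
    using compact_support_nn_integral_bound[of B R] by (rule le_less_trans)
qed auto

lemma mass_nn_integral:
  assumes "integrable lborel u" "\<And>x. 0 \<le> u x"
  shows "(\<integral>\<^sup>+x. ennreal (u x) \<partial>lborel) = ennreal (mass u)"
  unfolding mass_def using assms by (intro nn_integral_eq_integral) auto

lemma mass_enn2real:
  assumes "u \<in> borel_measurable borel" "\<And>x. 0 \<le> u x"
  shows "mass u = enn2real (\<integral>\<^sup>+x. ennreal (u x) \<partial>lborel)"
  unfolding mass_def using assms by (intro integral_eq_nn_integral) auto

lemma bienergy_mono:
  assumes "\<And>x. 0 \<le> f x" "\<And>x. f x \<le> g x"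
  shows "bienergy lam f f \<le> bienergy lam g g"
  unfolding bienergy_def
proof -
  have "0 \<le> g x" for x using assms order_trans by blast
  then show "(\<integral>\<^sup>+x. \<integral>\<^sup>+y. ennreal (f x * norm (x - y) powr lam * f y) \<partial>lborel \<partial>lborel)
    \<le> (\<integral>\<^sup>+x. \<integral>\<^sup>+y. ennreal (g x * norm (x - y) powr lam * g y) \<partial>lborel \<partial>lborel)"
    using assms by (intro nn_integral_mono ennreal_leI mult_mono) auto
qed

lemma bienergy_cong_AE:
  assumes "AE x in lborel. f x = g x"
  shows "bienergy lam f f = bienergy lam g g"
  unfolding bienergy_def
proof (rule nn_integral_cong_AE, use assms in eventually_elim)
  fix x assume "f x = g x"
  show "(\<integral>\<^sup>+y. ennreal (f x * norm (x - y) powr lam * f y) \<partial>lborel) = (\<integral>\<^sup>+y. ennreal (g x * norm (x - y) powr lam * g y) \<partial>lborel)"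
    by (rule nn_integral_cong_AE, use assms in eventually_elim) (simp add: \<open>f x = g x\<close>)
qed

lemma bienergy_limit:
  fixes u :: "nat \<Rightarrow> 'a::euclidean_space \<Rightarrow> real"
  assumes [measurable]: "\<And>n. u n \<in> borel_measurable borel" "v \<in> borel_measurable borel"
    and lim: "AE x in lborel. (\<lambda>n. u n x) \<longlonglongrightarrow> v x"
    and u: "\<And>n x. 0 \<le> u n x" "\<And>n x. u n x \<le> B" "\<And>n x. norm x > R \<Longrightarrow> u n x = 0" and lam: "lam > 0" and R: "R \<ge> 0"
  shows "(\<lambda>n. bienergy lam (u n) (u n)) \<longlonglongrightarrow> bienergy lam v v"
proof -
  define D where "D = B * (2 * R) powr lam * B"
  have B: "B \<ge> 0" using u(1,2)[of 0 0] by linarith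
  have bd: "u n x * norm (x - y) powr lam * u n y \<le> D" for n x y
  proof (cases "norm x > R \<or> norm y > R")
    case True
    then show ?thesis using u(3) B by (auto simp: D_def)
  next
    case False
    then have "norm (x - y) \<le> 2 * R" using norm_triangle_ineq4[of x y] by linarith
    then show ?thesis unfolding D_def using u B lam
      by (intro mult_mono powr_mono2) (auto intro!: mult_nonneg_nonneg)
  qed
  define W where "W = (\<integral>\<^sup>+y. ennreal D * indicator (cball 0 R) (y::'a) \<partial>lborel)"
  have W: "W < \<infinity>" unfolding W_def by (rule compact_support_nn_integral_bound)
  have cb[measurable]: "cball 0 R \<in> sets (borel :: 'a measure)" by auto
  show ?thesis
    unfolding bienergy_def
  proof (rule nn_integral_dominated_convergence[where w="\<lambda>x. W * indicator (cball 0 R) x"])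
    show "(\<integral>\<^sup>+x. W * indicator (cball 0 R) (x::'a) \<partial>lborel) < \<infinity>"
      using W emeasure_lborel_cball_finite[of "0::'a" R] by (simp add: nn_integral_cmult_indicator ennreal_mult_less_top)
    show "AE x in lborel. (\<integral>\<^sup>+y. ennreal (u j x * norm (x - y) powr lam * u j y) \<partial>lborel) \<le> W * indicator (cball 0 R) x" for j
    proof (rule AE_I2)
      fix x :: 'a
      show "(\<integral>\<^sup>+y. ennreal (u j x * norm (x - y) powr lam * u j y) \<partial>lborel) \<le> W * indicator (cball 0 R) x"
      proof (cases "norm x > R")
        case False
        have "(\<integral>\<^sup>+y. ennreal (u j x * norm (x - y) powr lam * u j y) \<partial>lborel) \<le> W"
          unfolding W_def using bd u(3)
          by (intro nn_integral_mono) (auto simp: indicator_def intro!: ennreal_leI)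
        then show ?thesis using False by simp
      qed (use u(3) in auto)
    qed
    show "AE x in lborel. (\<lambda>i. \<integral>\<^sup>+y. ennreal (u i x * norm (x - y) powr lam * u i y) \<partial>lborel)
       \<longlonglongrightarrow> (\<integral>\<^sup>+y. ennreal (v x * norm (x - y) powr lam * v y) \<partial>lborel)"
      using lim
    proof eventually_elim
      case (elim x)
      show ?case
      proof (rule nn_integral_compact_support_limit[where B=D and R=R])
        show "AE y in lborel. (\<lambda>i. u i x * norm (x - y) powr lam * u i y) \<longlonglongrightarrow> v x * norm (x - y) powr lam * v y"
          using lim by eventually_elim (intro tendsto_intros elim)
      qed (use bd u in auto)
    qed
  qed measurable
qed

text \<open>A continuous cutoff instead of an indicator keeps truncated continuous functions within
  the scope of \<open>symmetrization\<close>.\<close>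

definition cutoff :: "nat \<Rightarrow> 'a::real_normed_vector \<Rightarrow> real" where
  "cutoff k x = max 0 (min 1 (real k + 1 - norm x))"

lemma cutoff: "0 \<le> cutoff k x" "cutoff k x \<le> 1" "norm x > real k + 1 \<Longrightarrow> cutoff k x = 0"
  "norm x \<le> real k \<Longrightarrow> cutoff k x = 1"
  by (auto simp: cutoff_def)

lemma continuous_cutoff: "continuous_on UNIV (cutoff k)"
  unfolding cutoff_def by (intro continuous_intros)

lemma cutoff_borel[measurable]: "cutoff k \<in> borel_measurable (borel :: 'a::euclidean_space measure)"
  by (intro borel_measurable_continuous_onI continuous_cutoff)

text \<open>Two limits connect \<open>f\<close> with continuous functions of compact support. For
  the bounded truncations \<open>F k\<close> both sides converge by dominated convergence along the
  continuous approximants \<open>G k n\<close>. To remove the truncation, only the left side has to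
  converge, because \<open>F k \<le> f\<close> bounds the energy by monotonicity, even if that of
  \<open>f\<close> is infinite. As \<open>al\<close> may be negative, the limits of the masses must
  be positive.\<close>

theorem admissible_by_radial:
  fixes c al th :: real
  assumes lam: "lam > 0" and q: "0 < q" and th: "th > 0" and c: "c \<ge> 0"
    and hyp: "\<And>g R. \<lbrakk>continuous_on UNIV g; \<And>x::'a::euclidean_space. 0 \<le> g x; \<And>x. norm x > R \<Longrightarrow> g x = 0;
      \<And>x y. norm x \<le> norm y \<Longrightarrow> g y \<le> g x; mass g > 0\<rbrakk>
      \<Longrightarrow> ennreal (c * mass g powr al * mass (\<lambda>x. g x powr q) powr th) \<le> bienergy lam g g"
    and f: "admissible q (f :: 'a \<Rightarrow> real)"
  shows "ennreal (c * mass f powr al * mass (\<lambda>x. f x powr q) powr th) \<le> bienergy lam f f"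
proof -
  have fm[measurable]: "f \<in> borel_measurable borel" and f0: "\<And>x. 0 \<le> f x" and fi: "integrable lborel f"
    "integrable lborel (\<lambda>x. f x powr q)" using f unfolding admissible_def by auto
  have cont: "ennreal (c * mass h powr al * mass (\<lambda>x. h x powr q) powr th) \<le> bienergy lam h h"
    if h: "continuous_on UNIV h" "\<And>x. 0 \<le> h x" "\<And>x. norm x > R \<Longrightarrow> h x = 0" and R: "R \<ge> 0" for h :: "'a \<Rightarrow> real" and R
  \<comment> \<open>For \<open>mass h = 0\<close> the left side vanishes, because
    \<open>0 powr al\<close> is 0 for every \<open>al\<close>, also a negative one.\<close>
  proof (cases "mass h = 0")
    case False
    have [measurable]: "h \<in> borel_measurable borel" using h(1) by (rule borel_measurable_continuous_onI)
    obtain g :: "'a \<Rightarrow> real" where g: "continuous_on UNIV g" "\<And>x. 0 \<le> g x" "\<And>x. norm x > R \<Longrightarrow> g x = 0"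
      "\<And>x y. norm x \<le> norm y \<Longrightarrow> g y \<le> g x"
      "(\<integral>\<^sup>+x. ennreal (g x) \<partial>lborel) = (\<integral>\<^sup>+x. ennreal (h x) \<partial>lborel)"
      "(\<integral>\<^sup>+x. ennreal (g x powr q) \<partial>lborel) = (\<integral>\<^sup>+x. ennreal (h x powr q) \<partial>lborel)"
      "bienergy lam g g \<le> bienergy lam h h"
      using symmetrization[OF h R lam q] by blast
    have [measurable]: "g \<in> borel_measurable borel" using g(1) by (rule borel_measurable_continuous_onI)
    have m: "mass g = mass h" "mass (\<lambda>x. g x powr q) = mass (\<lambda>x. h x powr q)"
      using g h by (simp_all add: mass_enn2real)
    have "mass g > 0" using False m mass_nonneg[of h] h(2) by force
    from hyp[of g R, OF g(1-4) this] show ?thesis using g(7) m by auto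
  qed simp
  \<comment> \<open>This notion of measurability supplies the continuous functions converging to
    \<open>f\<close> off a null set.\<close>
  have "f measurable_on UNIV"
    by (rule lebesgue_measurable_imp_measurable_on_nnreal_UNIV[OF _ f0]) (intro measurable_completion, use fm in simp)
  then obtain Z h where Z: "negligible Z" and h: "\<And>n. continuous_on UNIV (h n)" "\<And>x. x \<notin> Z \<Longrightarrow> (\<lambda>n. h n x) \<longlonglongrightarrow> f x"
    unfolding measurable_on_def by force
  have AEh: "AE x in lborel. (\<lambda>n. h n x) \<longlonglongrightarrow> f x"
  proof -
    have "AE x in lebesgue. (\<lambda>n. h n x) \<longlonglongrightarrow> f x"
      by (rule AE_I'[of Z]) (use Z h in \<open>auto simp: negligible_iff_null_sets\<close>)
    then show ?thesis by (simp add: AE_completion_iff)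
  qed
  define F where "F k x = min (f x) (real k) * cutoff k x" for k x
  define G where "G k n x = min (max (h n x) 0) (real k) * cutoff k x" for k n x
  have [measurable]: "F k \<in> borel_measurable borel" for k unfolding F_def by measurable
  have Gc: "continuous_on UNIV (G k n)" for k n
    unfolding G_def by (intro continuous_intros h(1) continuous_cutoff[unfolded eta_contract_eq])
  have [measurable]: "G k n \<in> borel_measurable borel" for k n using Gc by (rule borel_measurable_continuous_onI)
  have G: "0 \<le> G k n x" "G k n x \<le> real k" "norm x > real k + 1 \<Longrightarrow> G k n x = 0" for k n x
    unfolding G_def using cutoff(1-2)[of k x] cutoff(3)[of k x] by (auto intro!: mult_left_le[THEN order_trans])
  have F: "0 \<le> F k x" "F k x \<le> f x" for k x
    unfolding F_def using cutoff(1,2)[of k x] f0[of x] by (auto intro!: mult_left_le[THEN order_trans])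
  have FG: "AE x in lborel. (\<lambda>n. G k n x) \<longlonglongrightarrow> F k x" for k
    using AEh
  proof eventually_elim
    case (elim x)
    have "(\<lambda>n. G k n x) \<longlonglongrightarrow> min (max (f x) 0) (real k) * cutoff k x"
      unfolding G_def by (intro tendsto_intros elim)
    then show ?case using f0[of x] by (simp add: F_def max_absorb1)
  qed
  have AEq: "AE x in lborel. (\<lambda>n. w n x powr q) \<longlonglongrightarrow> v x powr q"
    if "AE x in lborel. (\<lambda>n. w n x) \<longlonglongrightarrow> v x" "\<And>n x. 0 \<le> w n x" for w and v :: "'a \<Rightarrow> real"
    using that(1)
  proof eventually_elim
    case (elim x)
    show ?case by (rule tendsto_powr'[OF elim tendsto_const]) (use that(2) q in auto)
  qed
  have step: "ennreal (c * mass (F k) powr al * mass (\<lambda>x. F k x powr q) powr th) \<le> bienergy lam (F k) (F k)"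
    if pos: "mass (F k) > 0" for k
  proof -
    have 1: "(\<lambda>n. mass (G k n)) \<longlonglongrightarrow> mass (F k)"
      unfolding mass_def
    proof (rule integral_dominated_convergence[where w="\<lambda>x. real k * indicator (cball 0 (real k + 1)) x"])
      show "integrable lborel (\<lambda>x::'a. real k * indicator (cball 0 (real k + 1)) x)"
        by (rule integrable_compact_support[of _ "real k" "real k + 1"]) (auto simp: indicator_def)
      show "AE x in lborel. norm (G k n x) \<le> real k * indicator (cball 0 (real k + 1)) x" for n
        using G(1,2)[of k n] G(3)[where k=k and n=n] by (auto simp: indicator_def)
    qed (use FG in auto)
    have 2: "(\<lambda>n. mass (\<lambda>x. G k n x powr q)) \<longlonglongrightarrow> mass (\<lambda>x. F k x powr q)"
      unfolding mass_def
    proof (rule integral_dominated_convergence[where w="\<lambda>x. real k powr q * indicator (cball 0 (real k + 1)) x"])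
      show "integrable lborel (\<lambda>x::'a. real k powr q * indicator (cball 0 (real k + 1)) x)"
        by (rule integrable_compact_support[of _ "real k powr q" "real k + 1"]) (auto simp: indicator_def)
      show "AE x in lborel. norm (G k n x powr q) \<le> real k powr q * indicator (cball 0 (real k + 1)) x" for n
        using G(1,2)[of k n] G(3)[where k=k and n=n] q by (auto simp: indicator_def intro!: powr_mono2)
    qed (use AEq[OF FG] G in auto)
    have 3: "(\<lambda>n. bienergy lam (G k n) (G k n)) \<longlonglongrightarrow> bienergy lam (F k) (F k)"
      by (rule bienergy_limit[where B="real k" and R="real k + 1"]) (use FG G lam in auto)
    have "(\<lambda>n. ennreal (c * mass (G k n) powr al * mass (\<lambda>x. G k n x powr q) powr th))
      \<longlonglongrightarrow> ennreal (c * mass (F k) powr al * mass (\<lambda>x. F k x powr q) powr th)"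
      by (intro tendsto_ennrealI tendsto_mult tendsto_const tendsto_powr'[OF 2] tendsto_powr[OF 1])
        (use pos th in \<open>auto intro!: always_eventually mass_nonneg\<close>)
    then show ?thesis
      by (rule LIMSEQ_le[OF _ 3]) (use cont[OF Gc G(1) G(3)] in auto)
  qed
  have Flim: "(\<lambda>k. F k x) \<longlonglongrightarrow> f x" for x
  proof -
    obtain k0 :: nat where k0: "f x \<le> real k0" "norm x \<le> real k0"
      using real_arch_simple[of "max (f x) (norm x)"] by auto
    have "F k x = f x" if "k \<ge> k0" for k
      using k0 that cutoff(4)[of x k] by (auto simp: F_def min_absorb1)
    then show ?thesis unfolding eventually_sequentially by (intro tendsto_eventually) (auto simp: eventually_sequentially)
  qed
  have 1: "(\<lambda>k. mass (F k)) \<longlonglongrightarrow> mass f"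
    unfolding mass_def
    by (rule integral_dominated_convergence[where w=f]) (use fi F Flim in auto)
  have 2: "(\<lambda>k. mass (\<lambda>x. F k x powr q)) \<longlonglongrightarrow> mass (\<lambda>x. f x powr q)"
    unfolding mass_def
    by (rule integral_dominated_convergence[where w="\<lambda>x. f x powr q"])
      (use fi F Flim AEq[of F f] q in \<open>auto intro!: powr_mono2\<close>)
  have pos: "mass f > 0" by (rule admissible_pos[OF f])
  have 3: "(\<lambda>k. ennreal (c * mass (F k) powr al * mass (\<lambda>x. F k x powr q) powr th))
      \<longlonglongrightarrow> ennreal (c * mass f powr al * mass (\<lambda>x. f x powr q) powr th)"
    by (intro tendsto_ennrealI tendsto_mult tendsto_const tendsto_powr'[OF 2] tendsto_powr[OF 1])
      (use pos th in \<open>auto intro!: always_eventually mass_nonneg\<close>)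
  have "\<forall>\<^sub>F k in sequentially. mass (F k) > 0" using order_tendstoD(1)[OF 1 pos] .
  then have "\<forall>\<^sub>F k in sequentially. ennreal (c * mass (F k) powr al * mass (\<lambda>x. F k x powr q) powr th) \<le> bienergy lam f f"
  proof eventually_elim
    case (elim k)
    show ?case using step[OF elim] bienergy_mono[of "F k" f lam] F by (meson order_trans)
  qed
  then show ?thesis by (intro tendsto_upperbound[OF 3]) auto
qed

section \<open>Scaling and a priori bounds\<close>

lemma bienergy_scale:
  fixes g :: "'a::euclidean_space \<Rightarrow> real"
  assumes [measurable]: "g \<in> borel_measurable borel" and g0: "\<And>x. 0 \<le> g x" and a: "a > 0" and b: "b > 0"
  shows "bienergy lam (\<lambda>x. a * g (b *\<^sub>R x)) (\<lambda>x. a * g (b *\<^sub>R x))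
    = ennreal (a\<^sup>2 * b powr - lam / (b ^ DIM('a))\<^sup>2) * bienergy lam g g"
proof -
  let ?k = "a\<^sup>2 * b powr - lam" and ?B = "b ^ DIM('a)"
  have sc: "norm (x - y) powr lam = b powr - lam * norm (b *\<^sub>R x - b *\<^sub>R y) powr lam" for x y :: 'a
  proof -
    have "norm (b *\<^sub>R x - b *\<^sub>R y) = b * norm (x - y)"
      using b by (simp flip: scaleR_diff_right)
    then show ?thesis using b by (simp add: powr_mult powr_minus)
  qed
  define G where "G x y = ennreal (g x * norm (x - y) powr lam * g y)" for x y :: 'a
  have [measurable]: "(\<lambda>(x, y). G x y) \<in> borel_measurable (borel \<Otimes>\<^sub>M borel)" unfolding G_def by measurable
  have "bienergy lam (\<lambda>x. a * g (b *\<^sub>R x)) (\<lambda>x. a * g (b *\<^sub>R x))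
      = (\<integral>\<^sup>+x. (\<integral>\<^sup>+y. ennreal ?k * G (b *\<^sub>R x) (b *\<^sub>R y) \<partial>lborel) \<partial>lborel)"
    unfolding bienergy_def G_def using a g0
    by (intro nn_integral_cong, subst sc, subst ennreal_mult'[symmetric]) (auto simp: power2_eq_square algebra_simps intro!: mult_nonneg_nonneg)
  also have "\<dots> = (\<integral>\<^sup>+x. ennreal (1 / ?B) * (\<integral>\<^sup>+y. ennreal ?k * G (b *\<^sub>R x) y \<partial>lborel) \<partial>lborel)"
    by (intro nn_integral_cong nn_integral_scaleR[OF _ b]) measurable
  also have "\<dots> = ennreal (1 / ?B) * (\<integral>\<^sup>+x. ennreal (1 / ?B) * (\<integral>\<^sup>+y. ennreal ?k * G x y \<partial>lborel) \<partial>lborel)"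
    by (rule nn_integral_scaleR[OF _ b, where f="\<lambda>x. ennreal (1 / ?B) * (\<integral>\<^sup>+y. ennreal ?k * G x y \<partial>lborel)"]) measurable
  also have "\<dots> = ennreal (1 / ?B) * (ennreal (1 / ?B) * (ennreal ?k * bienergy lam g g))"
    unfolding bienergy_def by (simp add: nn_integral_cmult G_def)
  also have "\<dots> = ennreal (?k / ?B\<^sup>2) * bienergy lam g g"
    using a b by (simp add: mult.assoc[symmetric] ennreal_mult'[symmetric] power2_eq_square)
  finally show ?thesis .
qed

lemma nn_integral_mult_scaleR:
  fixes g :: "'a::euclidean_space \<Rightarrow> real"
  assumes [measurable]: "g \<in> borel_measurable borel" and "a \<ge> 0" and b: "b > 0"
  shows "(\<integral>\<^sup>+x. ennreal (a * g (b *\<^sub>R x)) \<partial>lborel) = ennreal (a / b ^ DIM('a)) * (\<integral>\<^sup>+x. ennreal (g x) \<partial>lborel)"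
proof -
  have "(\<integral>\<^sup>+x. ennreal (a * g (b *\<^sub>R x)) \<partial>lborel) = ennreal a * (\<integral>\<^sup>+x. ennreal (g (b *\<^sub>R x)) \<partial>lborel)"
    using assms by (simp add: ennreal_mult' nn_integral_cmult)
  also have "(\<integral>\<^sup>+x. ennreal (g (b *\<^sub>R x)) \<partial>lborel) = ennreal (1 / b ^ DIM('a)) * (\<integral>\<^sup>+x. ennreal (g x) \<partial>lborel)"
    by (rule nn_integral_scaleR[OF _ b]) measurable
  finally show ?thesis using assms by (simp add: mult.assoc[symmetric] ennreal_mult'[symmetric])
qed

text \<open>The interaction of \<open>f\<close> with a unit point mass at the origin.\<close>

definition moment :: "real \<Rightarrow> ('a::euclidean_space \<Rightarrow> real) \<Rightarrow> ennreal" where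
  "moment lam f = (\<integral>\<^sup>+x. ennreal (norm x powr lam * f x) \<partial>lborel)"

lemma nn_integral_uminus:
  fixes f :: "'a::euclidean_space \<Rightarrow> ennreal"
  assumes "f \<in> borel_measurable borel"
  shows "(\<integral>\<^sup>+x. f (- x) \<partial>lborel) = (\<integral>\<^sup>+x. f x \<partial>lborel)"
  by (rule nn_integral_isometry) (use assms in \<open>auto simp: dist_norm norm_minus_commute\<close>)

lemma nn_integral_even:
  fixes f g :: "'a::euclidean_space \<Rightarrow> real"
  assumes [measurable]: "f \<in> borel_measurable borel" "g \<in> borel_measurable borel"
    and f0: "\<And>x. 0 \<le> f x" and g0: "\<And>x. 0 \<le> g x" and ev: "\<And>x. g (- x) = g x"
  shows "2 * (\<integral>\<^sup>+x. ennreal (f x * g x) \<partial>lborel) = (\<integral>\<^sup>+x. ennreal ((f x + f (- x)) * g x) \<partial>lborel)"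
proof -
  have "(\<integral>\<^sup>+x. ennreal (f x * g x) \<partial>lborel) = (\<integral>\<^sup>+x. ennreal (f (- x) * g (- x)) \<partial>lborel)"
    by (rule nn_integral_uminus[symmetric]) measurable
  then have "2 * (\<integral>\<^sup>+x. ennreal (f x * g x) \<partial>lborel)
     = (\<integral>\<^sup>+x. ennreal (f x * g x) \<partial>lborel) + (\<integral>\<^sup>+x. ennreal (f (- x) * g x) \<partial>lborel)"
    by (simp add: mult_2 ev)
  also have "\<dots> = (\<integral>\<^sup>+x. ennreal ((f x + f (- x)) * g x) \<partial>lborel)"
    using f0 g0 by (subst nn_integral_add[symmetric]) (auto simp: distrib_right intro!: nn_integral_cong ennreal_plus[symmetric])
  finally show ?thesis .
qed

text \<open>For even \<open>g\<close> the potential at any point is at least half of that at the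
  origin: \<open>norm y\<close> is at most the larger of \<open>norm (x - y)\<close> and
  \<open>norm (x + y)\<close>. An energy bound thus controls the tails, and a vanishing energy is
  impossible for a nonzero density.\<close>

lemma bienergy_ge_moment:
  fixes g :: "'a::euclidean_space \<Rightarrow> real"
  assumes [measurable]: "g \<in> borel_measurable borel" and g0: "\<And>x. 0 \<le> g x" and ev: "\<And>x. g (- x) = g x" and lam: "lam > 0"
  shows "(\<integral>\<^sup>+x. ennreal (g x) \<partial>lborel) * moment lam g \<le> 2 * bienergy lam g g"
proof -
  have V: "moment lam g \<le> 2 * (\<integral>\<^sup>+y. ennreal (norm (x - y) powr lam * g y) \<partial>lborel)" for x
  proof -
    have "norm y powr lam \<le> norm (x - y) powr lam + norm (x + y) powr lam" for y
    proof -
      have "2 * norm y \<le> norm (x - y) + norm (x + y)"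
        using norm_triangle_ineq4[of "x + y" "x - y"] by (simp add: algebra_simps flip: scaleR_2)
      then consider "norm y \<le> norm (x - y)" | "norm y \<le> norm (x + y)" by linarith
      then show ?thesis using lam powr_mono2[of lam "norm y"]
        by cases (smt (verit) norm_ge_zero powr_ge_zero)+
    qed
    then have "moment lam g \<le> (\<integral>\<^sup>+y. ennreal ((norm (x - y) powr lam + norm (x - - y) powr lam) * g y) \<partial>lborel)"
      unfolding moment_def by (intro nn_integral_mono ennreal_leI mult_right_mono g0) auto
    also have "\<dots> = 2 * (\<integral>\<^sup>+y. ennreal (norm (x - y) powr lam * g y) \<partial>lborel)"
      by (rule nn_integral_even[symmetric]) (auto simp: g0 ev)
    finally show ?thesis .
  qed
  have "(\<integral>\<^sup>+x. ennreal (g x) \<partial>lborel) * moment lam g = (\<integral>\<^sup>+x. ennreal (g x) * moment lam g \<partial>lborel)"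
    by (simp add: nn_integral_multc)
  also have "\<dots> \<le> (\<integral>\<^sup>+x. 2 * (\<integral>\<^sup>+y. ennreal (g x * norm (x - y) powr lam * g y) \<partial>lborel) \<partial>lborel)"
  proof (rule nn_integral_mono)
    fix x :: 'a
    have "ennreal (g x) * moment lam g \<le> ennreal (g x) * (2 * (\<integral>\<^sup>+y. ennreal (norm (x - y) powr lam * g y) \<partial>lborel))"
      by (intro mult_left_mono V) auto
    also have "\<dots> = 2 * (\<integral>\<^sup>+y. ennreal (g x) * ennreal (norm (x - y) powr lam * g y) \<partial>lborel)"
      by (subst nn_integral_cmult) (auto simp: mult_ac)
    also have "\<dots> = 2 * (\<integral>\<^sup>+y. ennreal (g x * norm (x - y) powr lam * g y) \<partial>lborel)"
      using g0 by (simp add: ennreal_mult'[symmetric] mult.assoc)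
    finally show "ennreal (g x) * moment lam g \<le> 2 * (\<integral>\<^sup>+y. ennreal (g x * norm (x - y) powr lam * g y) \<partial>lborel)" .
  qed
  also have "\<dots> = 2 * bienergy lam g g" unfolding bienergy_def by (rule nn_integral_cmult) measurable
  finally show ?thesis .
qed

text \<open>The ball of radius \<open>norm x\<close> already carries mass at least
  \<open>g x\<close> times its volume.\<close>

lemma radially_decreasing_bound_mass:
  fixes g :: "'a::euclidean_space \<Rightarrow> real"
  assumes [measurable]: "g \<in> borel_measurable borel" and g0: "\<And>x. 0 \<le> g x" and dec: "\<And>x y. norm x \<le> norm y \<Longrightarrow> g y \<le> g x"
    and m: "(\<integral>\<^sup>+x. ennreal (g x) \<partial>lborel) \<le> ennreal A" and A: "A \<ge> 0" and x: "x \<noteq> 0"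
  shows "g x \<le> A / unit_ball_vol DIM('a) * norm x powr - real DIM('a)"
proof -
  let ?w = "unit_ball_vol DIM('a)"
  have "ennreal (g x * (?w * norm x ^ DIM('a))) = ennreal (g x) * emeasure lborel (cball (0::'a) (norm x))"
    using g0 by (simp add: emeasure_cball ennreal_mult')
  also have "\<dots> = (\<integral>\<^sup>+y. ennreal (g x) * indicator (cball 0 (norm x)) (y::'a) \<partial>lborel)"
    by (rule nn_integral_cmult_indicator[symmetric]) auto
  also have "\<dots> \<le> (\<integral>\<^sup>+y. ennreal (g y) \<partial>lborel)"
    using dec by (intro nn_integral_mono) (auto simp: indicator_def intro!: ennreal_leI)
  finally have "ennreal (g x * (?w * norm x ^ DIM('a))) \<le> ennreal A" using m by (rule order_trans)
  then have "g x * (?w * norm x ^ DIM('a)) \<le> A" using A by simp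
  moreover have "?w * norm x ^ DIM('a) > 0" using x by simp
  ultimately have "g x \<le> A / (?w * norm x ^ DIM('a))" by (simp add: pos_le_divide_eq)
  then show ?thesis using x by (simp add: powr_minus powr_realpow field_simps)
qed

text \<open>On the annulus between \<open>norm x / 2\<close> and \<open>norm x\<close> both
  \<open>g\<close> and the weight are bounded below. The outer radius lets \<open>g x\<close> be
  used, and the inner one produces \<open>2 powr lam\<close> and the factor
  \<open>1 - (1/2) ^ DIM('a)\<close>.\<close>

lemma radially_decreasing_bound_moment:
  fixes g :: "'a::euclidean_space \<Rightarrow> real"
  assumes [measurable]: "g \<in> borel_measurable borel" and g0: "\<And>x. 0 \<le> g x" and dec: "\<And>x y. norm x \<le> norm y \<Longrightarrow> g y \<le> g x"
    and m: "moment lam g \<le> ennreal A" and A: "A \<ge> 0" and x: "x \<noteq> 0" and lam: "lam > 0"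
  shows "g x \<le> A * 2 powr lam / (unit_ball_vol DIM('a) * (1 - (1/2) ^ DIM('a))) * norm x powr - (real DIM('a) + lam)"
proof -
  let ?w = "unit_ball_vol DIM('a)" and ?n = "norm x"
  let ?h = "(1/2::real) ^ DIM('a)"
  have h: "?h < 1" by (simp add: power_less_one_iff)
  let ?c = "(?n / 2) powr lam * g x"
  have c0: "?c \<ge> 0" using g0 by simp
  have "ennreal (?c * (?w * (?n ^ DIM('a) - (?n/2) ^ DIM('a)))) = ennreal ?c * emeasure lborel (annulus (?n/2) ?n :: 'a set)"
    using c0 by (simp add: emeasure_annulus ennreal_mult')
  also have "\<dots> = (\<integral>\<^sup>+y. ennreal ?c * indicator (annulus (?n/2) ?n) (y::'a) \<partial>lborel)"
    by (rule nn_integral_cmult_indicator[symmetric]) auto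
  also have "\<dots> \<le> moment lam g"
    unfolding moment_def using dec lam g0
    by (intro nn_integral_mono) (auto simp: indicator_def annulus_def intro!: ennreal_leI mult_mono powr_mono2)
  finally have "ennreal (?c * (?w * (?n ^ DIM('a) - (?n/2) ^ DIM('a)))) \<le> ennreal A" using m by (rule order_trans)
  then have "?c * (?w * (?n ^ DIM('a) - (?n/2) ^ DIM('a))) \<le> A" using A by simp
  moreover have "?n ^ DIM('a) - (?n/2) ^ DIM('a) = ?n ^ DIM('a) * (1 - ?h)"
    by (simp add: power_divide algebra_simps power_one_over)
  moreover have "(?n/2) powr lam = ?n powr lam / 2 powr lam" by (simp add: powr_divide)
  ultimately have "g x * (?n powr lam * ?n ^ DIM('a) * (?w * (1 - ?h)) / 2 powr lam) \<le> A"
    by (simp add: mult_ac)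
  moreover have "?n powr lam * ?n ^ DIM('a) * (?w * (1 - ?h)) / 2 powr lam > 0" using x h by simp
  ultimately have "g x \<le> A / (?n powr lam * ?n ^ DIM('a) * (?w * (1 - ?h)) / 2 powr lam)"
    by (subst pos_le_divide_eq)
  also have "\<dots> = A * 2 powr lam / (?w * (1 - ?h)) * ?n powr - (real DIM('a) + lam)"
  proof -
    have "?n powr - (real DIM('a) + lam) = 1 / (?n powr lam * ?n ^ DIM('a))"
      using x by (subst powr_minus) (simp add: powr_add powr_realpow divide_simps)
    then show ?thesis by (simp only:) (simp add: mult_ac)
  qed
  finally show ?thesis .
qed

text \<open>With \<open>X\<close> and \<open>S\<close> replaced by their infima over tails, the
  limit in \<open>A\<close> and \<open>E\<close> is taken first and that of the tails afterwards.
  The finite bounds on \<open>S\<close> and \<open>a\<close> keep both multiplications continuous in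
  \<open>ennreal\<close>.\<close>

lemma liminf_add_mult_le:
  fixes X S A E :: "nat \<Rightarrow> ennreal"
  assumes le: "\<And>n. X n + S n * A n \<le> E n" and A: "A \<longlonglongrightarrow> a" and E: "E \<longlonglongrightarrow> c"
    and K: "\<And>n. S n \<le> K" "K < \<infinity>" and a: "a < \<infinity>"
  shows "liminf X + liminf S * a \<le> c"
proof -
  define X' S' where "X' n = (INF m\<in>{n..}. X m)" and "S' n = (INF m\<in>{n..}. S m)" for n
  have le': "X' n + S' n * a \<le> c" for n
  proof (rule LIMSEQ_le[OF _ E])
    have "S' n \<le> S n" unfolding S'_def by (rule INF_lower) auto
    then have "S' n < \<infinity>" using K by (meson le_less_trans order_trans)
    then show "(\<lambda>m. X' n + S' n * A m) \<longlonglongrightarrow> X' n + S' n * a"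
      by (intro tendsto_add tendsto_const ennreal_tendsto_cmult A) auto
    have "X' n + S' n * A m \<le> E m" if "m \<ge> n" for m
    proof -
      have "X' n \<le> X m" "S' n \<le> S m" using that unfolding X'_def S'_def by (auto intro: INF_lower)
      then have "X' n + S' n * A m \<le> X m + S m * A m" by (intro add_mono mult_right_mono) auto
      then show ?thesis using le order_trans by blast
    qed
    then show "\<exists>N. \<forall>m\<ge>N. X' n + S' n * A m \<le> E m" by blast
  qed
  have "incseq X'" "incseq S'" unfolding incseq_def X'_def S'_def by (auto intro!: INF_superset_mono)
  then have "X' \<longlonglongrightarrow> liminf X" "S' \<longlonglongrightarrow> liminf S"
    using LIMSEQ_SUP[of X'] LIMSEQ_SUP[of S'] by (simp_all add: liminf_SUP_INF X'_def S'_def)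
  then have "(\<lambda>n. X' n + a * S' n) \<longlonglongrightarrow> liminf X + a * liminf S"
    using a by (intro tendsto_add ennreal_tendsto_cmult) auto
  then show ?thesis using le' by (intro LIMSEQ_le_const2[of _ "liminf X + liminf S * a"]) (auto simp: mult.commute)
qed

section \<open>Compactness of minimising sequences\<close>

text \<open>A radial function is its profile along one ray. The map \<open>t / (1 + t)\<close> makes
  the profiles bounded and the minus sign makes them increasing, as Helly's theorem requires.
  Convergence fails at most at the countably many discontinuities of the limit, that is on countably
  many spheres, and at the origin.\<close>

lemma radially_decreasing_subsequence:
  fixes u :: "nat \<Rightarrow> 'a::euclidean_space \<Rightarrow> real"
  assumes cont: "\<And>n. continuous_on UNIV (u n)" and u0: "\<And>n x. 0 \<le> u n x"
    and dec: "\<And>n x y. norm x \<le> norm y \<Longrightarrow> u n y \<le> u n x"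
    and bd: "\<And>n x. x \<noteq> 0 \<Longrightarrow> u n x \<le> W x"
  obtains s where "strict_mono (s :: nat \<Rightarrow> nat)" "AE x in lborel. convergent (\<lambda>n. u (s n) x)"
proof -
  define e :: 'a where "e = (SOME b. b \<in> Basis)"
  have e: "norm e = 1" unfolding e_def using nonempty_Basis some_in_eq by (metis norm_Basis)
  define \<phi> where "\<phi> t = t / (1 + t)" for t :: real
  have \<phi>_mono: "\<phi> t \<le> \<phi> t'" if "0 \<le> t" "t \<le> t'" for t t' using that unfolding \<phi>_def by (simp add: divide_simps algebra_simps)
  have \<phi>_bd: "0 \<le> \<phi> t" "\<phi> t < 1" if "0 \<le> t" for t using that unfolding \<phi>_def by auto
  have \<phi>_inv: "t = \<phi> t / (1 - \<phi> t)" if "0 \<le> t" for t using that unfolding \<phi>_def by (simp add: field_simps)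
  have same: "u n (norm x *\<^sub>R e) = u n x" for n x
    using e by (intro antisym dec) auto
  define h where "h n t = - \<phi> (u n (max t 0 *\<^sub>R e))" for n and t :: real
  have "continuous (at_right t) (h n)" for n t
  proof -
    have "continuous_on UNIV (\<lambda>t. u n (max t 0 *\<^sub>R e))"
      by (rule continuous_on_compose2[OF cont]) (auto intro!: continuous_intros)
    moreover have "1 + u n (max t 0 *\<^sub>R e) \<noteq> 0" for t using u0[of n "max t 0 *\<^sub>R e"] by linarith
    ultimately have "continuous_on UNIV (h n)"
      unfolding h_def \<phi>_def by (intro continuous_intros) auto
    then show ?thesis by (simp add: continuous_on_eq_continuous_at continuous_at_imp_continuous_within)
  qed
  moreover have "mono (h n)" for n
    unfolding mono_def h_def
  proof (intro allI impI)
    fix t t' :: real assume "t \<le> t'"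
    then have "u n (max t' 0 *\<^sub>R e) \<le> u n (max t 0 *\<^sub>R e)" using e by (intro dec) auto
    then show "- \<phi> (u n (max t 0 *\<^sub>R e)) \<le> - \<phi> (u n (max t' 0 *\<^sub>R e))" using \<phi>_mono u0 by simp
  qed
  moreover have "\<bar>h n t\<bar> \<le> 1" for n t
    using \<phi>_bd[OF u0[of n "max t 0 *\<^sub>R e"]] unfolding h_def by linarith
  ultimately obtain s F where s: "strict_mono (s :: nat \<Rightarrow> nat)" and "mono F"
    and lim: "\<And>t. continuous (at t) F \<Longrightarrow> (\<lambda>n. h (s n) t) \<longlonglongrightarrow> F t"
    using Helly_selection[of h 1] by blast
  let ?D = "{t. \<not> isCont F t}"
  have "countable ?D" using mono_ctble_discont[OF \<open>mono F\<close>] .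
  then have "negligible (\<Union>t\<in>?D. sphere (0::'a) t)"
    by (intro negligible_countable_Union) (auto intro: negligible_sphere)
  then have neg: "negligible (insert 0 (\<Union>t\<in>?D. sphere (0::'a) t))" by simp
  have conv: "convergent (\<lambda>n. u (s n) x)" if x: "x \<notin> insert 0 (\<Union>t\<in>?D. sphere (0::'a) t)" for x
  proof -
    have "isCont F (norm x)" "x \<noteq> 0" using x by auto
    have "(\<lambda>n. - h (s n) (norm x)) \<longlonglongrightarrow> - F (norm x)" by (intro tendsto_minus lim \<open>isCont F (norm x)\<close>)
    then have l: "(\<lambda>n. \<phi> (u (s n) x)) \<longlonglongrightarrow> - F (norm x)" unfolding h_def by (simp add: same)
    have "0 \<le> W x" using bd[OF \<open>x \<noteq> 0\<close>, of 0] u0[of 0 x] by linarith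
    \<comment> \<open>The majorant \<open>W\<close> keeps the compressed limit strictly below 1, so
      the compression can be inverted and the values do not run off to infinity.\<close>
    have "- F (norm x) \<le> \<phi> (W x)"
      by (rule LIMSEQ_le_const2[OF l]) (use \<phi>_mono u0 bd \<open>x \<noteq> 0\<close> in auto)
    then have "1 - - F (norm x) \<noteq> 0" using \<phi>_bd[OF \<open>0 \<le> W x\<close>] by linarith
    then have "(\<lambda>n. \<phi> (u (s n) x) / (1 - \<phi> (u (s n) x))) \<longlonglongrightarrow> - F (norm x) / (1 - - F (norm x))"
      by (intro tendsto_intros l)
    then show ?thesis unfolding \<phi>_inv[OF u0, symmetric] convergent_def by blast
  qed
  have "AE x in lebesgue. convergent (\<lambda>n. u (s n) x)"
    by (rule AE_I'[OF neg[unfolded negligible_iff_null_sets]]) (use conv in blast)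
  then have "AE x in lborel. convergent (\<lambda>n. u (s n) x)" by (simp add: AE_completion_iff)
  with s show ?thesis by (rule that)
qed

text \<open>The inner part acts on the outer one at least as a point mass would at the reduced
  distance \<open>norm x - e\<close>. The factor 2 counts both orders of such a pair, and the energy
  of the inner part with itself is dropped.\<close>

lemma bienergy_split:
  fixes u :: "'a::euclidean_space \<Rightarrow> real"
  assumes [measurable]: "u \<in> borel_measurable borel" and u0: "\<And>x. 0 \<le> u x" and e: "e > 0" and lam: "lam > 0"
  defines "f \<equiv> \<lambda>x. u x * indicator {x. norm x > e} x" and "g \<equiv> \<lambda>x. u x * indicator {x. norm x \<le> e} x"
  shows "bienergy lam f f + (\<integral>\<^sup>+x. ennreal ((norm x - e) powr lam * f x) \<partial>lborel) * (2 * (\<integral>\<^sup>+x. ennreal (g x) \<partial>lborel)) \<le> bienergy lam u u"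
proof -
  let ?w = "\<lambda>x::'a. (norm x - e) powr lam"
  let ?S = "\<integral>\<^sup>+x. ennreal (?w x * f x) \<partial>lborel" and ?g = "\<integral>\<^sup>+x. ennreal (g x) \<partial>lborel"
  have [measurable]: "f \<in> borel_measurable borel" "g \<in> borel_measurable borel" unfolding f_def g_def by measurable
  have fg0: "0 \<le> f x" "0 \<le> g x" for x unfolding f_def g_def using u0 by auto
  have w: "?w x \<le> norm (x - y) powr lam" "?w x \<le> norm (y - x) powr lam" if "norm x > e" "norm y \<le> e" for x y
  proof -
    have "norm x - e \<le> norm (x - y)" using norm_triangle_ineq2[of x y] that by linarith
    then show "?w x \<le> norm (x - y) powr lam" "?w x \<le> norm (y - x) powr lam" using that lam by (auto intro!: powr_mono2 simp: norm_minus_commute)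
  qed
  have pt: "f x * norm (x - y) powr lam * f y + ((?w x * f x) * g y + g x * (?w y * f y)) \<le> u x * norm (x - y) powr lam * u y" for x y
  proof (cases "norm x > e"; cases "norm y > e")
    assume "norm x > e" "\<not> norm y > e"
    then show ?thesis using mult_right_mono[OF w(1)[of x y], of "u x * u y"] u0 by (simp add: f_def g_def mult_ac)
  next
    assume "\<not> norm x > e" "norm y > e"
    then show ?thesis using mult_right_mono[OF w(2)[of y x], of "u x * u y"] u0 by (simp add: f_def g_def mult_ac)
  qed (use u0 in \<open>auto simp: f_def g_def\<close>)
  have "bienergy lam f f + ?S * (2 * ?g)
    = (\<integral>\<^sup>+x. \<integral>\<^sup>+y. ennreal (f x * norm (x - y) powr lam * f y) \<partial>lborel \<partial>lborel)
      + ((\<integral>\<^sup>+x. ennreal (?w x * f x) * ?g \<partial>lborel) + (\<integral>\<^sup>+x. ennreal (g x) * ?S \<partial>lborel))"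
  proof -
    have "(\<integral>\<^sup>+x. ennreal (?w x * f x) * ?g \<partial>lborel) = ?S * ?g" "(\<integral>\<^sup>+x. ennreal (g x) * ?S \<partial>lborel) = ?g * ?S"
      by (rule nn_integral_multc, measurable)+
    then show ?thesis by (simp only: bienergy_def mult_2 distrib_left mult.commute[of ?g ?S])
  qed
  also have "\<dots> = (\<integral>\<^sup>+x. (\<integral>\<^sup>+y. ennreal (f x * norm (x - y) powr lam * f y) \<partial>lborel)
      + (ennreal (?w x * f x) * ?g + ennreal (g x) * ?S) \<partial>lborel)"
    by (simp add: nn_integral_add)
  also have "\<dots> = (\<integral>\<^sup>+x. (\<integral>\<^sup>+y. ennreal (f x * norm (x - y) powr lam * f y)
      + (ennreal (?w x * f x) * ennreal (g y) + ennreal (g x) * ennreal (?w y * f y)) \<partial>lborel) \<partial>lborel)"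
    by (simp add: nn_integral_add nn_integral_cmult)
  also have "\<dots> \<le> bienergy lam u u"
    unfolding bienergy_def
  proof (intro nn_integral_mono)
    fix x y :: 'a
    have "ennreal (f x * norm (x - y) powr lam * f y) + (ennreal (?w x * f x) * ennreal (g y) + ennreal (g x) * ennreal (?w y * f y))
      = ennreal (f x * norm (x - y) powr lam * f y + ((?w x * f x) * g y + g x * (?w y * f y)))"
      using fg0 by (simp add: ennreal_mult'[symmetric] ennreal_plus[symmetric] del: ennreal_plus)
    also have "\<dots> \<le> ennreal (u x * norm (x - y) powr lam * u y)" by (intro ennreal_leI pt)
    finally show "ennreal (f x * norm (x - y) powr lam * f y) + (ennreal (?w x * f x) * ennreal (g y) + ennreal (g x) * ennreal (?w y * f y))
      \<le> ennreal (u x * norm (x - y) powr lam * u y)" .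
  qed
  finally show ?thesis .
qed

text \<open>The number \<open>M\<close> is the mass that a minimising sequence loses to a point mass at the origin.\<close>

theorem relaxed_minimizer:
  fixes lam q c N th al :: real
  assumes N_def: "N = real DIM('a::euclidean_space)"
    and th_def: "th = lam / (N * (1 - q))" and al_def: "al = 2 - q * th"
    and lam: "lam > 0" and q: "0 < q" "q < 1" and qN: "q > N / (N + lam)" and c: "c \<ge> 0"
    and hyp: "\<And>\<epsilon>. \<epsilon> > 0 \<Longrightarrow> \<exists>f::'a::euclidean_space \<Rightarrow> real. admissible q f \<and>
      bienergy lam f f < ennreal ((c + \<epsilon>) * mass f powr al * mass (\<lambda>x. f x powr q) powr th)"
  obtains \<rho> :: "'a::euclidean_space \<Rightarrow> real" and M :: real
  where "\<rho> \<in> borel_measurable borel" "\<And>x. 0 \<le> \<rho> x" "\<And>x y. norm x = norm y \<Longrightarrow> \<rho> x = \<rho> y"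
    "integrable lborel \<rho>" "integrable lborel (\<lambda>x. \<rho> x powr q)" "M \<ge> 0" "mass \<rho> + M = 1"
    "mass (\<lambda>x. \<rho> x powr q) = 1" "moment lam \<rho> < \<infinity>"
    "bienergy lam \<rho> \<rho> + moment lam \<rho> * ennreal (2 * M) \<le> ennreal c"
proof -
  have N: "N > 0" unfolding N_def by simp
  have th: "th > 0" unfolding th_def using lam N q by simp
  have Nq: "N < q * (N + lam)" using qN N lam by (simp add: pos_divide_less_eq)
  have ex: "\<exists>u::'a \<Rightarrow> real. continuous_on UNIV u \<and> (\<forall>x. 0 \<le> u x) \<and> (\<forall>x y. norm x \<le> norm y \<longrightarrow> u y \<le> u x) \<and>
    (\<integral>\<^sup>+x. ennreal (u x) \<partial>lborel) = 1 \<and> (\<integral>\<^sup>+x. ennreal (u x powr q) \<partial>lborel) = 1 \<and> bienergy lam u u \<le> ennreal (c + \<epsilon>)"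
    if \<epsilon>: "\<epsilon> > 0" for \<epsilon>
  proof -
    obtain f :: "'a \<Rightarrow> real" where f: "admissible q f"
      "bienergy lam f f < ennreal ((c + \<epsilon>) * mass f powr al * mass (\<lambda>x. f x powr q) powr th)"
      using hyp[OF \<epsilon>] by blast
    have "\<exists>(g :: 'a \<Rightarrow> real) R. continuous_on UNIV g \<and> (\<forall>x. 0 \<le> g x) \<and> (\<forall>x. norm x > R \<longrightarrow> g x = 0) \<and>
      (\<forall>x y. norm x \<le> norm y \<longrightarrow> g y \<le> g x) \<and> mass g > 0 \<and>
      bienergy lam g g < ennreal ((c + \<epsilon>) * mass g powr al * mass (\<lambda>x. g x powr q) powr th)"
    \<comment> \<open>If no continuous radially decreasing competitor beat the constant
      \<open>c + \<epsilon>\<close>, then \<open>admissible_by_radial\<close> would give the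
      inequality with that constant for \<open>f\<close> as well.\<close>
    proof (rule ccontr)
      assume neg: "\<not> ?thesis"
      have "ennreal ((c + \<epsilon>) * mass f powr al * mass (\<lambda>x. f x powr q) powr th) \<le> bienergy lam f f"
      proof (rule admissible_by_radial[OF lam q(1) th _ _ f(1)])
        show "ennreal ((c + \<epsilon>) * mass g powr al * mass (\<lambda>x. g x powr q) powr th) \<le> bienergy lam g g"
          if "continuous_on UNIV g" "\<And>x. 0 \<le> g x" "\<And>x. norm x > R \<Longrightarrow> g x = 0"
            "\<And>x y. norm x \<le> norm y \<Longrightarrow> g y \<le> g x" "mass g > 0" for g :: "'a \<Rightarrow> real" and R
          using that neg not_le by blast
      qed (use c \<epsilon> in auto)
      with f(2) show False by simp
    qed
    then obtain g :: "'a \<Rightarrow> real" and R where g: "continuous_on UNIV g" "\<And>x. 0 \<le> g x" "\<And>x. norm x > R \<Longrightarrow> g x = 0"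
      "\<And>x y. norm x \<le> norm y \<Longrightarrow> g y \<le> g x" "mass g > 0"
      and lt: "bienergy lam g g < ennreal ((c + \<epsilon>) * mass g powr al * mass (\<lambda>x. g x powr q) powr th)"
      by blast
    have gm[measurable]: "g \<in> borel_measurable borel" using g(1) by (rule borel_measurable_continuous_onI)
    have gR: "g x \<le> g 0" for x using g(4)[of 0 x] by simp
    have gq: "g x powr q \<le> g 0 powr q" for x using gR g(2) q by (intro powr_mono2) auto
    have gi: "integrable lborel g" "integrable lborel (\<lambda>x. g x powr q)"
      using integrable_compact_support[of g "g 0" R] integrable_compact_support[of "\<lambda>x. g x powr q" "g 0 powr q" R] g(2,3) gR gq
      by auto
    have "\<not> (AE x in lborel. g x = 0)"
    proof
      assume "AE x in lborel. g x = 0"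
      then have "mass g = 0" unfolding mass_def by (rule integral_eq_zero_AE)
      with g(5) show False by simp
    qed
    then have "admissible q g" unfolding admissible_def using g(2) gi by auto
    note pos = admissible_pos[OF this]
    define m Q where "m = mass g" and "Q = mass (\<lambda>x. g x powr q)"
    have mQ: "m > 0" "Q > 0" unfolding m_def Q_def using pos by auto
    \<comment> \<open>The height \<open>a\<close> is fixed by mass 1 once the dilation
      \<open>b\<close> is known. Inserting \<open>a = b powr N / m\<close> into the
      \<open>q\<close>-mass leaves \<open>b powr (N * (1 - q)) = Q / m powr q\<close>.\<close>
    define b where "b = (Q / m powr q) powr (1 / (N * (1 - q)))"
    have b: "b > 0" unfolding b_def using mQ by simp
    have bN: "b ^ DIM('a) = b powr N" unfolding N_def using b by (simp add: powr_realpow)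
    define a where "a = b powr N / m"
    have a: "a > 0" unfolding a_def using b mQ by simp
    define u where "u x = a * g (b *\<^sub>R x)" for x
    have I1: "(\<integral>\<^sup>+x. ennreal (u x) \<partial>lborel) = 1"
    proof -
      have "(\<integral>\<^sup>+x. ennreal (u x) \<partial>lborel) = ennreal (a / b ^ DIM('a)) * ennreal m"
        unfolding u_def m_def using a b by (simp add: nn_integral_mult_scaleR mass_nn_integral[OF gi(1) g(2)])
      also have "\<dots> = ennreal (a / b ^ DIM('a) * m)" by (rule ennreal_mult'[symmetric]) (use a b in auto)
      also have "a / b ^ DIM('a) * m = 1" unfolding bN a_def using b mQ by simp
      finally show ?thesis by simp
    qed
    have bq: "b powr (N * (1 - q)) = Q / m powr q"
      unfolding b_def powr_powr using N q mQ by simp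
    have I2: "(\<integral>\<^sup>+x. ennreal (u x powr q) \<partial>lborel) = 1"
    proof -
      have "u x powr q = a powr q * g (b *\<^sub>R x) powr q" for x
        unfolding u_def using a g(2) by (simp add: powr_mult)
      then have "(\<integral>\<^sup>+x. ennreal (u x powr q) \<partial>lborel) = ennreal (a powr q / b ^ DIM('a)) * ennreal Q"
        unfolding Q_def using a b by (simp add: nn_integral_mult_scaleR[where g="\<lambda>x. g x powr q"] mass_nn_integral[OF gi(2)])
      also have "\<dots> = ennreal (a powr q / b ^ DIM('a) * Q)" by (rule ennreal_mult'[symmetric]) (use a b in auto)
      also have "a powr q / b ^ DIM('a) * Q = b powr (N * q) / b powr N * (Q / m powr q)"
        unfolding bN a_def using b mQ by (simp add: powr_divide powr_powr)
      also have "\<dots> = b powr (N * q) / b powr N * b powr (N * (1 - q))" by (simp only: bq)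
      also have "\<dots> = 1" using b by (simp add: powr_add[symmetric] powr_diff[symmetric] algebra_simps)
      finally show ?thesis by simp
    qed
    have I3: "bienergy lam u u \<le> ennreal (c + \<epsilon>)"
    proof -
      have "bienergy lam u u = ennreal (a\<^sup>2 * b powr - lam / (b ^ DIM('a))\<^sup>2) * bienergy lam g g"
        unfolding u_def[abs_def] by (rule bienergy_scale[OF gm g(2) a b])
      also have "a\<^sup>2 * b powr - lam / (b ^ DIM('a))\<^sup>2 = b powr - lam / m\<^sup>2"
        unfolding bN a_def using b by (simp add: power_divide)
      also have "ennreal (b powr - lam / m\<^sup>2) * bienergy lam g g
          \<le> ennreal (b powr - lam / m\<^sup>2) * ennreal ((c + \<epsilon>) * m powr al * Q powr th)"
        unfolding m_def Q_def using lt by (intro mult_left_mono) auto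
      also have "\<dots> = ennreal (b powr - lam / m\<^sup>2 * ((c + \<epsilon>) * m powr al * Q powr th))"
        by (rule ennreal_mult'[symmetric]) simp
      also have "b powr - lam / m\<^sup>2 * ((c + \<epsilon>) * m powr al * Q powr th) = c + \<epsilon>"
      proof -
        have "b powr lam = (Q / m powr q) powr th" unfolding b_def th_def powr_powr by simp
        then have "Q powr th = b powr lam * m powr (q * th)" using mQ by (simp add: powr_divide powr_powr)
        moreover have "m powr al = m\<^sup>2 / m powr (q * th)" unfolding al_def using mQ by (simp add: powr_diff)
        ultimately have "m powr al * Q powr th = b powr lam * m\<^sup>2" using mQ by simp
        then have "b powr - lam / m\<^sup>2 * ((c + \<epsilon>) * m powr al * Q powr th) = b powr - lam / m\<^sup>2 * ((c + \<epsilon>) * (b powr lam * m\<^sup>2))"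
          by (simp only: mult.assoc)
        then show ?thesis using mQ b by (simp add: powr_minus)
      qed
      finally show ?thesis .
    qed
    have "continuous_on UNIV u" unfolding u_def
      by (intro continuous_intros continuous_on_compose2[OF g(1)]) auto
    moreover have "0 \<le> u x" for x unfolding u_def using a g(2) by simp
    moreover have "u y \<le> u x" if "norm x \<le> norm y" for x y
      unfolding u_def using a b g(4)[of "b *\<^sub>R x" "b *\<^sub>R y"] that by auto
    ultimately show ?thesis using I1 I2 I3 by blast
  qed
  have "\<forall>n. \<exists>u::'a \<Rightarrow> real. continuous_on UNIV u \<and> (\<forall>x. 0 \<le> u x) \<and> (\<forall>x y. norm x \<le> norm y \<longrightarrow> u y \<le> u x) \<and>
    (\<integral>\<^sup>+x. ennreal (u x) \<partial>lborel) = 1 \<and> (\<integral>\<^sup>+x. ennreal (u x powr q) \<partial>lborel) = 1 \<and>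
    bienergy lam u u \<le> ennreal (c + 1 / real (Suc n))"
    by (intro allI ex) simp
  then obtain u where u: "\<And>n. continuous_on UNIV (u n)" "\<And>n x. 0 \<le> (u n x :: real)"
    "\<And>n x y. norm (x::'a) \<le> norm y \<Longrightarrow> u n y \<le> u n x"
    "\<And>n. (\<integral>\<^sup>+x. ennreal (u n x) \<partial>lborel) = 1" "\<And>n. (\<integral>\<^sup>+x. ennreal (u n x powr q) \<partial>lborel) = 1"
    "\<And>n. bienergy lam (u n) (u n) \<le> ennreal (c + 1 / real (Suc n))" by metis
  have um[measurable]: "u n \<in> borel_measurable borel" for n using u(1) by (rule borel_measurable_continuous_onI)
  \<comment> \<open>All energies are at most \<open>c + 1\<close>, and the 2 is that of
    \<open>bienergy_ge_moment\<close>.\<close>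
  define K where "K = 2 * (c + 1)"
  have mom: "moment lam (u n) \<le> ennreal K" for n
  proof -
    have ev: "u n (- x) = u n x" for x using u(3)[of x "- x"] u(3)[of "- x" x] by (simp add: antisym)
    have "1 * moment lam (u n) \<le> 2 * bienergy lam (u n) (u n)"
      unfolding u(4)[of n, symmetric] by (rule bienergy_ge_moment[where g="u n", OF um u(2) ev lam])
    also have "\<dots> \<le> 2 * ennreal (c + 1)"
      by (intro mult_left_mono order_trans[OF u(6)] ennreal_leI) auto
    also have "\<dots> = ennreal K" unfolding K_def using c by (simp add: ennreal_mult')
    finally show ?thesis by simp
  qed
  define D where "D = max (1 / unit_ball_vol DIM('a)) (K * 2 powr lam / (unit_ball_vol DIM('a) * (1 - (1/2) ^ DIM('a))))"
  have D: "D > 0" unfolding D_def by (simp add: less_max_iff_disj)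
  have b1: "u n x \<le> D * norm x powr - N" if "x \<noteq> 0" for n x
  proof -
    have "u n x \<le> 1 / unit_ball_vol DIM('a) * norm x powr - N"
      unfolding N_def by (rule radially_decreasing_bound_mass[OF um u(2) u(3) _ _ that]) (use u(4) in auto)
    also have "\<dots> \<le> D * norm x powr - N" by (intro mult_right_mono) (auto simp: D_def)
    finally show ?thesis .
  qed
  have b2: "u n x \<le> D * norm x powr - (N + lam)" if "x \<noteq> 0" for n x
  proof -
    have "u n x \<le> K * 2 powr lam / (unit_ball_vol DIM('a) * (1 - (1/2) ^ DIM('a))) * norm x powr - (N + lam)"
      unfolding N_def by (rule radially_decreasing_bound_moment[OF um u(2) u(3) mom _ that lam]) (use c in \<open>auto simp: K_def\<close>)
    also have "\<dots> \<le> D * norm x powr - (N + lam)" by (intro mult_right_mono) (auto simp: D_def)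
    finally show ?thesis .
  qed
  obtain s where s: "strict_mono (s :: nat \<Rightarrow> nat)" and conv: "AE x in lborel. convergent (\<lambda>n. u (s n) x)"
    using radially_decreasing_subsequence[where u=u and W="\<lambda>x. D * norm x powr - N", OF u(1) u(2) u(3) b1] by blast
  \<comment> \<open>The upper limit is defined and measurable everywhere and depends on the values
    at \<open>x\<close> alone, so \<open>\<rho>\<close> is radial at every point and not just almost
    everywhere. An infinite upper limit is read as 0.\<close>
  define \<rho> where "\<rho> x = max 0 (real_of_ereal (limsup (\<lambda>n. ereal (u (s n) x))))" for x
  have [measurable]: "\<rho> \<in> borel_measurable borel" unfolding \<rho>_def by measurable
  have \<rho>0: "0 \<le> \<rho> x" for x unfolding \<rho>_def by simp
  have \<rho>rad: "\<rho> x = \<rho> y" if "norm x = norm y" for x y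
  proof -
    have "u n x = u n y" for n using u(3) that by (intro antisym) auto
    then show ?thesis unfolding \<rho>_def by simp
  qed
  have lim: "AE x in lborel. (\<lambda>n. u (s n) x) \<longlonglongrightarrow> \<rho> x"
    using conv
  proof eventually_elim
    case (elim x)
    then obtain l where l: "(\<lambda>n. u (s n) x) \<longlonglongrightarrow> l" unfolding convergent_def by blast
    then have "limsup (\<lambda>n. ereal (u (s n) x)) = ereal l" by (intro lim_imp_Limsup) auto
    moreover have "0 \<le> l" by (rule LIMSEQ_le_const[OF l]) (use u(2) in auto)
    ultimately show ?case using l unfolding \<rho>_def by simp
  qed
  have ne0: "AE x::'a in lborel. x \<noteq> 0" by (rule AE_lborel_singleton)
  have iu: "integrable lborel (u n)" for n
    by (rule integrableI_nonneg) (use u in auto)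
  have mu: "mass (u n) = 1" for n using u by (simp add: mass_enn2real)
  have cb[measurable]: "cball 0 r \<in> sets (borel :: 'a measure)" for r by auto

  \<comment> \<open>the total \<open>q\<close>-mass passes to the limit, by domination near the origin and at infinity\<close>
  define wq where "wq x = D powr q * (norm x powr - (N * q) * indicator (cball 0 1) x
    + norm x powr - ((N + lam) * q) * indicator (- cball 0 1) x)" for x :: 'a
  have wq_int: "integrable lborel wq"
  proof -
    have "integrable lborel (\<lambda>x::'a. norm x powr - (N * q) * indicator (cball 0 1) x)"
    proof (rule integrableI_nonneg)
      show "(\<integral>\<^sup>+x. ennreal (norm (x::'a) powr - (N * q) * indicator (cball 0 1) x) \<partial>lborel) < \<infinity>"
        using nn_integral_norm_powr_near[where 'a='a, of "N * q"] q N
        by (simp add: N_def ennreal_mult' ennreal_indicator)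
    qed auto
    \<comment> \<open>Integrability at infinity is the place where \<open>q > N / (N + lam)\<close>
      enters, through \<open>N < q * (N + lam)\<close>.\<close>
    moreover have "integrable lborel (\<lambda>x::'a. norm x powr - ((N + lam) * q) * indicator (- cball 0 1) x)"
    proof (rule integrableI_nonneg)
      show "(\<integral>\<^sup>+x. ennreal (norm (x::'a) powr - ((N + lam) * q) * indicator (- cball 0 1) x) \<partial>lborel) < \<infinity>"
        using nn_integral_norm_powr_far[where 'a='a, of "(N + lam) * q"] Nq
        by (simp add: N_def ennreal_mult' ennreal_indicator mult.commute)
    qed auto
    ultimately show ?thesis unfolding wq_def by simp
  qed
  have ub: "u n x powr q \<le> wq x" if "x \<noteq> 0" for n x
  proof (cases "x \<in> cball 0 1")
    case True
    have "u n x powr q \<le> (D * norm x powr - N) powr q" using b1[OF that] u(2) q by (intro powr_mono2) auto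
    then show ?thesis using True D unfolding wq_def by (simp add: powr_mult powr_powr)
  next
    case False
    have "u n x powr q \<le> (D * norm x powr - (N + lam)) powr q" using b2[OF that] u(2) q by (intro powr_mono2) auto
    then show ?thesis using False D unfolding wq_def by (simp add: powr_mult powr_powr algebra_simps)
  qed
  have limq: "AE x in lborel. (\<lambda>n. u (s n) x powr q) \<longlonglongrightarrow> \<rho> x powr q"
    using lim
  proof eventually_elim
    case (elim x)
    show ?case by (rule tendsto_powr'[OF elim tendsto_const]) (use u(2) q in auto)
  qed
  have ubq: "AE x in lborel. norm (u (s n) x powr q) \<le> wq x" for n
    using ne0 by eventually_elim (simp add: ub)
  have \<rho>q: "integrable lborel (\<lambda>x. \<rho> x powr q)" "(\<lambda>n. mass (\<lambda>x. u (s n) x powr q)) \<longlonglongrightarrow> mass (\<lambda>x. \<rho> x powr q)"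
    unfolding mass_def
    using integrable_dominated_convergence[OF _ _ wq_int limq ubq] integral_dominated_convergence[OF _ _ wq_int limq ubq]
    by auto
  have "mass (\<lambda>x. u (s n) x powr q) = 1" for n using u(5) by (simp add: mass_enn2real)
  with \<rho>q(2) have \<rho>Q: "mass (\<lambda>x. \<rho> x powr q) = 1" by (simp add: LIMSEQ_const_iff)

  have fatou: "(\<integral>\<^sup>+x. ennreal (w x * \<rho> x) \<partial>lborel) \<le> B"
    if [measurable]: "w \<in> borel_measurable borel" and B: "\<And>n. (\<integral>\<^sup>+x. ennreal (w x * u (s n) x) \<partial>lborel) \<le> B" for w B
  proof -
    have "(\<integral>\<^sup>+x. ennreal (w x * \<rho> x) \<partial>lborel) = (\<integral>\<^sup>+x. liminf (\<lambda>n. ennreal (w x * u (s n) x)) \<partial>lborel)"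
    proof (rule nn_integral_cong_AE, use lim in eventually_elim)
      case (elim x)
      have "(\<lambda>n. ennreal (w x * u (s n) x)) \<longlonglongrightarrow> ennreal (w x * \<rho> x)" by (intro tendsto_intros tendsto_ennrealI elim)
      then show ?case by (intro lim_imp_Liminf[symmetric]) auto
    qed
    also have "\<dots> \<le> liminf (\<lambda>n. \<integral>\<^sup>+x. ennreal (w x * u (s n) x) \<partial>lborel)" by (rule nn_integral_liminf) measurable
    also have "\<dots> \<le> liminf (\<lambda>n::nat. B)" by (intro Liminf_mono always_eventually allI B)
    finally show ?thesis by (simp add: Liminf_const)
  qed
  have \<rho>1: "(\<integral>\<^sup>+x. ennreal (\<rho> x) \<partial>lborel) \<le> 1" using fatou[of "\<lambda>_. 1" 1] u(4) by simp
  have \<rho>i: "integrable lborel \<rho>"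
    by (rule integrableI_nonneg) (use \<rho>1 \<rho>0 in \<open>auto intro: le_less_trans\<close>)
  have \<rho>m: "mass \<rho> \<le> 1" using \<rho>1 mass_nn_integral[OF \<rho>i \<rho>0] by simp
  have \<rho>T: "moment lam \<rho> \<le> ennreal K"
    unfolding moment_def by (rule fatou) (use mom in \<open>auto simp: moment_def\<close>)
  define M where "M = 1 - mass \<rho>"
  have M: "M \<ge> 0" unfolding M_def using \<rho>m by simp

  define S where "S e f = (\<integral>\<^sup>+x. ennreal ((norm x - e) powr lam * (f x * indicator {x. norm x > e} x)) \<partial>lborel)" for e and f :: "'a \<Rightarrow> real"
  define E where "E e f = bienergy lam (\<lambda>x. f x * indicator {x. norm x > e} x) (\<lambda>x. f x * indicator {x. norm x > e} x)" for e and f :: "'a \<Rightarrow> real"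
  have SK: "S e f \<le> moment lam f" if "\<And>x. 0 \<le> f x" "e > 0" for e f
    unfolding S_def moment_def using that lam
    by (intro nn_integral_mono ennreal_leI) (auto simp: indicator_def intro!: mult_right_mono powr_mono2)
  \<comment> \<open>Outside the ball of radius \<open>e\<close> domination by \<open>w1\<close>
    makes the masses converge. The total mass is always 1, so the mass inside tends to
    \<open>1 - ?r\<close>, which is at least \<open>M\<close>. The split estimate then passes to the
    limit with this mass acting on the outer part.\<close>
  have outer: "E e \<rho> + S e \<rho> * ennreal (2 * M) \<le> ennreal c" if e: "e > 0" for e
  proof -
    define a where "a n = mass (\<lambda>x. u (s n) x * indicator {x. norm x > e} x)" for n
    define w1 where "w1 x = D * e powr - N * indicator (cball 0 1) x + D * (norm x powr - (N + lam) * indicator (- cball 0 1) x)" for x :: 'a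
    have w1_int: "integrable lborel w1"
    proof -
      have "integrable lborel (\<lambda>x::'a. D * e powr - N * indicator (cball 0 1) x)"
        by (rule integrable_compact_support[of _ "D * e powr - N" 1]) (use D in \<open>auto simp: indicator_def\<close>)
      moreover have "integrable lborel (\<lambda>x::'a. norm x powr - (N + lam) * indicator (- cball 0 1) x)"
      proof (rule integrableI_nonneg)
        show "(\<integral>\<^sup>+x. ennreal (norm (x::'a) powr - (N + lam) * indicator (- cball 0 1) x) \<partial>lborel) < \<infinity>"
          using nn_integral_norm_powr_far[where 'a='a, of "N + lam"] lam
          by (simp add: N_def ennreal_mult' ennreal_indicator)
      qed auto
      ultimately show ?thesis unfolding w1_def by simp
    qed
    have dom: "norm (u n x * indicator {x. norm x > e} x) \<le> w1 x" for n x
    proof (cases "norm x > e")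
      case True
      then have x: "x \<noteq> 0" using e by auto
      show ?thesis
      proof (cases "x \<in> cball 0 1")
        case True
        have "norm x powr - N \<le> e powr - N" using \<open>norm x > e\<close> e N by (intro powr_mono2') auto
        then have "u n x \<le> D * e powr - N" using b1[OF x, of n] D by (meson mult_left_mono less_imp_le order_trans)
        then show ?thesis using True \<open>norm x > e\<close> u(2) unfolding w1_def by simp
      qed (use b2[OF x, of n] \<open>norm x > e\<close> u(2) in \<open>auto simp: w1_def\<close>)
    qed (use D in \<open>auto simp: w1_def indicator_def\<close>)
    have lime: "AE x in lborel. (\<lambda>n. u (s n) x * indicator {x. norm x > e} x) \<longlonglongrightarrow> \<rho> x * indicator {x. norm x > e} x"
      using lim by eventually_elim (intro tendsto_intros)
    have alim: "a \<longlonglongrightarrow> mass (\<lambda>x. \<rho> x * indicator {x. norm x > e} x)"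
      unfolding a_def mass_def
      by (rule integral_dominated_convergence[OF _ _ w1_int lime]) (use dom in auto)
    let ?r = "mass (\<lambda>x. \<rho> x * indicator {x. norm x > e} x)"
    have r: "?r \<le> mass \<rho>"
    proof -
      have "integrable lborel (\<lambda>x. \<rho> x * indicator {x. norm x > e} x)"
        by (rule integrable_real_mult_indicator) (use \<rho>i in auto)
      then show ?thesis
        unfolding mass_def by (rule integral_mono[OF _ \<rho>i]) (use \<rho>0 in \<open>auto simp: indicator_def\<close>)
    qed
    have inner: "(\<integral>\<^sup>+x. ennreal (u (s n) x * indicator {x. norm x \<le> e} x) \<partial>lborel) = ennreal (1 - a n)" for n
    proof -
      have i1: "integrable lborel (\<lambda>x. u (s n) x * indicator {x. norm x \<le> e} x)" "integrable lborel (\<lambda>x. u (s n) x * indicator {x. norm x > e} x)"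
        using iu by (auto intro!: integrable_real_mult_indicator)
      have "mass (u (s n)) = mass (\<lambda>x. u (s n) x * indicator {x. norm x \<le> e} x + u (s n) x * indicator {x. norm x > e} x)"
        by (rule arg_cong[where f=mass]) (auto simp: indicator_def)
      also have "\<dots> = mass (\<lambda>x. u (s n) x * indicator {x. norm x \<le> e} x) + a n"
        unfolding a_def mass_def using i1 by (rule Bochner_Integration.integral_add)
      finally have "mass (\<lambda>x. u (s n) x * indicator {x. norm x \<le> e} x) = 1 - a n" using mu by simp
      then show ?thesis using mass_nn_integral[OF i1(1)] u(2) by simp
    qed
    have "liminf (\<lambda>n. E e (u (s n))) + liminf (\<lambda>n. S e (u (s n))) * ennreal (2 * (1 - ?r)) \<le> ennreal c"
    proof (rule liminf_add_mult_le)
      show "E e (u (s n)) + S e (u (s n)) * (2 * ennreal (1 - a n)) \<le> ennreal (c + 1 / real (Suc (s n)))" for n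
        using order_trans[OF bienergy_split[OF um u(2) e lam] u(6), of "s n"] unfolding E_def S_def inner .
      have "(\<lambda>n. ennreal (2 * (1 - a n))) \<longlonglongrightarrow> ennreal (2 * (1 - ?r))"
        by (intro tendsto_ennrealI tendsto_intros alim)
      then show "(\<lambda>n. 2 * ennreal (1 - a n)) \<longlonglongrightarrow> ennreal (2 * (1 - ?r))"
        by (subst (asm) ennreal_mult') auto
      have "(\<lambda>n. c + 1 / real (Suc (s n))) \<longlonglongrightarrow> c + 0"
        using LIMSEQ_subseq_LIMSEQ[OF LIMSEQ_Suc[OF lim_1_over_n] s] by (intro tendsto_intros) (simp add: o_def)
      then show "(\<lambda>n. ennreal (c + 1 / real (Suc (s n)))) \<longlonglongrightarrow> ennreal c" by (intro tendsto_ennrealI) simp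
      show "S e (u (s n)) \<le> ennreal K" for n using SK[OF u(2) e] mom by (rule order_trans)
    qed auto
    moreover have "E e \<rho> \<le> liminf (\<lambda>n. E e (u (s n)))"
      unfolding E_def by (rule bienergy_Fatou[OF _ _ lime]) (use u(2) in auto)
    moreover have "S e \<rho> \<le> liminf (\<lambda>n. S e (u (s n)))"
    proof -
      have "S e \<rho> = (\<integral>\<^sup>+x. liminf (\<lambda>n. ennreal ((norm x - e) powr lam * (u (s n) x * indicator {x. norm x > e} x))) \<partial>lborel)"
        unfolding S_def
      proof (rule nn_integral_cong_AE, use lime in eventually_elim)
        case (elim x)
        have "(\<lambda>n. ennreal ((norm x - e) powr lam * (u (s n) x * indicator {x. norm x > e} x)))
            \<longlonglongrightarrow> ennreal ((norm x - e) powr lam * (\<rho> x * indicator {x. norm x > e} x))" by (intro tendsto_ennrealI tendsto_mult elim tendsto_const)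
        then show ?case by (intro lim_imp_Liminf[symmetric]) auto
      qed
      also have "\<dots> \<le> liminf (\<lambda>n. S e (u (s n)))" unfolding S_def by (rule nn_integral_liminf) measurable
      finally show ?thesis .
    qed
    moreover have "ennreal (2 * M) \<le> ennreal (2 * (1 - ?r))" unfolding M_def using r by (intro ennreal_leI) simp
    ultimately show ?thesis by (meson add_mono mult_mono order_trans zero_le)
  qed
  \<comment> \<open>Only now does the inner radius shrink to 0. Fatou's lemma recovers the full
    energy and moment, and the inner mass has become a point mass.\<close>
  define ee where "ee k = 1 / real (Suc k)" for k
  have ee: "ee k > 0" for k unfolding ee_def by simp
  have eelim: "ee \<longlonglongrightarrow> 0" unfolding ee_def by (rule LIMSEQ_Suc[OF lim_1_over_n])
  have ind: "(\<lambda>k. indicator {x. norm x > ee k} x) \<longlonglongrightarrow> (1::real)" if "x \<noteq> 0" for x :: 'a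
  proof -
    have "\<forall>\<^sub>F k in sequentially. ee k < norm x" using order_tendstoD(2)[OF eelim] that by simp
    then have "\<forall>\<^sub>F k in sequentially. indicator {x. norm x > ee k} x = (1::real)" by eventually_elim simp
    then show ?thesis by (rule tendsto_eventually)
  qed
  have "liminf (\<lambda>k. E (ee k) \<rho>) + liminf (\<lambda>k. S (ee k) \<rho>) * ennreal (2 * M) \<le> ennreal c"
    by (rule liminf_add_mult_le[OF outer[OF ee] tendsto_const tendsto_const, where K="ennreal K"])
      (use order_trans[OF SK[OF \<rho>0 ee] \<rho>T] in auto)
  moreover have "bienergy lam \<rho> \<rho> \<le> liminf (\<lambda>k. E (ee k) \<rho>)"
    unfolding E_def
  proof (rule bienergy_Fatou)
    show "AE x in lborel. (\<lambda>k. \<rho> x * indicator {x. norm x > ee k} x) \<longlonglongrightarrow> \<rho> x"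
      using ne0
    proof eventually_elim
      case (elim x)
      show ?case using tendsto_mult[OF tendsto_const[of "\<rho> x"] ind[OF elim]] by simp
    qed
  qed (use \<rho>0 in auto)
  moreover have "moment lam \<rho> \<le> liminf (\<lambda>k. S (ee k) \<rho>)"
  proof -
    have "moment lam \<rho> = (\<integral>\<^sup>+x. liminf (\<lambda>k. ennreal ((norm x - ee k) powr lam * (\<rho> x * indicator {x. norm x > ee k} x))) \<partial>lborel)"
      unfolding moment_def
    proof (rule nn_integral_cong_AE, use ne0 in eventually_elim)
      case (elim x)
      have "(\<lambda>k. norm x - ee k) \<longlonglongrightarrow> norm x - 0" by (intro tendsto_intros eelim)
      then have "(\<lambda>k. (norm x - ee k) powr lam) \<longlonglongrightarrow> (norm x - 0) powr lam"
        using elim by (intro tendsto_powr tendsto_const) auto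
      from tendsto_mult[OF this tendsto_mult[OF tendsto_const[of "\<rho> x"] ind[OF elim]]]
      have "(\<lambda>k. ennreal ((norm x - ee k) powr lam * (\<rho> x * indicator {x. norm x > ee k} x))) \<longlonglongrightarrow> ennreal (norm x powr lam * \<rho> x)"
        by (intro tendsto_ennrealI) simp
      then show ?case by (intro lim_imp_Liminf[symmetric]) auto
    qed
    also have "\<dots> \<le> liminf (\<lambda>k. S (ee k) \<rho>)" unfolding S_def by (rule nn_integral_liminf) measurable
    finally show ?thesis .
  qed
  ultimately have "bienergy lam \<rho> \<rho> + moment lam \<rho> * ennreal (2 * M) \<le> ennreal c"
    by (meson add_mono mult_right_mono order_trans zero_le)
  moreover have "moment lam \<rho> < \<infinity>" using \<rho>T by (rule le_less_trans) simp
  ultimately show ?thesis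
    by (intro that[of \<rho> M] \<rho>0 \<rho>rad \<rho>i \<rho>q(1) M \<rho>Q) (auto simp: M_def)
qed

section \<open>Point masses\<close>

lemma bienergy_commute:
  fixes f g :: "'a::euclidean_space \<Rightarrow> real"
  assumes [measurable]: "f \<in> borel_measurable borel" "g \<in> borel_measurable borel"
  shows "bienergy lam f g = bienergy lam g f"
proof -
  have "bienergy lam f g = (\<integral>\<^sup>+y. \<integral>\<^sup>+x. ennreal (f x * norm (x - y) powr lam * g y) \<partial>lborel \<partial>lborel)"
    unfolding bienergy_def
    by (rule lborel_pair.Fubini'[symmetric, where f="\<lambda>x y. ennreal (f x * norm (x - y) powr lam * g y)"]) measurable
  then show ?thesis unfolding bienergy_def by (simp add: norm_minus_commute mult_ac)
qed

lemma bienergy_add: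
  fixes f g :: "'a::euclidean_space \<Rightarrow> real"
  assumes [measurable]: "f \<in> borel_measurable borel" "g \<in> borel_measurable borel" and f0: "\<And>x. 0 \<le> f x" and g0: "\<And>x. 0 \<le> g x"
  shows "bienergy lam (\<lambda>x. f x + g x) (\<lambda>x. f x + g x) = bienergy lam f f + 2 * bienergy lam g f + bienergy lam g g"
proof -
  let ?K = "\<lambda>x y::'a. norm (x - y) powr lam"
  have "bienergy lam (\<lambda>x. f x + g x) (\<lambda>x. f x + g x) = (\<integral>\<^sup>+x. (\<integral>\<^sup>+y. ennreal (f x * ?K x y * f y) + ennreal (g x * ?K x y * f y)
     + (ennreal (f x * ?K x y * g y) + ennreal (g x * ?K x y * g y)) \<partial>lborel) \<partial>lborel)"
    unfolding bienergy_def using f0 g0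
    by (intro nn_integral_cong) (simp add: ennreal_plus[symmetric] algebra_simps del: ennreal_plus)
  also have "\<dots> = bienergy lam f f + bienergy lam g f + (bienergy lam f g + bienergy lam g g)"
    unfolding bienergy_def by (simp add: nn_integral_add)
  also have "bienergy lam f g = bienergy lam g f" by (rule bienergy_commute) auto
  finally show ?thesis by (simp add: mult_2 add_ac)
qed

lemma bienergy_eq_potential:
  fixes f g :: "'a::euclidean_space \<Rightarrow> real"
  assumes [measurable]: "f \<in> borel_measurable borel" "g \<in> borel_measurable borel" and f0: "\<And>x. 0 \<le> f x"
  shows "bienergy lam f g = (\<integral>\<^sup>+x. ennreal (f x) * (\<integral>\<^sup>+y. ennreal (norm (x - y) powr lam * g y) \<partial>lborel) \<partial>lborel)"
  unfolding bienergy_def using f0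
  by (simp add: mult.assoc ennreal_mult' nn_integral_cmult)

lemma powr_add_le: "(a + b) powr q \<le> 2 powr q * (a powr q + b powr q)" if "0 \<le> a" "0 \<le> b" "q > 0" for a b q :: real
proof -
  have "(a + b) powr q \<le> (2 * max a b) powr q" using that by (intro powr_mono2) auto
  also have "\<dots> = 2 powr q * max a b powr q" using that by (simp add: powr_mult)
  also have "\<dots> \<le> 2 powr q * (a powr q + b powr q)" by (intro mult_left_mono) (auto simp: max_def)
  finally show ?thesis .
qed

lemma admissible_add:
  fixes f g :: "'a::euclidean_space \<Rightarrow> real"
  assumes f: "admissible q f" and q: "q > 0" and [measurable]: "g \<in> borel_measurable borel"
    and g: "\<And>x. 0 \<le> g x" "\<And>x. g x \<le> B" "\<And>x. norm x > R \<Longrightarrow> g x = 0"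
  shows "admissible q (\<lambda>x. f x + g x)" "mass (\<lambda>x. f x + g x) = mass f + mass g"
    "mass (\<lambda>x. f x powr q) \<le> mass (\<lambda>x. (f x + g x) powr q)"
proof -
  have [measurable]: "f \<in> borel_measurable borel" and f0: "\<And>x. 0 \<le> f x" and fi: "integrable lborel f" "integrable lborel (\<lambda>x. f x powr q)"
    and fn: "\<not> (AE x in lborel. f x = 0)" using f unfolding admissible_def by auto
  have B: "B \<ge> 0" using g(1,2)[of 0] by linarith
  have gi: "integrable lborel g" by (rule integrable_compact_support[OF _ g]) auto
  have giq: "integrable lborel (\<lambda>x. g x powr q)"
    by (rule integrable_compact_support[of _ "B powr q" R]) (use g q in \<open>auto intro: powr_mono2\<close>)
  have iq: "integrable lborel (\<lambda>x. (f x + g x) powr q)"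
  proof (rule Bochner_Integration.integrable_bound)
    show "integrable lborel (\<lambda>x. 2 powr q * (f x powr q + g x powr q))" using fi giq by simp
    show "AE x in lborel. norm ((f x + g x) powr q) \<le> norm (2 powr q * (f x powr q + g x powr q))"
      using powr_add_le[OF f0 g(1) q] by (simp add: abs_mult)
  qed auto
  have "\<not> (AE x in lborel. f x + g x = 0)"
  proof
    assume "AE x in lborel. f x + g x = 0"
    then have "AE x in lborel. f x = 0"
      by eventually_elim (use f0 g(1) in \<open>auto simp: add_nonneg_eq_0_iff\<close>)
    with fn show False by simp
  qed
  then show "admissible q (\<lambda>x. f x + g x)" unfolding admissible_def using f0 g(1) fi gi iq by auto
  show "mass (\<lambda>x. f x + g x) = mass f + mass g" unfolding mass_def using fi gi by simp
  show "mass (\<lambda>x. f x powr q) \<le> mass (\<lambda>x. (f x + g x) powr q)"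
    unfolding mass_def by (rule integral_mono[OF fi(2) iq]) (use f0 g(1) q in \<open>auto intro!: powr_mono2\<close>)
qed

text \<open>The upper counterpart of \<open>bienergy_split\<close>: moving a source from the origin
  by at most \<open>e\<close> lengthens distances by at most \<open>e\<close>.\<close>

lemma bienergy_near_origin:
  fixes f g :: "'a::euclidean_space \<Rightarrow> real"
  assumes [measurable]: "f \<in> borel_measurable borel" "g \<in> borel_measurable borel" and f0: "\<And>x. 0 \<le> f x" and g0: "\<And>x. 0 \<le> g x"
    and s: "\<And>x. norm x > e \<Longrightarrow> f x = 0" and lam: "lam > 0"
  shows "bienergy lam f g \<le> (\<integral>\<^sup>+x. ennreal (f x) \<partial>lborel) * (\<integral>\<^sup>+y. ennreal ((norm y + e) powr lam * g y) \<partial>lborel)"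
proof -
  have "bienergy lam f g = (\<integral>\<^sup>+x. ennreal (f x) * (\<integral>\<^sup>+y. ennreal (norm (x - y) powr lam * g y) \<partial>lborel) \<partial>lborel)"
    by (rule bienergy_eq_potential) (use f0 in auto)
  also have "\<dots> \<le> (\<integral>\<^sup>+x. ennreal (f x) * (\<integral>\<^sup>+y. ennreal ((norm y + e) powr lam * g y) \<partial>lborel) \<partial>lborel)"
  proof (rule nn_integral_mono)
    fix x :: 'a
    show "ennreal (f x) * (\<integral>\<^sup>+y. ennreal (norm (x - y) powr lam * g y) \<partial>lborel) \<le> ennreal (f x) * (\<integral>\<^sup>+y. ennreal ((norm y + e) powr lam * g y) \<partial>lborel)"
    proof (cases "norm x > e")
      case False
      have "norm (x - y) powr lam \<le> (norm y + e) powr lam" for y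
        using norm_triangle_ineq4[of x y] False lam by (intro powr_mono2) auto
      then show ?thesis by (intro mult_left_mono nn_integral_mono ennreal_leI mult_right_mono g0) auto
    qed (simp add: s)
  qed
  also have "\<dots> = (\<integral>\<^sup>+x. ennreal (f x) \<partial>lborel) * (\<integral>\<^sup>+y. ennreal ((norm y + e) powr lam * g y) \<partial>lborel)"
    by (rule nn_integral_multc) measurable
  finally show ?thesis .
qed

text \<open>The point mass is spread uniformly over a ball of radius \<open>e\<close>. This can only
  increase the \<open>q\<close>-mass, its self-interaction is at most
  \<open>M\<^sup>2 * (2 * e) powr lam\<close>, and its interaction with \<open>f\<close> tends to
  the moment. The inequality for functions therefore survives as \<open>e\<close> tends to
  0.\<close>

theorem relaxed_inequality:
  fixes c al th M :: real and f :: "'a::euclidean_space \<Rightarrow> real"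
  assumes lam: "lam > 0" and q: "0 < q" and th: "th > 0" and c: "c \<ge> 0"
    and hyp: "\<And>f::'a \<Rightarrow> real. admissible q f \<Longrightarrow> ennreal (c * mass f powr al * mass (\<lambda>x. f x powr q) powr th) \<le> bienergy lam f f"
    and f: "admissible q f" and M: "M \<ge> 0"
  shows "ennreal (c * (mass f + M) powr al * mass (\<lambda>x. f x powr q) powr th) \<le> bienergy lam f f + moment lam f * ennreal (2 * M)"
\<comment> \<open>For \<open>M = 0\<close> this is the hypothesis itself, and for an infinite moment
  with \<open>M > 0\<close> the right side is infinite. Otherwise the finite moment provides the
  dominating function.\<close>
proof (cases "M = 0 \<or> moment lam f = \<infinity>")
  case True
  then show ?thesis using hyp[OF f] M by (cases "M = 0") (auto simp: ennreal_top_mult)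
next
  case False
  then have M0: "M > 0" and T: "moment lam f < \<infinity>" using M by (auto simp: less_top)
  have [measurable]: "f \<in> borel_measurable borel" and f0: "\<And>x. 0 \<le> f x" and fi: "integrable lborel f" "integrable lborel (\<lambda>x. f x powr q)"
    using f unfolding admissible_def by auto
  define V where "V e = (\<integral>\<^sup>+y. ennreal ((norm y + e) powr lam * f y) \<partial>lborel)" for e :: real
  have step: "ennreal (c * (mass f + M) powr al * mass (\<lambda>x. f x powr q) powr th)
      \<le> bienergy lam f f + V e * ennreal (2 * M) + ennreal (M\<^sup>2 * (2 * e) powr lam)" if e: "e > 0" for e
  proof -
    define v where "v = unit_ball_vol DIM('a) * e ^ DIM('a)"
    have v: "v > 0" unfolding v_def using e by simp
    define g where "g x = M / v * indicator (cball 0 e) x" for x :: 'a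
    have [measurable]: "g \<in> borel_measurable borel"
      unfolding g_def by (intro borel_measurable_times borel_measurable_const borel_measurable_indicator) simp
    have g: "\<And>x. 0 \<le> g x" "\<And>x. g x \<le> M / v" "\<And>x. norm x > e \<Longrightarrow> g x = 0"
      unfolding g_def using M0 v by (auto simp: indicator_def)
    have gn: "(\<integral>\<^sup>+x. ennreal (g x) \<partial>lborel) = ennreal M"
    proof -
      have "(\<integral>\<^sup>+x. ennreal (g x) \<partial>lborel) = (\<integral>\<^sup>+x. ennreal (M / v) * indicator (cball 0 e) (x::'a) \<partial>lborel)"
        by (intro nn_integral_cong) (auto simp: g_def indicator_def)
      also have "\<dots> = ennreal (M / v) * ennreal v"
        using e by (subst nn_integral_cmult_indicator) (auto simp: emeasure_cball v_def)
      also have "\<dots> = ennreal M" using v M0 by (simp add: ennreal_mult'[symmetric])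
      finally show ?thesis .
    qed
    have mg: "mass g = M" using gn g(1) M by (simp add: mass_enn2real)
    note add = admissible_add[where g=g and R=e and B="M / v", OF f q _ g]
    have "ennreal (c * (mass f + M) powr al * mass (\<lambda>x. f x powr q) powr th)
       \<le> ennreal (c * mass (\<lambda>x. f x + g x) powr al * mass (\<lambda>x. (f x + g x) powr q) powr th)"
      unfolding add(2)[simplified] mg using add(3) c th
      by (intro ennreal_leI mult_left_mono powr_mono2 mass_nonneg) (auto intro!: mult_nonneg_nonneg)
    also have "\<dots> \<le> bienergy lam (\<lambda>x. f x + g x) (\<lambda>x. f x + g x)" by (rule hyp) (use add in auto)
    also have "\<dots> = bienergy lam f f + 2 * bienergy lam g f + bienergy lam g g"
      by (rule bienergy_add) (use f0 g in auto)
    also have "\<dots> \<le> bienergy lam f f + V e * ennreal (2 * M) + ennreal (M\<^sup>2 * (2 * e) powr lam)"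
    proof (intro add_mono order_refl)
      have "bienergy lam g f \<le> ennreal M * V e"
        using bienergy_near_origin[of g f e lam] g f0 lam unfolding gn V_def by auto
      then have "2 * bienergy lam g f \<le> 2 * (ennreal M * V e)" by (rule mult_left_mono) simp
      also have "\<dots> = V e * ennreal (2 * M)" using M by (simp add: ennreal_mult' mult_ac)
      finally show "2 * bienergy lam g f \<le> V e * ennreal (2 * M)" .
      have "bienergy lam g g \<le> ennreal M * (\<integral>\<^sup>+y. ennreal ((norm y + e) powr lam * g y) \<partial>lborel)"
        using bienergy_near_origin[of g g e lam] g lam unfolding gn by auto
      also have "\<dots> \<le> ennreal M * (\<integral>\<^sup>+y. ennreal ((2 * e) powr lam) * ennreal (g y) \<partial>lborel)"
      proof (intro mult_left_mono nn_integral_mono)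
        fix y :: 'a
        show "ennreal ((norm y + e) powr lam * g y) \<le> ennreal ((2 * e) powr lam) * ennreal (g y)"
        proof (cases "norm y > e")
          case False
          then show ?thesis using e lam g by (subst ennreal_mult'[symmetric]) (auto intro!: ennreal_leI mult_right_mono powr_mono2)
        qed (simp add: g)
      qed auto
      also have "\<dots> = ennreal M * (ennreal ((2 * e) powr lam) * ennreal M)"
        by (subst nn_integral_cmult) (auto simp: gn)
      also have "\<dots> = ennreal (M\<^sup>2 * (2 * e) powr lam)"
        using M by (simp add: ennreal_mult'[symmetric] power2_eq_square mult_ac)
      finally show "bienergy lam g g \<le> ennreal (M\<^sup>2 * (2 * e) powr lam)" .
    qed
    finally show ?thesis .
  qed
  define ee where "ee k = 1 / real (Suc k)" for k
  have ee: "ee k > 0" "ee k \<le> 1" for k unfolding ee_def by (simp_all add: divide_simps)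
  have eelim: "ee \<longlonglongrightarrow> 0" unfolding ee_def by (rule LIMSEQ_Suc[OF lim_1_over_n])
  have Vlim: "(\<lambda>k. V (ee k)) \<longlonglongrightarrow> moment lam f"
    unfolding V_def moment_def
  proof (rule nn_integral_dominated_convergence[where w="\<lambda>y. ennreal (2 powr lam) * (ennreal (norm y powr lam * f y) + ennreal (f y))"])
    show "AE y in lborel. ennreal ((norm y + ee k) powr lam * f y) \<le> ennreal (2 powr lam) * (ennreal (norm y powr lam * f y) + ennreal (f y))" for k
    proof (rule AE_I2)
      fix y :: 'a
      have "(norm y + ee k) powr lam \<le> 2 powr lam * (norm y powr lam + ee k powr lam)"
        using ee[of k] lam by (intro powr_add_le) auto
      also have "\<dots> \<le> 2 powr lam * (norm y powr lam + 1)"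
        using ee[of k] lam powr_mono2[of lam "ee k" 1] by (intro mult_left_mono add_left_mono) auto
      finally have "(norm y + ee k) powr lam * f y \<le> 2 powr lam * (norm y powr lam * f y + f y)"
        using mult_right_mono[OF _ f0[of y]] by (fastforce simp: algebra_simps)
      then show "ennreal ((norm y + ee k) powr lam * f y) \<le> ennreal (2 powr lam) * (ennreal (norm y powr lam * f y) + ennreal (f y))"
        using f0[of y] by (simp add: ennreal_mult'[symmetric] ennreal_plus[symmetric] ennreal_leI del: ennreal_plus)
    qed
    show "(\<integral>\<^sup>+y. ennreal (2 powr lam) * (ennreal (norm y powr lam * f y) + ennreal (f y)) \<partial>lborel) < \<infinity>"
      using T mass_nn_integral[OF fi(1) f0] unfolding moment_def
      by (simp add: nn_integral_cmult nn_integral_add ennreal_mult_less_top)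
    show "AE y in lborel. (\<lambda>k. ennreal ((norm y + ee k) powr lam * f y)) \<longlonglongrightarrow> ennreal (norm y powr lam * f y)"
    proof (rule AE_I2)
      fix y :: 'a
      have "(\<lambda>k. norm y + ee k) \<longlonglongrightarrow> norm y + 0" by (intro tendsto_intros eelim)
      then have "(\<lambda>k. (norm y + ee k) powr lam) \<longlonglongrightarrow> norm y powr lam"
        using lam by (intro tendsto_powr'[OF _ tendsto_const]) (auto intro!: always_eventually add_nonneg_nonneg less_imp_le[OF ee(1)])
      then show "(\<lambda>k. ennreal ((norm y + ee k) powr lam * f y)) \<longlonglongrightarrow> ennreal (norm y powr lam * f y)"
        by (intro tendsto_ennrealI tendsto_mult tendsto_const)
    qed
  qed measurable
  have "(\<lambda>k. (2 * ee k) powr lam) \<longlonglongrightarrow> (2 * 0) powr lam"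
    using lam ee(1) by (intro tendsto_powr'[OF tendsto_mult[OF tendsto_const eelim] tendsto_const]) (auto intro!: always_eventually less_imp_le)
  then have "(\<lambda>k. ennreal (M\<^sup>2 * (2 * ee k) powr lam)) \<longlonglongrightarrow> ennreal (M\<^sup>2 * (2 * 0) powr lam)"
    by (intro tendsto_ennrealI tendsto_mult tendsto_const)
  moreover have "(\<lambda>k. ennreal (2 * M) * V (ee k)) \<longlonglongrightarrow> ennreal (2 * M) * moment lam f"
    by (intro ennreal_tendsto_cmult Vlim) auto
  ultimately have "(\<lambda>k. bienergy lam f f + V (ee k) * ennreal (2 * M) + ennreal (M\<^sup>2 * (2 * ee k) powr lam))
     \<longlonglongrightarrow> bienergy lam f f + moment lam f * ennreal (2 * M) + ennreal (M\<^sup>2 * (2 * 0) powr lam)"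
    by (intro tendsto_add tendsto_const) (simp_all add: mult.commute)
  then have "(\<lambda>k. bienergy lam f f + V (ee k) * ennreal (2 * M) + ennreal (M\<^sup>2 * (2 * ee k) powr lam))
     \<longlonglongrightarrow> bienergy lam f f + moment lam f * ennreal (2 * M)" by simp
  then show ?thesis by (rule LIMSEQ_le_const) (use step ee in auto)
qed

section \<open>Necessity of the condition on the exponent\<close>

lemma affine_growth:
  fixes a b d :: real
  assumes "\<And>M. M \<ge> 1 \<Longrightarrow> a * M \<le> b + d * M" and "b \<ge> 0"
  shows "a \<le> d"
proof (rule ccontr)
  assume "\<not> a \<le> d"
  then have "a - d > 0" by simp
  define M where "M = max 1 ((b + 1) / (a - d))"
  have "a * M \<le> b + d * M" using assms(1)[of M] by (simp add: M_def)
  moreover have "(b + 1) / (a - d) \<le> M" unfolding M_def by simp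
  then have "b + 1 \<le> M * (a - d)" using \<open>a - d > 0\<close> by (simp add: pos_divide_le_eq)
  ultimately show False by (simp add: algebra_simps)
qed

text \<open>The profile \<open>norm x powr - (N + lam)\<close> is chosen so that its product with
  \<open>norm x powr lam\<close> is critical. Below the threshold \<open>al > 1\<close>, so for one
  fixed truncation the left side of the relaxed inequality outgrows its right side, which is affine
  in \<open>M\<close>. At the threshold \<open>al = 1\<close>, the coefficients of \<open>M\<close>
  are compared; there the \<open>q\<close>-mass equals the moment \<open>L n\<close> and
  \<open>th = 1 / q > 1\<close>, which fails as \<open>L n\<close> grows.\<close>

theorem exponent_necessary:
  fixes lam q c N th al :: real
  assumes N_def: "N = real DIM('a::euclidean_space)"
    and th_def: "th = lam / (N * (1 - q))" and al_def: "al = 2 - q * th"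
    and lam: "lam > 0" and q: "0 < q" "q < 1" and c: "c \<ge> 0" and qN: "q \<le> N / (N + lam)"
    and hyp: "\<And>f::'a::euclidean_space \<Rightarrow> real. admissible q f \<Longrightarrow> ennreal (c * mass f powr al * mass (\<lambda>x. f x powr q) powr th) \<le> bienergy lam f f"
  shows "c = 0"
proof (rule ccontr)
  assume "c \<noteq> 0"
  with c have c: "c > 0" by simp
  have N: "N > 0" unfolding N_def by simp
  have th: "th > 0" unfolding th_def using lam N q by simp
  have Nq: "q * (N + lam) \<le> N" using qN N lam by (simp add: pos_le_divide_eq)
  have qth: "q * th \<le> 1" unfolding th_def using Nq N q by (simp add: divide_le_eq algebra_simps)
  define A where "A n = (annulus 1 (2 powr real n) :: 'a set)" for n :: nat
  define f where "f n x = norm x powr - (N + lam) * indicator (A n) x" for n and x :: 'a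
  define l where "l n x = norm x powr - N * indicator (A n) x" for n and x :: 'a
  have [measurable]: "f n \<in> borel_measurable borel" "l n \<in> borel_measurable borel" for n
    unfolding f_def l_def A_def by measurable
  have p1: "norm x powr - s \<le> 1" if "x \<in> A n" "s > 0" for x s n
    using that powr_mono2'[of "-s" 1 "norm x"] by (auto simp: A_def annulus_def)
  have f1: "0 \<le> f n x" "f n x \<le> 1" "norm x > 2 powr real n \<Longrightarrow> f n x = 0" for n x
    unfolding f_def using p1[of x n "N + lam"] N lam by (auto simp: indicator_def A_def annulus_def)
  have l1: "0 \<le> l n x" "l n x \<le> 1" "norm x > 2 powr real n \<Longrightarrow> l n x = 0" for n x
    unfolding l_def using p1[of x n "N"] N lam by (auto simp: indicator_def A_def annulus_def)
  have fq: "f n x powr q = norm x powr - ((N + lam) * q) * indicator (A n) x" for n x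
    using q by (auto simp: f_def indicator_def powr_powr algebra_simps)
  have fi: "integrable lborel (f n)" for n by (rule integrable_compact_support[OF _ f1]) auto
  have fiq: "integrable lborel (\<lambda>x. f n x powr q)" for n
    by (rule integrable_compact_support[of _ 1 "2 powr real n"]) (use f1 q powr_mono2[of q _ 1] in auto)
  have li: "integrable lborel (l n)" for n by (rule integrable_compact_support[OF _ l1]) auto
  define d where "d = unit_ball_vol DIM('a) * (1 - 2 powr - real DIM('a))"
  have d: "d > 0" unfolding d_def by (intro mult_pos_pos) (auto simp: powr_less_one)
  define L where "L n = mass (l n)" for n
  have Lge: "real n * d \<le> L n" for n
  proof -
    have "ennreal (real n * d) \<le> (\<integral>\<^sup>+x. ennreal (norm x powr - real DIM('a)) * indicator (annulus 1 (2 powr real n)) (x::'a) \<partial>lborel)"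
      unfolding d_def by (rule nn_integral_norm_powr_critical)
    also have "\<dots> = (\<integral>\<^sup>+x. ennreal (l n x) \<partial>lborel)"
      by (intro nn_integral_cong) (auto simp: l_def N_def A_def indicator_def)
    also have "\<dots> = ennreal (L n)" unfolding L_def by (rule mass_nn_integral[OF li l1(1)])
    finally show ?thesis using mass_nonneg[where f="l n", OF l1(1)] by (simp add: L_def)
  qed
  have mom: "moment lam (f n) = ennreal (L n)" for n
  proof -
    have "norm x powr lam * f n x = l n x" for x
      unfolding f_def l_def by (cases "x = 0") (simp_all add: powr_add[symmetric] mult.assoc[symmetric])
    then show ?thesis unfolding moment_def L_def by (simp add: mass_nn_integral[OF li l1(1)])
  qed
  have adm: "admissible q (f n)" if n: "n > 0" for n
  proof -
    have "\<not> (AE x in lborel. f n x = 0)"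
    proof
      assume "AE x in lborel. f n x = 0"
      then have "AE x in lborel. l n x = 0"
        by eventually_elim (auto simp: f_def l_def indicator_def split: if_splits)
      then have "L n = 0" unfolding L_def mass_def by (rule integral_eq_zero_AE)
      then show False using Lge[of n] n d by (simp add: mult_le_0_iff)
    qed
    then show ?thesis unfolding admissible_def using f1 fi fiq by auto
  qed
  define Q where "Q n = mass (\<lambda>x. f n x powr q)" for n
  have Ifin: "bienergy lam (f n) (f n) < \<infinity>" for n
  proof -
    have "bienergy lam (f n) (f n) \<le> (\<integral>\<^sup>+x. ennreal (f n x) \<partial>lborel) * (\<integral>\<^sup>+y. ennreal ((norm y + 2 powr real n) powr lam * f n y) \<partial>lborel)"
      by (rule bienergy_near_origin) (use f1 lam in auto)
    also have "\<dots> < \<infinity>"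
    proof -
      have "integrable lborel (\<lambda>y. (norm y + 2 powr real n) powr lam * f n y)"
      proof (rule integrable_compact_support[of _ "(2 powr real n + 2 powr real n) powr lam" "2 powr real n"])
        show "(norm x + 2 powr real n) powr lam * f n x \<le> (2 powr real n + 2 powr real n) powr lam" for x :: 'a
        proof (cases "norm x > 2 powr real n")
          case False
          then have "(norm x + 2 powr real n) powr lam * f n x \<le> (2 powr real n + 2 powr real n) powr lam * 1"
            using f1 lam by (intro mult_mono powr_mono2) auto
          then show ?thesis by simp
        qed (simp add: f1)
      qed (use f1 in auto)
      then show ?thesis using f1 fi by (simp add: mass_nn_integral ennreal_mult_less_top)
    qed
    finally show ?thesis .
  qed
  have key: "c * M powr al * Q n powr th \<le> enn2real (bienergy lam (f n) (f n)) + 2 * L n * M" if n: "n > 0" and M: "M \<ge> 1" for n M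
  proof -
    have h1: "c * M powr al * Q n powr th \<le> c * (mass (f n) + M) powr al * Q n powr th"
      using c M mass_nonneg[where f="f n", OF f1(1)] qth unfolding al_def by (intro mult_right_mono mult_left_mono powr_mono2) auto
    have h2: "ennreal (c * (mass (f n) + M) powr al * Q n powr th) \<le> bienergy lam (f n) (f n) + moment lam (f n) * ennreal (2 * M)"
      unfolding Q_def by (rule relaxed_inequality[OF lam q(1) th _ hyp adm[OF n]]) (use c M in auto)
    have h3: "bienergy lam (f n) (f n) + moment lam (f n) * ennreal (2 * M)
       = ennreal (enn2real (bienergy lam (f n) (f n)) + 2 * L n * M)"
      using Ifin[of n] M mass_nonneg[where f="l n", OF l1(1)] unfolding mom L_def
      by (simp add: ennreal_mult'[symmetric] mult_ac)
    have h4: "0 \<le> enn2real (bienergy lam (f n) (f n)) + 2 * L n * M"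
      using M mass_nonneg[where f="l n", OF l1(1)] by (simp add: L_def)
    have "c * (mass (f n) + M) powr al * Q n powr th \<le> enn2real (bienergy lam (f n) (f n)) + 2 * L n * M"
      using h2 unfolding h3 ennreal_le_iff[OF h4] .
    with h1 show ?thesis by linarith
  qed
  show False
  proof (cases "q * th = 1")
    case False
    then have al: "al > 1" using qth unfolding al_def by simp
    define I where "I = enn2real (bienergy lam (f 1) (f 1))"
    have Q: "Q 1 > 0" unfolding Q_def using admissible_pos[OF adm[of 1]] by simp
    have L: "L 1 \<ge> 0" unfolding L_def by (rule mass_nonneg[OF l1(1)])
    have I: "I \<ge> 0" unfolding I_def by simp
    have "(c * Q 1 powr th) * M \<le> (I + 2 * L 1) + 0 * M" if "M \<ge> 1" for M
    proof -
      \<comment> \<open>With this choice \<open>R powr al = R * M\<close>, so superlinear growth in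
        \<open>R\<close> becomes linear growth in \<open>M\<close> after division by
        \<open>R\<close>.\<close>
      define R where "R = M powr (1 / (al - 1))"
      have R: "R \<ge> 1" unfolding R_def using that al by (intro ge_one_powr_ge_zero) auto
      have RM: "R powr al = R * M"
      proof -
        have "R powr (al - 1) = M" unfolding R_def powr_powr using al that by simp
        then show ?thesis using R by (metis add.commute diff_add_cancel mult.commute powr_add powr_one' abs_of_nonneg le_numeral_extra(1) order_trans)
      qed
      have "c * (R * M) * Q 1 powr th \<le> I + 2 * L 1 * R" using key[of 1 R] R unfolding RM I_def by simp
      also have "\<dots> \<le> R * (I + 2 * L 1)" using I R mult_right_mono[of 1 R I] by (simp add: algebra_simps)
      finally have "R * (c * M * Q 1 powr th) \<le> R * (I + 2 * L 1)" by (simp add: mult_ac)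
      then show ?thesis using R by (simp add: mult_ac)
    qed
    then have "c * Q 1 powr th \<le> 0" using affine_growth[of "c * Q 1 powr th" "I + 2 * L 1" 0] I L by simp
    moreover have "c * Q 1 powr th > 0" using c Q by simp
    ultimately show False by simp
  next
    case True
    then have al: "al = 1" unfolding al_def by simp
    have thq: "th = 1 / q" using True q by (simp add: field_simps)
    have "q * lam = N * (1 - q)" using True N q unfolding th_def by (simp add: field_simps)
    then have Nq: "(N + lam) * q = N" by (simp add: algebra_simps)
    have QL: "Q n = L n" for n unfolding Q_def L_def fq Nq l_def ..
    \<comment> \<open>For fixed \<open>n\<close> the energy is a finite constant, so only the
      coefficients of \<open>M\<close> survive as \<open>M\<close> grows.\<close>
    have cL: "c * L n powr th \<le> 2 * L n" if n: "n > 0" for n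
    proof (rule affine_growth)
      show "c * L n powr th * M \<le> enn2real (bienergy lam (f n) (f n)) + 2 * L n * M" if "M \<ge> 1" for M
        using key[OF n that] that unfolding al QL by (simp add: mult_ac)
    qed simp
    \<comment> \<open>Beyond \<open>b\<close> one has \<open>c * L n powr (th - 1) > 2\<close>. The
      summand 1 makes \<open>b \<ge> 1\<close>, which excludes \<open>n = 0\<close>.\<close>
    define b where "b = (2 / c) powr (1 / (th - 1)) + 1"
    have th1: "th > 1" unfolding thq using q by simp
    obtain n :: nat where n: "b < real n * d" using d reals_Archimedean3 by blast
    have b1: "b \<ge> 1" unfolding b_def by simp
    with n have n0: "n > 0" by (cases n) auto
    have Lb: "L n > b" using n Lge[of n] by simp
    then have L0: "L n > 0" using b1 by simp
    have "2 / c = ((2 / c) powr (1 / (th - 1))) powr (th - 1)" unfolding powr_powr using c th1 by simp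
    also have "\<dots> < L n powr (th - 1)" using Lb th1 unfolding b_def by (intro powr_less_mono2) auto
    finally have "2 < c * L n powr (th - 1)" using c by (simp add: field_simps)
    then have "2 * L n < c * L n powr (th - 1) * L n" using L0 by simp
    also have "\<dots> = c * L n powr th" using L0 by (simp add: powr_diff)
    finally show False using cL[OF n0] by simp
  qed
qed

section \<open>Absence of a point mass\<close>

lemma powr_le_tangent:
  fixes t p :: real assumes "0 \<le> t" "0 \<le> p" "p \<le> 1" shows "t powr p \<le> 1 + p * (t - 1)"
  using Youngs_inequality_0[of p "1 - p" t 1] assms by (cases "t = 0") (auto simp: algebra_simps)

text \<open>The convex case is the concave one read backwards, with exponent \<open>1 / p\<close> at
  the point \<open>t powr p\<close>.\<close>

lemma powr_ge_tangent:
  fixes t p :: real assumes "0 \<le> t" "1 \<le> p" shows "1 + p * (t - 1) \<le> t powr p"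
proof -
  have "(t powr p) powr (1 / p) \<le> 1 + 1 / p * (t powr p - 1)" using assms by (intro powr_le_tangent) auto
  then have "t \<le> 1 + 1 / p * (t powr p - 1)" using assms by (simp add: powr_powr)
  then have "p * t \<le> p * (1 + 1 / p * (t powr p - 1))" using assms by (intro mult_left_mono) auto
  then show ?thesis using assms by (simp add: algebra_simps)
qed

lemma powr_diff_ge:
  fixes s t p :: real assumes "0 < s" "0 \<le> t" "0 \<le> p" "p \<le> 1"
  shows "p * s powr (p - 1) * (s - t) \<le> s powr p - t powr p"
proof -
  have "s powr p * (t / s) powr p \<le> s powr p * (1 + p * (t / s - 1))"
    using assms by (intro mult_left_mono powr_le_tangent) auto
  moreover have "s powr p * (t / s) powr p = t powr p" using assms by (simp add: powr_divide)
  moreover have "s powr p * (1 + p * (t / s - 1)) = s powr p - p * s powr (p - 1) * (s - t)"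
  proof -
    have "s powr p = s powr (p - 1) * s" using assms by (simp add: powr_diff)
    then show ?thesis using assms by (simp add: field_simps)
  qed
  ultimately show ?thesis by linarith
qed

lemma powr_diff_le:
  fixes s t p :: real assumes "0 < s" "0 \<le> t" "1 \<le> p"
  shows "s powr p - t powr p \<le> p * s powr (p - 1) * (s - t)"
proof -
  have "s powr p * (1 + p * (t / s - 1)) \<le> s powr p * (t / s) powr p"
    using assms by (intro mult_left_mono powr_ge_tangent) auto
  moreover have "s powr p * (t / s) powr p = t powr p" using assms by (simp add: powr_divide)
  moreover have "s powr p * (1 + p * (t / s - 1)) = s powr p - p * s powr (p - 1) * (s - t)"
  proof -
    have "s powr p = s powr (p - 1) * s" using assms by (simp add: powr_diff)
    then show ?thesis using assms by (simp add: field_simps)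
  qed
  ultimately show ?thesis by linarith
qed

lemma powr_midpoint_concave:
  fixes A B p :: real assumes "0 \<le> A" "0 \<le> B" "0 < p" "p \<le> 1"
  shows "A powr p + B powr p \<le> 2 * ((A + B) / 2) powr p"
proof (cases "A + B = 0")
  case False
  let ?m = "(A + B) / 2"
  have m: "?m > 0" using False assms by simp
  have "p * ?m powr (p - 1) * (?m - A) + p * ?m powr (p - 1) * (?m - B) \<le> (?m powr p - A powr p) + (?m powr p - B powr p)"
    using assms m by (intro add_mono powr_diff_ge) auto
  moreover have "p * ?m powr (p - 1) * (?m - A) + p * ?m powr (p - 1) * (?m - B) = p * ?m powr (p - 1) * 0"
    unfolding distrib_left[symmetric] by (rule arg_cong[where f="(*) _"]) (simp add: field_simps)
  ultimately show ?thesis by linarith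
qed (use assms in \<open>simp add: add_nonneg_eq_0_iff\<close>)

lemma powr_subadditive:
  fixes A B p :: real assumes "0 \<le> A" "0 \<le> B" "0 < p" "p \<le> 1"
  shows "(A + B) powr p \<le> A powr p + B powr p"
proof (cases "A + B = 0")
  case False
  then have s: "A + B > 0" using assms by simp
  have le: "x / (A + B) \<le> (x / (A + B)) powr p" if "0 \<le> x" "x \<le> A + B" for x
    using that s assms powr_mono'[of p 1 "x / (A + B)"] by (auto simp: divide_simps)
  have "1 = A / (A + B) + B / (A + B)" using s by (simp flip: add_divide_distrib)
  also have "\<dots> \<le> (A / (A + B)) powr p + (B / (A + B)) powr p" using assms by (intro add_mono le) auto
  finally have "1 \<le> (A powr p + B powr p) / (A + B) powr p" using assms s by (simp add: powr_divide add_divide_distrib)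
  then show ?thesis using s by simp
qed (use assms in \<open>simp add: add_nonneg_eq_0_iff\<close>)

text \<open>The tangents at \<open>A\<close> and \<open>B\<close> bound the second difference by an
  increment of the derivative. The factor \<open>max 1 (p - 1)\<close> covers both a concave and a
  convex derivative. The remainder carries a power of the larger point \<open>B\<close>, because
  \<open>A\<close> may be 0 and \<open>p - 2\<close> negative.\<close>

lemma powr_second_difference:
  fixes A B p :: real assumes p: "p > 1" and A: "0 \<le> A" "A \<le> B" and B: "B > 0"
  shows "A powr p + B powr p \<le> 2 * ((A + B) / 2) powr p + p * max 1 (p - 1) * ((B - A)\<^sup>2 / 2) * B powr (p - 2)"
proof -
  define s d where "s = (A + B) / 2" and "d = (B - A) / 2"
  have sd: "s - A = d" "B - s = d" "s \<ge> 0" unfolding s_def d_def using A B by (auto simp: field_simps)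
  have 1: "A powr p - s powr p \<le> - (p * A powr (p - 1) * d)"
  proof (cases "A = 0")
    case False
    then have "A powr p - s powr p \<le> p * A powr (p - 1) * (A - s)" using A sd p by (intro powr_diff_le) auto
    also have "A - s = - d" using sd by simp
    finally show ?thesis by simp
  qed (use p in simp)
  have 2: "B powr p - s powr p \<le> p * B powr (p - 1) * d"
    using powr_diff_le[of B s p] A B p sd by simp
  have 3: "B powr (p - 1) - A powr (p - 1) \<le> max 1 (p - 1) * (B - A) * B powr (p - 2)"
  proof -
    have u: "0 \<le> A / B" "A / B \<le> 1" using A B by (auto simp: divide_simps)
    have "1 - (A / B) powr (p - 1) \<le> max 1 (p - 1) * (1 - A / B)"
    proof (cases "p - 1 \<le> 1")
      case True
      then have "(A / B) powr 1 \<le> (A / B) powr (p - 1)" using u p by (intro powr_mono') auto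
      then have "A / B \<le> (A / B) powr (p - 1)" unfolding powr_one[OF u(1)] .
      then show ?thesis using True by simp
    next
      case False
      then show ?thesis using powr_ge_tangent[of "A / B" "p - 1"] u by (simp add: algebra_simps)
    qed
    then have "B powr (p - 1) * (1 - (A / B) powr (p - 1)) \<le> B powr (p - 1) * (max 1 (p - 1) * (1 - A / B))"
      by (intro mult_left_mono) auto
    moreover have "B powr (p - 1) * (1 - (A / B) powr (p - 1)) = B powr (p - 1) - A powr (p - 1)"
      using A B by (simp add: powr_divide algebra_simps)
    moreover have "B powr (p - 1) * (max 1 (p - 1) * (1 - A / B)) = max 1 (p - 1) * (B - A) * B powr (p - 2)"
    proof -
      have "B powr (p - 1) = B powr (p - 2) * B" using B powr_add[of B "p - 2" 1] by simp
      then show ?thesis using B by (simp add: field_simps)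
    qed
    ultimately show ?thesis by simp
  qed
  have "A powr p + B powr p - 2 * s powr p \<le> p * d * (B powr (p - 1) - A powr (p - 1))"
    using 1 2 by (simp add: algebra_simps)
  also have "\<dots> \<le> p * d * (max 1 (p - 1) * (B - A) * B powr (p - 2))"
    using p A by (intro mult_left_mono 3) (auto simp: d_def)
  also have "\<dots> = p * max 1 (p - 1) * ((B - A)\<^sup>2 / 2) * B powr (p - 2)"
    unfolding d_def power2_eq_square by (simp only: times_divide_eq_left times_divide_eq_right mult_ac)
  finally show ?thesis unfolding s_def by linarith
qed

text \<open>With \<open>p = lam / 2\<close> the power acts on squared norms, whose sum is given by
  the parallelogram law. For \<open>lam \<le> 2\<close> concavity and subadditivity leave
  \<open>norm x powr lam\<close>; for \<open>lam > 2\<close> the second difference is quadratic in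
  \<open>x\<close>. The weight \<open>1 + norm y powr lam\<close> is integrable against any density
  of finite mass and moment.\<close>

lemma norm_powr_second_difference:
  assumes lam: "lam > 0"
  obtains K where "K \<ge> 0" "\<And>x y :: 'a::euclidean_space. norm x \<le> 1 \<Longrightarrow>
    norm (x - y) powr lam + norm (x + y) powr lam \<le> 2 * norm y powr lam + K * norm x powr (min 2 lam) * (1 + norm y powr lam)"
proof -
  define p where "p = lam / 2"
  have p0: "p > 0" unfolding p_def using lam by simp
  have np: "norm z powr lam = ((norm z)\<^sup>2) powr p" for z :: 'a
  proof -
    have sq: "(norm z)\<^sup>2 = norm z powr 2" by simp
    show ?thesis unfolding p_def sq powr_powr by simp
  qed
  have par: "(norm (x - y))\<^sup>2 + (norm (x + y))\<^sup>2 = 2 * ((norm x)\<^sup>2 + (norm y)\<^sup>2)" for x y :: 'a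
    by (simp add: power2_norm_eq_inner inner_diff_left inner_diff_right inner_add_left inner_add_right inner_commute)
  show ?thesis
  proof (cases "lam \<le> 2")
    case True
    then have p1: "p \<le> 1" unfolding p_def by simp
    show ?thesis
    proof (rule that[of 2])
      fix x y :: 'a assume "norm x \<le> 1"
      have "norm (x - y) powr lam + norm (x + y) powr lam \<le> 2 * (((norm (x - y))\<^sup>2 + (norm (x + y))\<^sup>2) / 2) powr p"
        unfolding np by (rule powr_midpoint_concave) (use p0 p1 in auto)
      also have "\<dots> = 2 * ((norm x)\<^sup>2 + (norm y)\<^sup>2) powr p"
        unfolding par by (subst nonzero_mult_div_cancel_left) auto
      also have "\<dots> \<le> 2 * (((norm x)\<^sup>2) powr p + ((norm y)\<^sup>2) powr p)"
        by (intro mult_left_mono powr_subadditive) (use p0 p1 in auto)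
      also have "\<dots> = 2 * norm y powr lam + 2 * norm x powr (min 2 lam)"
        unfolding np[symmetric] using True by (simp add: min_absorb2)
      also have "\<dots> \<le> 2 * norm y powr lam + 2 * norm x powr (min 2 lam) * (1 + norm y powr lam)"
        by (simp add: algebra_simps)
      finally show "norm (x - y) powr lam + norm (x + y) powr lam \<le> 2 * norm y powr lam + 2 * norm x powr (min 2 lam) * (1 + norm y powr lam)" .
    qed simp
  next
    case False
    then have p1: "p > 1" unfolding p_def by simp
    \<comment> \<open>The term \<open>2 * p\<close> comes from passing from \<open>s\<close> to the
      square of \<open>norm y\<close> along a tangent. The other one comes from the bound
      \<open>16 * (norm x)\<^sup>2 * B\<close> for the squared difference, halved.\<close>
    define K0 where "K0 = 2 * p + 8 * p * max 1 (p - 1)"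
    have K0: "K0 \<ge> 0" unfolding K0_def using p1 by (intro add_nonneg_nonneg mult_nonneg_nonneg) auto
    show ?thesis
    proof (rule that[of "K0 * 4 powr p"])
      show "K0 * 4 powr p \<ge> 0" using K0 by simp
      fix x y :: 'a assume x1: "norm x \<le> 1"
      define s where "s = (norm x)\<^sup>2 + (norm y)\<^sup>2"
      define A B where "A = min ((norm (x - y))\<^sup>2) ((norm (x + y))\<^sup>2)" and "B = max ((norm (x - y))\<^sup>2) ((norm (x + y))\<^sup>2)"
      have AB: "0 \<le> A" "A \<le> B" "A + B = 2 * s" unfolding A_def B_def s_def using par[of x y] by auto
      have sum: "norm (x - y) powr lam + norm (x + y) powr lam = A powr p + B powr p"
        unfolding np A_def B_def by (auto simp: min_def max_def)
      show "norm (x - y) powr lam + norm (x + y) powr lam \<le> 2 * norm y powr lam + K0 * 4 powr p * norm x powr (min 2 lam) * (1 + norm y powr lam)"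
      proof (cases "B = 0")
        case True
        then have "A = 0" using AB by simp
        then show ?thesis unfolding sum using True K0 by simp
      next
        case False
        then have B: "B > 0" using AB by simp
        then have s: "s > 0" "s \<le> B" "B \<le> 2 * s" using AB by auto
        have ys: "(norm y)\<^sup>2 \<le> s" unfolding s_def by simp
        have sy: "s - (norm y)\<^sup>2 = (norm x)\<^sup>2" unfolding s_def by simp
        have BA: "(B - A)\<^sup>2 \<le> 16 * (norm x)\<^sup>2 * B"
        proof -
          have "\<bar>(norm (x + y))\<^sup>2 - (norm (x - y))\<^sup>2\<bar> = 4 * \<bar>x \<bullet> y\<bar>"
            by (simp add: power2_norm_eq_inner inner_diff_left inner_diff_right inner_add_left inner_add_right inner_commute)
          moreover have "B - A = \<bar>(norm (x + y))\<^sup>2 - (norm (x - y))\<^sup>2\<bar>" unfolding A_def B_def by auto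
          ultimately have "B - A \<le> 4 * (norm x * norm y)" using Cauchy_Schwarz_ineq2[of x y] by simp
          then have "(B - A)\<^sup>2 \<le> (4 * (norm x * norm y))\<^sup>2" using AB by (intro power_mono) auto
          also have "\<dots> = 16 * (norm x)\<^sup>2 * (norm y)\<^sup>2" by (simp add: power_mult_distrib)
          also have "\<dots> \<le> 16 * (norm x)\<^sup>2 * B" using ys s by (intro mult_left_mono) auto
          finally show ?thesis .
        qed
        have "A powr p + B powr p \<le> 2 * s powr p + p * max 1 (p - 1) * ((B - A)\<^sup>2 / 2) * B powr (p - 2)"
          using powr_second_difference[OF p1 AB(1,2) B] AB(3) by simp
        also have "\<dots> \<le> 2 * s powr p + p * max 1 (p - 1) * (16 * (norm x)\<^sup>2 * B / 2) * B powr (p - 2)"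
          using BA p1 by (intro add_left_mono mult_right_mono mult_left_mono divide_right_mono) auto
        also have "\<dots> = 2 * s powr p + 8 * p * max 1 (p - 1) * (norm x)\<^sup>2 * B powr (p - 1)"
        proof -
          have "B powr (p - 1) = B powr (p - 2) * B" using B powr_add[of B "p - 2" 1] by simp
          then show ?thesis by (simp add: algebra_simps)
        qed
        also have "\<dots> \<le> 2 * (norm y powr lam + p * (norm x)\<^sup>2 * B powr (p - 1)) + 8 * p * max 1 (p - 1) * (norm x)\<^sup>2 * B powr (p - 1)"
        proof -
          have "s powr p - ((norm y)\<^sup>2) powr p \<le> p * s powr (p - 1) * (norm x)\<^sup>2"
            using powr_diff_le[of s "(norm y)\<^sup>2" p] s p1 sy by simp
          also have "\<dots> \<le> p * B powr (p - 1) * (norm x)\<^sup>2"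
            using s p1 by (intro mult_right_mono mult_left_mono powr_mono2) auto
          finally show ?thesis unfolding np by (simp add: algebra_simps)
        qed
        also have "\<dots> = 2 * norm y powr lam + K0 * (norm x)\<^sup>2 * B powr (p - 1)" unfolding K0_def by (simp add: algebra_simps)
        also have "\<dots> \<le> 2 * norm y powr lam + K0 * (norm x)\<^sup>2 * (4 powr p * (1 + norm y powr lam))"
        proof -
          \<comment> \<open>Since \<open>norm x \<le> 1\<close>, \<open>B\<close> is at most
            \<open>4 * ?m\<close>. This explains the factor \<open>4 powr p\<close> in the final
            constant.\<close>
          let ?m = "max 1 ((norm y)\<^sup>2)"
          have "(norm x)\<^sup>2 \<le> 1" using x1 by (simp add: power_le_one)
          then have "B \<le> 4 * ?m" using s(3) unfolding s_def by (auto simp: max_def)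
          then have "B powr (p - 1) \<le> (4 * ?m) powr (p - 1)" using B p1 by (intro powr_mono2) auto
          also have "\<dots> \<le> (4 * ?m) powr p" by (intro powr_mono) auto
          also have "\<dots> = 4 powr p * ?m powr p" by (simp add: powr_mult)
          also have "\<dots> \<le> 4 powr p * (1 + norm y powr lam)" unfolding np by (intro mult_left_mono) (auto simp: max_def)
          finally show ?thesis using K0 by (intro add_left_mono mult_left_mono) auto
        qed
        also have "\<dots> = 2 * norm y powr lam + K0 * 4 powr p * norm x powr (min 2 lam) * (1 + norm y powr lam)"
          using False p1 \<open>\<not> lam \<le> 2\<close> by (simp add: min_absorb1 mult_ac)
        finally show ?thesis unfolding sum .
      qed
    qed
  qed
qed

text \<open>Spreading a small part of the point mass over the density \<open>\<phi>\<close> near the origin changes the energy by at most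
  a multiple of \<open>\<integral>|x|\<^sup>\<beta> \<phi>\<close>, because the even part of the potential is flat to order \<open>\<beta> = min 2 lam\<close>
  at the origin; the gain in the \<open>q\<close>-mass then forces \<open>\<rho> \<ge> k|x|\<^bsup>-\<gamma>\<^esup>\<close> with \<open>\<gamma> = \<beta> / (1 - q) \<ge> N\<close>,
  which is not integrable.\<close>

theorem no_point_mass:
  fixes lam q c N th al M :: real and \<rho> :: "'a::euclidean_space \<Rightarrow> real"
  assumes N_def: "N = real DIM('a::euclidean_space)"
    and lam: "lam > 0" and q: "0 < q" "q < 1" and c: "c > 0" and th1: "th \<ge> 1"
    and hyp: "\<And>f::'a \<Rightarrow> real. admissible q f \<Longrightarrow> ennreal (c * mass f powr al * mass (\<lambda>x. f x powr q) powr th) \<le> bienergy lam f f"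
    and \<rho>: "admissible q \<rho>" and ev: "\<And>x. \<rho> (- x) = \<rho> x" and M: "M \<ge> 0" and m: "mass \<rho> + M = 1"
    and Q: "mass (\<lambda>x. \<rho> x powr q) = 1" and T: "moment lam \<rho> < \<infinity>"
    and le: "bienergy lam \<rho> \<rho> + moment lam \<rho> * ennreal (2 * M) \<le> ennreal c"
    and \<beta>: "N * (1 - q) \<le> min 2 lam"
  shows "M = 0"
proof (rule ccontr)
  assume "M \<noteq> 0"
  with M have M0: "M > 0" by simp
  have [measurable]: "\<rho> \<in> borel_measurable borel" and \<rho>0: "\<And>x. 0 \<le> \<rho> x" and \<rho>i: "integrable lborel \<rho>" "integrable lborel (\<lambda>x. \<rho> x powr q)"
    using \<rho> unfolding admissible_def by auto
  have m1: "mass \<rho> \<le> 1" "M \<le> 1" using m M mass_nonneg[of \<rho>] \<rho>0 by auto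
  define b where "b = min 2 lam"
  have b: "b > 0" "b \<le> lam" unfolding b_def using lam by auto
  define t where "t = enn2real (moment lam \<rho>)"
  have t: "moment lam \<rho> = ennreal t" "t \<ge> 0" unfolding t_def using T by auto
  define I where "I = enn2real (bienergy lam \<rho> \<rho>)"
  have "bienergy lam \<rho> \<rho> \<le> ennreal c" using le by (rule order_trans[rotated]) simp
  then have "bienergy lam \<rho> \<rho> < \<infinity>" by (rule le_less_trans) simp
  then have I: "bienergy lam \<rho> \<rho> = ennreal I" "I \<ge> 0" unfolding I_def by auto
  have le': "I + t * (2 * M) \<le> c"
    using le c I t M unfolding I t by (simp add: ennreal_mult'[symmetric] ennreal_plus[symmetric] del: ennreal_plus)
  obtain K where K: "K \<ge> 0" "\<And>x y :: 'a. norm x \<le> 1 \<Longrightarrow>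
    norm (x - y) powr lam + norm (x + y) powr lam \<le> 2 * norm y powr lam + K * norm x powr b * (1 + norm y powr lam)"
    unfolding b_def using norm_powr_second_difference[OF lam, where 'a='a] by blast
  \<comment> \<open>The three summands bound the coefficients of \<open>z\<close> in the first
    variation: the non-constant part of the potential of \<open>\<rho>\<close>, the self-interaction
    of the spread mass, and its interaction with the remaining point mass, for which
    \<open>M \<le> 1\<close>.\<close>
  define A where "A = K * (1 + t) + 2 * 2 powr lam + 2"
  have A: "A > 0" unfolding A_def using K t by (auto intro!: add_nonneg_pos add_nonneg_nonneg)
  \<comment> \<open>Evenness of \<open>\<rho>\<close> replaces the kernel by its symmetric second
    difference. The potential then exceeds its value \<open>t\<close> at the origin only by order
    \<open>norm x powr b\<close>.\<close>
  have pot: "2 * (\<integral>\<^sup>+y. ennreal (norm (x - y) powr lam * \<rho> y) \<partial>lborel) \<le> ennreal (2 * t + K * norm x powr b * (1 + t))"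
    if x: "norm x \<le> 1" for x
  proof -
    have "2 * (\<integral>\<^sup>+y. ennreal (norm (x - y) powr lam * \<rho> y) \<partial>lborel)
        = (\<integral>\<^sup>+y. ennreal ((norm (x - y) powr lam + norm (x - - y) powr lam) * \<rho> y) \<partial>lborel)"
      by (rule nn_integral_even) (auto simp: \<rho>0 ev)
    also have "\<dots> \<le> (\<integral>\<^sup>+y. ennreal (2 + K * norm x powr b) * ennreal (norm y powr lam * \<rho> y) + ennreal (K * norm x powr b) * ennreal (\<rho> y) \<partial>lborel)"
    proof (rule nn_integral_mono)
      fix y
      have "(norm (x - y) powr lam + norm (x - - y) powr lam) * \<rho> y \<le> (2 * norm y powr lam + K * norm x powr b * (1 + norm y powr lam)) * \<rho> y"
        using K(2)[OF x, of y] by (intro mult_right_mono \<rho>0) simp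
      also have "\<dots> = (2 + K * norm x powr b) * (norm y powr lam * \<rho> y) + K * norm x powr b * \<rho> y" by (simp add: algebra_simps)
      finally have "ennreal ((norm (x - y) powr lam + norm (x - - y) powr lam) * \<rho> y)
        \<le> ennreal ((2 + K * norm x powr b) * (norm y powr lam * \<rho> y) + K * norm x powr b * \<rho> y)" by (rule ennreal_leI)
      also have "\<dots> = ennreal (2 + K * norm x powr b) * ennreal (norm y powr lam * \<rho> y) + ennreal (K * norm x powr b) * ennreal (\<rho> y)"
        using K \<rho>0 by (simp only: ennreal_mult'[symmetric] ennreal_plus[symmetric] mult_nonneg_nonneg add_nonneg_nonneg powr_ge_zero zero_le_numeral)
      finally show "ennreal ((norm (x - y) powr lam + norm (x - - y) powr lam) * \<rho> y)
         \<le> ennreal (2 + K * norm x powr b) * ennreal (norm y powr lam * \<rho> y) + ennreal (K * norm x powr b) * ennreal (\<rho> y)" .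
    qed
    also have "\<dots> = ennreal (2 + K * norm x powr b) * moment lam \<rho> + ennreal (K * norm x powr b) * ennreal (mass \<rho>)"
      unfolding moment_def by (simp add: nn_integral_add nn_integral_cmult mass_nn_integral[OF \<rho>i(1) \<rho>0])
    also have "\<dots> = ennreal ((2 + K * norm x powr b) * t + K * norm x powr b * mass \<rho>)"
      unfolding t(1) using K t mass_nonneg[of \<rho>] \<rho>0
      by (simp only: ennreal_mult'[symmetric] ennreal_plus[symmetric] mult_nonneg_nonneg add_nonneg_nonneg powr_ge_zero zero_le_numeral)
    also have "\<dots> \<le> ennreal (2 * t + K * norm x powr b * (1 + t))"
    proof (rule ennreal_leI)
      have "K * norm x powr b * mass \<rho> \<le> K * norm x powr b * 1" using K m1 by (intro mult_left_mono) auto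
      then show "(2 + K * norm x powr b) * t + K * norm x powr b * mass \<rho> \<le> 2 * t + K * norm x powr b * (1 + t)"
        by (simp add: algebra_simps)
    qed
    finally show ?thesis .
  qed
  \<comment> \<open>First variation: the mass of \<open>\<phi>\<close> is taken out of the point
    mass, so the total stays 1 and \<open>al\<close> drops out. The cost
    \<open>2 * t * \<mu>\<close> of the new density cancels against the saving of the point mass.
    Only multiples of the \<open>b\<close>-th moment of \<open>\<phi>\<close> remain.\<close>
  have gain: "c * (mass (\<lambda>x. (\<rho> x + \<phi> x) powr q) - 1) \<le> A * mass (\<lambda>x. norm x powr b * \<phi> x)"
    if [measurable]: "\<phi> \<in> borel_measurable borel" and \<phi>: "\<And>x. 0 \<le> \<phi> x" "\<And>x. \<phi> x \<le> B" "\<And>x. norm x > 1 \<Longrightarrow> \<phi> x = 0"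
      and \<phi>M: "mass \<phi> \<le> M" for \<phi> B
  proof -
    define z where "z = mass (\<lambda>x. norm x powr b * \<phi> x)"
    define \<mu> where "\<mu> = mass \<phi>"
    have B: "B \<ge> 0" using \<phi>(1,2)[of 0] by linarith
    have i1: "integrable lborel \<phi>" by (rule integrable_compact_support[OF _ \<phi>]) auto
    have x1: "norm x powr b \<le> 1" if "norm x \<le> 1" for x :: 'a using that b powr_mono2[of b "norm x" 1] by simp
    have i2: "integrable lborel (\<lambda>x. norm x powr b * \<phi> x)"
    proof (rule integrable_compact_support[of _ B 1])
      show "norm x powr b * \<phi> x \<le> B" for x
      proof (cases "norm x > 1")
        case False
        then have "norm x powr b * \<phi> x \<le> 1 * B" using x1 \<phi> by (intro mult_mono) auto
        then show ?thesis by simp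
      qed (use \<phi> B in auto)
    qed (use \<phi> in auto)
    have z0: "z \<ge> 0" unfolding z_def by (rule mass_nonneg) (use \<phi> in auto)
    have mu0: "\<mu> \<ge> 0" unfolding \<mu>_def by (rule mass_nonneg) (use \<phi> in auto)
    have zn: "(\<integral>\<^sup>+x. ennreal (norm x powr b * \<phi> x) \<partial>lborel) = ennreal z"
      unfolding z_def by (rule mass_nn_integral[OF i2]) (use \<phi> in auto)
    have mn: "(\<integral>\<^sup>+x. ennreal (\<phi> x) \<partial>lborel) = ennreal \<mu>"
      unfolding \<mu>_def by (rule mass_nn_integral[OF i1]) (use \<phi> in auto)
    have momle: "moment lam \<phi> \<le> ennreal z"
      unfolding zn[symmetric] moment_def
    proof (intro nn_integral_mono ennreal_leI)
      fix x :: 'a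
      show "norm x powr lam * \<phi> x \<le> norm x powr b * \<phi> x"
        using \<phi> b powr_mono'[of b lam "norm x"] by (cases "norm x > 1") (auto intro!: mult_right_mono)
    qed
    have cross: "2 * bienergy lam \<phi> \<rho> \<le> ennreal (2 * t * \<mu> + K * (1 + t) * z)"
    proof -
      have "2 * bienergy lam \<phi> \<rho> = (\<integral>\<^sup>+x. ennreal (\<phi> x) * (2 * (\<integral>\<^sup>+y. ennreal (norm (x - y) powr lam * \<rho> y) \<partial>lborel)) \<partial>lborel)"
        by (subst bienergy_eq_potential) (auto simp: \<phi> nn_integral_cmult[symmetric] mult_ac)
      also have "\<dots> \<le> (\<integral>\<^sup>+x. ennreal (2 * t) * ennreal (\<phi> x) + ennreal (K * (1 + t)) * ennreal (norm x powr b * \<phi> x) \<partial>lborel)"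
      proof (rule nn_integral_mono)
        fix x :: 'a
        show "ennreal (\<phi> x) * (2 * (\<integral>\<^sup>+y. ennreal (norm (x - y) powr lam * \<rho> y) \<partial>lborel))
          \<le> ennreal (2 * t) * ennreal (\<phi> x) + ennreal (K * (1 + t)) * ennreal (norm x powr b * \<phi> x)"
        proof (cases "norm x > 1")
          case False
          then have "ennreal (\<phi> x) * (2 * (\<integral>\<^sup>+y. ennreal (norm (x - y) powr lam * \<rho> y) \<partial>lborel)) \<le> ennreal (\<phi> x) * ennreal (2 * t + K * norm x powr b * (1 + t))"
            by (intro mult_left_mono pot) auto
          also have "\<dots> = ennreal (\<phi> x * (2 * t + K * norm x powr b * (1 + t)))" using \<phi> by (simp only: ennreal_mult'[symmetric])
          also have "\<phi> x * (2 * t + K * norm x powr b * (1 + t)) = 2 * t * \<phi> x + K * (1 + t) * (norm x powr b * \<phi> x)" by (simp add: algebra_simps)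
          also have "ennreal \<dots> = ennreal (2 * t) * ennreal (\<phi> x) + ennreal (K * (1 + t)) * ennreal (norm x powr b * \<phi> x)"
            using K t \<phi>
            by (simp only: ennreal_mult'[symmetric] ennreal_plus[symmetric] mult_nonneg_nonneg add_nonneg_nonneg powr_ge_zero zero_le_numeral zero_le_one)
          finally show ?thesis .
        qed (simp add: \<phi>)
      qed
      also have "\<dots> = ennreal (2 * t) * ennreal \<mu> + ennreal (K * (1 + t)) * ennreal z"
        by (simp add: nn_integral_add nn_integral_cmult zn mn)
      also have "\<dots> = ennreal (2 * t * \<mu> + K * (1 + t) * z)"
        using K t mu0 z0 by (simp only: ennreal_mult'[symmetric] ennreal_plus[symmetric] mult_nonneg_nonneg add_nonneg_nonneg zero_le_numeral zero_le_one)
      finally show ?thesis .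
    qed
    have self: "bienergy lam \<phi> \<phi> \<le> ennreal (2 * 2 powr lam * z)"
    proof -
      have "bienergy lam \<phi> \<phi> \<le> (\<integral>\<^sup>+x. (\<integral>\<^sup>+y. ennreal (2 powr lam * \<phi> y) * ennreal (norm x powr lam * \<phi> x) + ennreal (2 powr lam * \<phi> x) * ennreal (norm y powr lam * \<phi> y) \<partial>lborel) \<partial>lborel)"
        unfolding bienergy_def
      proof (intro nn_integral_mono)
        fix x y :: 'a
        have "norm (x - y) powr lam \<le> (norm x + norm y) powr lam" using lam by (intro powr_mono2 norm_triangle_ineq4) auto
        also have "\<dots> \<le> 2 powr lam * (norm x powr lam + norm y powr lam)" using lam by (intro powr_add_le) auto
        finally have "norm (x - y) powr lam * (\<phi> x * \<phi> y) \<le> 2 powr lam * (norm x powr lam + norm y powr lam) * (\<phi> x * \<phi> y)"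
          using \<phi> by (intro mult_right_mono mult_nonneg_nonneg) auto
        then have "\<phi> x * norm (x - y) powr lam * \<phi> y \<le> (2 powr lam * \<phi> y) * (norm x powr lam * \<phi> x) + (2 powr lam * \<phi> x) * (norm y powr lam * \<phi> y)"
          by (simp add: algebra_simps)
        then have "ennreal (\<phi> x * norm (x - y) powr lam * \<phi> y) \<le> ennreal ((2 powr lam * \<phi> y) * (norm x powr lam * \<phi> x) + (2 powr lam * \<phi> x) * (norm y powr lam * \<phi> y))"
          by (rule ennreal_leI)
        also have "\<dots> = ennreal (2 powr lam * \<phi> y) * ennreal (norm x powr lam * \<phi> x) + ennreal (2 powr lam * \<phi> x) * ennreal (norm y powr lam * \<phi> y)"
          using \<phi> by (simp only: ennreal_mult'[symmetric] ennreal_plus[symmetric] mult_nonneg_nonneg powr_ge_zero)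
        finally show "ennreal (\<phi> x * norm (x - y) powr lam * \<phi> y)
          \<le> ennreal (2 powr lam * \<phi> y) * ennreal (norm x powr lam * \<phi> x) + ennreal (2 powr lam * \<phi> x) * ennreal (norm y powr lam * \<phi> y)" .
      qed
      also have "\<dots> = 2 * (ennreal (2 powr lam) * (ennreal \<mu> * moment lam \<phi>))"
      proof -
        have *: "(\<integral>\<^sup>+y. ennreal (2 powr lam * \<phi> y) \<partial>lborel) = ennreal (2 powr lam) * ennreal \<mu>"
          using \<phi> by (simp add: ennreal_mult' nn_integral_cmult mn)
        have "(\<integral>\<^sup>+x. (\<integral>\<^sup>+y. ennreal (2 powr lam * \<phi> y) * ennreal (norm x powr lam * \<phi> x) + ennreal (2 powr lam * \<phi> x) * ennreal (norm y powr lam * \<phi> y) \<partial>lborel) \<partial>lborel)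
          = (\<integral>\<^sup>+x. (ennreal (2 powr lam) * ennreal \<mu>) * ennreal (norm x powr lam * \<phi> x) + ennreal (2 powr lam * \<phi> x) * moment lam \<phi> \<partial>lborel)"
          unfolding *[symmetric] moment_def by (simp add: nn_integral_add nn_integral_cmult nn_integral_multc)
        also have "\<dots> = (ennreal (2 powr lam) * ennreal \<mu>) * moment lam \<phi> + (ennreal (2 powr lam) * ennreal \<mu>) * moment lam \<phi>"
          by (subst nn_integral_add) (auto simp: nn_integral_cmult nn_integral_multc * moment_def)
        finally show ?thesis by (simp only: mult_2 mult.assoc)
      qed
      also have "\<dots> \<le> 2 * (ennreal (2 powr lam) * (ennreal 1 * ennreal z))"
        using \<phi>M m1 momle unfolding \<mu>_def by (intro mult_left_mono mult_mono ennreal_leI) auto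
      also have "\<dots> = ennreal (2 * 2 powr lam * z)" using z0 by (simp add: ennreal_mult' mult_ac)
      finally show ?thesis .
    qed
    note add = admissible_add[where g=\<phi> and B=B and R=1, OF \<rho> q(1) _ \<phi>, simplified]
    define Q' where "Q' = mass (\<lambda>x. (\<rho> x + \<phi> x) powr q)"
    have Q1: "Q' \<ge> 1" unfolding Q'_def using add(3) Q by simp
    have "ennreal (c * (mass (\<lambda>x. \<rho> x + \<phi> x) + (M - \<mu>)) powr al * Q' powr th)
        \<le> bienergy lam (\<lambda>x. \<rho> x + \<phi> x) (\<lambda>x. \<rho> x + \<phi> x) + moment lam (\<lambda>x. \<rho> x + \<phi> x) * ennreal (2 * (M - \<mu>))"
      unfolding Q'_def by (rule relaxed_inequality[OF lam q(1) _ _ hyp add(1)]) (use c th1 \<phi>M in \<open>auto simp: \<mu>_def\<close>)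
    also have "mass (\<lambda>x. \<rho> x + \<phi> x) + (M - \<mu>) = 1" using add(2) m unfolding \<mu>_def by simp
    also have "bienergy lam (\<lambda>x. \<rho> x + \<phi> x) (\<lambda>x. \<rho> x + \<phi> x) = ennreal I + 2 * bienergy lam \<phi> \<rho> + bienergy lam \<phi> \<phi>"
      by (subst bienergy_add) (auto simp: \<rho>0 \<phi> I)
    also have "moment lam (\<lambda>x. \<rho> x + \<phi> x) = ennreal t + moment lam \<phi>"
      unfolding t(1)[symmetric] moment_def using \<rho>0 \<phi>
      by (subst nn_integral_add[symmetric]) (auto simp: distrib_left intro!: nn_integral_cong)
    also have "ennreal I + 2 * bienergy lam \<phi> \<rho> + bienergy lam \<phi> \<phi> + (ennreal t + moment lam \<phi>) * ennreal (2 * (M - \<mu>))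
      \<le> ennreal I + ennreal (2 * t * \<mu> + K * (1 + t) * z) + ennreal (2 * 2 powr lam * z) + (ennreal t + ennreal z) * ennreal (2 * (M - \<mu>))"
      by (intro add_mono mult_right_mono cross self momle) auto
    also have "\<dots> = ennreal (I + (2 * t * \<mu> + K * (1 + t) * z) + 2 * 2 powr lam * z + (t + z) * (2 * (M - \<mu>)))"
    proof -
      have "0 \<le> 2 * (M - \<mu>)" using \<phi>M unfolding \<mu>_def by simp
      then show ?thesis using K t mu0 z0 I(2)
        by (simp only: ennreal_mult'[symmetric] ennreal_plus[symmetric] mult_nonneg_nonneg add_nonneg_nonneg powr_ge_zero zero_le_numeral zero_le_one)
    qed
    also have "\<dots> \<le> ennreal (c + A * z)"
    proof (rule ennreal_leI)
      have "z * (M - \<mu>) \<le> z * 1" using m1 mu0 z0 by (intro mult_left_mono) auto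
      then show "I + (2 * t * \<mu> + K * (1 + t) * z) + 2 * 2 powr lam * z + (t + z) * (2 * (M - \<mu>)) \<le> c + A * z"
        using le' unfolding A_def by (simp add: algebra_simps)
    qed
    finally have "c * 1 powr al * Q' powr th \<le> c + A * z"
      by (subst (asm) ennreal_le_iff) (use c A z0 in auto)
    \<comment> \<open>Here \<open>th \<ge> 1\<close> and \<open>Q' \<ge> 1\<close> make the gain at
      least linear in the \<open>q\<close>-mass.\<close>
    moreover have "c * Q' \<le> c * Q' powr th" using Q1 th1 powr_mono[of 1 th Q'] c by (intro mult_left_mono) auto
    ultimately have "c * Q' \<le> c + A * z" by simp
    then show ?thesis unfolding Q'_def z_def by (simp add: algebra_simps)
  qed
  \<comment> \<open>With this exponent, the power \<open>q - 1\<close> of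
    \<open>norm x powr - \<gamma>\<close> is exactly \<open>norm x powr b\<close>, the weight in the
    cost.\<close>
  define \<gamma> where "\<gamma> = b / (1 - q)"
  have \<gamma>: "\<gamma> \<ge> N" unfolding \<gamma>_def using \<beta> q by (simp add: b_def pos_le_divide_eq)
  \<comment> \<open>Chosen so that \<open>c * q * k powr (q - 1) = A + c * q\<close>. The surplus
    \<open>c * q\<close> makes the gain exceed the cost wherever \<open>\<rho>\<close> lies below
    the profile.\<close>
  define k where "k = (A / (c * q) + 1) powr - (1 / (1 - q))"
  have "A / (c * q) + 1 > 0" using A c q by (intro add_pos_pos divide_pos_pos mult_pos_pos) auto
  then have k: "k > 0" unfolding k_def powr_gt_zero by (metis less_irrefl)
  have kq: "k powr (q - 1) = A / (c * q) + 1"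
  proof -
    have "A / (c * q) + 1 > 0" using A c q by (simp add: add_pos_pos)
    moreover have "- (1 / (1 - q)) * (q - 1) = 1" using q by (simp add: field_simps)
    ultimately show ?thesis unfolding k_def powr_powr by (metis less_imp_le powr_one)
  qed
  have lower: "AE x in lborel. x \<in> annulus e 1 \<longrightarrow> k * norm x powr - \<gamma> \<le> \<rho> x" if e: "e > 0" for e
  proof -
    define v where "v x = k * norm x powr - \<gamma>" for x :: 'a
    define f where "f x = max 0 (v x - \<rho> x) * indicator (annulus e 1) x" for x
    have [measurable]: "v \<in> borel_measurable borel" "f \<in> borel_measurable borel" unfolding v_def f_def by measurable
    have g0: "\<gamma> > 0" using \<gamma> unfolding N_def by (smt (verit) DIM_positive of_nat_0_less_iff)
    have f: "0 \<le> f x" "f x \<le> k * e powr - \<gamma>" "norm x > 1 \<Longrightarrow> f x = 0" for x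
    proof -
      show "0 \<le> f x" "norm x > 1 \<Longrightarrow> f x = 0" unfolding f_def by (auto simp: annulus_def)
      have "v x \<le> k * e powr - \<gamma>" if "x \<in> annulus e 1"
        unfolding v_def using that e g0 k by (intro mult_left_mono powr_mono2') (auto simp: annulus_def)
      then show "f x \<le> k * e powr - \<gamma>" unfolding f_def using \<rho>0[of x] k by (auto simp: indicator_def max_def)
    qed
    have fi: "integrable lborel f" by (rule integrable_compact_support[OF _ f]) auto
    have f1: "mass f \<ge> 0" by (rule mass_nonneg[OF f(1)])
    \<comment> \<open>The deficit of \<open>\<rho>\<close> below the profile may weigh more than the
      available point mass \<open>M\<close>, so only a fraction \<open>s\<close> of it is
      filled.\<close>
    define s where "s = min 1 (M / (mass f + 1))"
    have s: "0 < s" "s \<le> 1" unfolding s_def using M0 f1 by auto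
    have sM: "s * mass f \<le> M"
    proof -
      have "s * mass f \<le> M / (mass f + 1) * mass f" unfolding s_def using f1 by (intro mult_right_mono) auto
      also have "\<dots> \<le> M" using f1 M0 by (simp add: field_simps)
      finally show ?thesis .
    qed
    define \<phi> where "\<phi> x = s * f x" for x
    have [measurable]: "\<phi> \<in> borel_measurable borel" unfolding \<phi>_def by measurable
    have \<phi>: "0 \<le> \<phi> x" "\<phi> x \<le> k * e powr - \<gamma>" "norm x > 1 \<Longrightarrow> \<phi> x = 0" for x
      unfolding \<phi>_def using f[of x] s mult_mono[of s 1 "f x" "k * e powr - \<gamma>"] by auto
    have m\<phi>: "mass \<phi> = s * mass f" unfolding \<phi>_def mass_def by simp
    have g: "c * (mass (\<lambda>x. (\<rho> x + \<phi> x) powr q) - 1) \<le> A * mass (\<lambda>x. norm x powr b * \<phi> x)"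
      by (rule gain[OF _ \<phi>]) (use sM m\<phi> in auto)
    define z where "z = mass (\<lambda>x. norm x powr b * \<phi> x)"
    \<comment> \<open>Concavity: after the filling the value is still at most \<open>v x\<close>,
      and \<open>q - 1\<close> is negative, so the slope along the whole increment is at least that
      at \<open>v x\<close>.\<close>
    have pt: "q * k powr (q - 1) * (norm x powr b * \<phi> x) \<le> (\<rho> x + \<phi> x) powr q - \<rho> x powr q" for x
    proof (cases "f x = 0")
      case False
      then have x: "x \<in> annulus e 1" "f x = v x - \<rho> x" "v x > \<rho> x" unfolding f_def by (auto simp: max_def indicator_def split: if_splits)
      then have nx: "norm x > 0" using e by (auto simp: annulus_def)
      have u: "\<rho> x + \<phi> x \<le> v x" "\<rho> x + \<phi> x > 0"
      proof -
        have "s * f x \<le> f x" using s f(1)[of x] mult_right_mono[of s 1 "f x"] by simp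
        then show "\<rho> x + \<phi> x \<le> v x" unfolding \<phi>_def using x by linarith
        have "s * f x > 0" using s x by simp
        then show "\<rho> x + \<phi> x > 0" unfolding \<phi>_def using \<rho>0[of x] by linarith
      qed
      have "k powr (q - 1) * norm x powr b = v x powr (q - 1)"
      proof -
        have "- \<gamma> * (q - 1) = b" unfolding \<gamma>_def using q by (simp add: field_simps)
        then show ?thesis unfolding v_def using k nx by (simp add: powr_mult powr_powr)
      qed
      also have "\<dots> \<le> (\<rho> x + \<phi> x) powr (q - 1)" using u q by (intro powr_mono2') auto
      finally have "q * (k powr (q - 1) * norm x powr b) * \<phi> x \<le> q * (\<rho> x + \<phi> x) powr (q - 1) * \<phi> x"
        using q \<phi> by (intro mult_right_mono mult_left_mono) auto
      also have "\<dots> = q * (\<rho> x + \<phi> x) powr (q - 1) * ((\<rho> x + \<phi> x) - \<rho> x)" by simp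
      also have "\<dots> \<le> (\<rho> x + \<phi> x) powr q - \<rho> x powr q" using u \<rho>0 q by (intro powr_diff_ge) auto
      finally show ?thesis by (simp add: mult_ac)
    qed (simp add: \<phi>_def)
    note add = admissible_add[where g=\<phi> and B="k * e powr - \<gamma>" and R=1, OF \<rho> q(1) _ \<phi>, simplified]
    have qi: "integrable lborel (\<lambda>x. (\<rho> x + \<phi> x) powr q)" using add(1) unfolding admissible_def by simp
    have x1: "norm x powr b * \<phi> x \<le> k * e powr - \<gamma>" for x
    proof (cases "norm x > 1")
      case False
      then have "norm x powr b * \<phi> x \<le> 1 * (k * e powr - \<gamma>)" using \<phi> b powr_mono2[of b "norm x" 1] by (intro mult_mono) auto
      then show ?thesis by simp
    qed (use \<phi> k in auto)
    have zi: "integrable lborel (\<lambda>x. norm x powr b * \<phi> x)"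
      by (rule integrable_compact_support[of _ "k * e powr - \<gamma>" 1]) (use \<phi> x1 in auto)
    have "q * k powr (q - 1) * z \<le> mass (\<lambda>x. (\<rho> x + \<phi> x) powr q) - 1"
    proof -
      have "q * k powr (q - 1) * z = (\<integral>x. q * k powr (q - 1) * (norm x powr b * \<phi> x) \<partial>lborel)"
        unfolding z_def mass_def by simp
      also have "\<dots> \<le> (\<integral>x. (\<rho> x + \<phi> x) powr q - \<rho> x powr q \<partial>lborel)"
        by (rule integral_mono) (use pt zi qi \<rho>i in auto)
      also have "\<dots> = mass (\<lambda>x. (\<rho> x + \<phi> x) powr q) - 1"
        unfolding Q[symmetric] mass_def by (rule Bochner_Integration.integral_diff[OF qi \<rho>i(2)])
      finally show ?thesis .
    qed
    then have "c * (q * k powr (q - 1) * z) \<le> A * z" using g c unfolding z_def by (meson mult_left_mono less_imp_le order_trans)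
    \<comment> \<open>Comparison with the upper bound for the gain leaves
      \<open>c * q * z \<le> 0\<close>, so the deficit vanishes almost everywhere.\<close>
    moreover have "c * (q * k powr (q - 1) * z) = A * z + c * q * z" unfolding kq using c q by (simp add: field_simps)
    ultimately have "c * q * z \<le> 0" by simp
    moreover have z0: "z \<ge> 0" unfolding z_def by (rule mass_nonneg) (use \<phi> in auto)
    ultimately have "z = 0" using c q by (simp add: mult_le_0_iff)
    then have "AE x in lborel. norm x powr b * \<phi> x = 0"
      unfolding z_def mass_def by (subst (asm) integral_nonneg_eq_0_iff_AE[OF zi]) (use \<phi> in auto)
    then show ?thesis
    proof eventually_elim
      case (elim x)
      show ?case
      proof
        assume x: "x \<in> annulus e 1"
        then have "norm x > 0" using e by (auto simp: annulus_def)
        then have "f x = 0" using elim s unfolding \<phi>_def by simp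
        then show "k * norm x powr - \<gamma> \<le> \<rho> x" using x unfolding f_def v_def by (auto simp: max_def split: if_splits)
      qed
    qed
  qed
  \<comment> \<open>The test functions had to be bounded, hence the annuli away from the origin;
    countably many of them exhaust the punctured unit ball.\<close>
  have "AE x in lborel. \<forall>j::nat. x \<in> annulus (1 / real (Suc j)) 1 \<longrightarrow> k * norm x powr - \<gamma> \<le> \<rho> x"
    unfolding AE_all_countable by (intro allI lower) simp
  then have ae: "AE x in lborel. ennreal k * (ennreal (norm x powr - \<gamma>) * indicator (cball 0 1) x) \<le> ennreal (\<rho> x)"
  proof eventually_elim
    case (elim x)
    show ?case
    proof (cases "x \<in> cball 0 1 \<and> x \<noteq> 0")
      case True
      then obtain j :: nat where "1 / real (Suc j) < norm x" using nat_approx_posE[of "norm x"] by auto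
      then have "k * norm x powr - \<gamma> \<le> \<rho> x" using elim True by (auto simp: annulus_def)
      then show ?thesis using True k by (simp add: ennreal_mult'[symmetric] ennreal_leI)
    qed (auto simp: indicator_def)
  qed
  have "ennreal k * \<infinity> = (\<integral>\<^sup>+x. ennreal k * (ennreal (norm x powr - \<gamma>) * indicator (cball 0 1) (x::'a)) \<partial>lborel)"
  proof -
    have [measurable]: "cball 0 1 \<in> sets (borel :: 'a measure)" by auto
    have "(\<integral>\<^sup>+x. ennreal k * (ennreal (norm x powr - \<gamma>) * indicator (cball 0 1) (x::'a)) \<partial>lborel)
      = ennreal k * (\<integral>\<^sup>+x. ennreal (norm x powr - \<gamma>) * indicator (cball 0 1) (x::'a) \<partial>lborel)"
      by (rule nn_integral_cmult) measurable
    then show ?thesis using nn_integral_norm_powr_near_infinite[where 'a='a, of \<gamma>] \<gamma> unfolding N_def by simp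
  qed
  also have "\<dots> \<le> (\<integral>\<^sup>+x. ennreal (\<rho> x) \<partial>lborel)" by (rule nn_integral_mono_AE[OF ae])
  also have "\<dots> = ennreal (mass \<rho>)" by (rule mass_nn_integral[OF \<rho>i(1) \<rho>0])
  finally show False using k by (simp add: ennreal_mult_top top_unique)
qed

section \<open>The sharp constant\<close>

lemma sigma_finite_lebesgue: "sigma_finite_measure (lebesgue :: 'a::euclidean_space measure)"
proof
  obtain A :: "'a set set" where "countable A" "A \<subseteq> sets lborel" "\<Union>A = space lborel" "\<forall>a\<in>A. emeasure lborel a \<noteq> \<infinity>"
    using lborel.sigma_finite_countable by blast
  then show "\<exists>A::'a set set. countable A \<and> A \<subseteq> sets lebesgue \<and> \<Union>A = space lebesgue \<and> (\<forall>a\<in>A. emeasure lebesgue a \<noteq> \<infinity>)"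
    by (intro exI[of _ A]) (auto simp: subset_eq intro!: sets_completionI_sets)
qed

text \<open>Tonelli's theorem is applied on the product of the two completed measures. After that
  each single integral against a completion equals the one against \<open>lborel\<close>, even
  without Borel measurability of the integrand.\<close>

lemma energy_eq_bienergy:
  fixes \<rho> :: "real ^ 'n::finite \<Rightarrow> real"
  assumes \<rho>[measurable]: "\<rho> \<in> borel_measurable lebesgue"
  shows "energy lam \<rho> = bienergy lam \<rho> \<rho>"
proof -
  interpret sigma_finite_measure "lebesgue :: (real ^ 'n) measure" by (rule sigma_finite_lebesgue)
  have [measurable]: "(\<lambda>x. x) \<in> lebesgue \<rightarrow>\<^sub>M (borel :: (real ^ 'n) measure)"
    by (rule measurable_completion) simp
  have fst': "fst \<in> lebesgue \<Otimes>\<^sub>M lebesgue \<rightarrow>\<^sub>M (borel :: (real ^ 'n) measure)"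
    using measurable_compose[OF measurable_fst \<open>(\<lambda>x. x) \<in> lebesgue \<rightarrow>\<^sub>M (borel :: (real ^ 'n) measure)\<close>] .
  have snd': "snd \<in> lebesgue \<Otimes>\<^sub>M lebesgue \<rightarrow>\<^sub>M (borel :: (real ^ 'n) measure)"
    using measurable_compose[OF measurable_snd \<open>(\<lambda>x. x) \<in> lebesgue \<rightarrow>\<^sub>M (borel :: (real ^ 'n) measure)\<close>] .
  have nm: "(\<lambda>p. norm (fst p - snd p)) \<in> borel_measurable (lebesgue \<Otimes>\<^sub>M (lebesgue :: (real ^ 'n) measure))"
    using fst' snd' by measurable
  have "(\<lambda>p. ennreal (\<rho> (fst p) * norm (fst p - snd p) powr lam * \<rho> (snd p))) \<in> borel_measurable (lebesgue \<Otimes>\<^sub>M lebesgue)"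
    using nm by measurable
  then have m: "(\<lambda>(x, y). ennreal (\<rho> x * norm (x - y) powr lam * \<rho> y)) \<in> borel_measurable (lebesgue \<Otimes>\<^sub>M lebesgue)"
    by (simp add: case_prod_beta')
  have "energy lam \<rho> = (\<integral>\<^sup>+x. \<integral>\<^sup>+y. ennreal (\<rho> x * norm (x - y) powr lam * \<rho> y) \<partial>lebesgue \<partial>lebesgue)"
    unfolding energy_def by (subst nn_integral_fst[OF m, symmetric]) simp
  then show ?thesis unfolding bienergy_def nn_integral_completion .
qed

lemma admissible_densities:
  fixes f :: "real ^ 'n::finite \<Rightarrow> real"
  assumes "admissible q f"
  shows "f \<in> densities q" "(\<integral>x. f x \<partial>lebesgue) = mass f" "(\<integral>x. f x powr q \<partial>lebesgue) = mass (\<lambda>x. f x powr q)"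
    "energy lam f = bienergy lam f f"
proof -
  have [measurable]: "f \<in> borel_measurable borel" and f0: "\<And>x. 0 \<le> f x" and fi: "integrable lborel f" "integrable lborel (\<lambda>x. f x powr q)"
    and fn: "\<not> (AE x in lborel. f x = 0)" using assms unfolding admissible_def by auto
  have fm: "f \<in> borel_measurable lebesgue" by (rule measurable_completion) simp
  show "(\<integral>x. f x \<partial>lebesgue) = mass f" "(\<integral>x. f x powr q \<partial>lebesgue) = mass (\<lambda>x. f x powr q)"
    unfolding mass_def by (rule integral_completion; measurable)+
  show "energy lam f = bienergy lam f f" by (rule energy_eq_bienergy[OF fm])
  have p1: "\<bar>f x\<bar> powr 1 = f x" and pq: "\<bar>f x\<bar> powr q = f x powr q" for x using f0[of x] by auto
  have "f \<in> Lp 1"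
    unfolding Lp_def mem_Collect_eq p1 nn_integral_completion using fm mass_nn_integral[OF fi(1) f0] by simp
  moreover have "f \<in> Lp q"
    unfolding Lp_def mem_Collect_eq pq nn_integral_completion using fm mass_nn_integral[OF fi(2)] by simp
  ultimately show "f \<in> densities q" unfolding densities_def using f0 fn by (auto simp: AE_completion_iff)
qed

text \<open>A Borel function agreeing with \<open>\<rho>\<close> almost everywhere is cut at 0 from
  below, since off the common set it could be negative.\<close>

lemma densities_admissible:
  fixes \<rho> :: "real ^ 'n::finite \<Rightarrow> real"
  assumes "\<rho> \<in> densities q"
  obtains f :: "real ^ 'n \<Rightarrow> real" where "admissible q f" "(\<integral>x. \<rho> x \<partial>lebesgue) = mass f" "(\<integral>x. \<rho> x powr q \<partial>lebesgue) = mass (\<lambda>x. f x powr q)"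
    "energy lam \<rho> = bienergy lam f f"
proof -
  have \<rho>m[measurable]: "\<rho> \<in> borel_measurable lebesgue" and \<rho>0: "\<And>x. 0 \<le> \<rho> x"
    and fin: "(\<integral>\<^sup>+x. ennreal (\<bar>\<rho> x\<bar> powr 1) \<partial>lebesgue) < \<infinity>" "(\<integral>\<^sup>+x. ennreal (\<bar>\<rho> x\<bar> powr q) \<partial>lebesgue) < \<infinity>"
    and ne: "\<not> (AE x in lebesgue. \<rho> x = 0)"
    using assms unfolding densities_def Lp_def by auto
  obtain g where g: "g \<in> borel_measurable lborel" "AE x in lborel. \<rho> x = g x"
    using completion_ex_borel_measurable_real[OF \<rho>m] by blast
  define f where "f x = max 0 (g x)" for x
  have [measurable]: "g \<in> borel_measurable borel" using g(1) by simp
  have fm[measurable]: "f \<in> borel_measurable borel" unfolding f_def by measurable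
  have f0: "0 \<le> f x" for x unfolding f_def by simp
  have ae: "AE x in lborel. \<rho> x = f x"
    using g(2) by eventually_elim (metis \<rho>0 f_def max.absorb2)
  then have ae': "AE x in lebesgue. \<rho> x = f x" by (rule AE_completion)
  have n1: "(\<integral>\<^sup>+x. ennreal (f x) \<partial>lborel) = (\<integral>\<^sup>+x. ennreal (\<bar>\<rho> x\<bar> powr 1) \<partial>lebesgue)"
    unfolding nn_integral_completion
    by (rule nn_integral_cong_AE, use ae in eventually_elim) (use \<rho>0 in \<open>auto simp: f0\<close>)
  have n2: "(\<integral>\<^sup>+x. ennreal (f x powr q) \<partial>lborel) = (\<integral>\<^sup>+x. ennreal (\<bar>\<rho> x\<bar> powr q) \<partial>lebesgue)"
    unfolding nn_integral_completion
    by (rule nn_integral_cong_AE, use ae in eventually_elim) (use \<rho>0 in \<open>auto simp: f0\<close>)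
  have i1: "integrable lborel f" by (rule integrableI_nonneg) (use n1 fin f0 in auto)
  have i2: "integrable lborel (\<lambda>x. f x powr q)" by (rule integrableI_nonneg) (use n2 fin f0 in auto)
  have "\<not> (AE x in lborel. f x = 0)"
  proof
    assume "AE x in lborel. f x = 0"
    with ae have "AE x in lborel. \<rho> x = 0" by eventually_elim simp
    with ne show False using AE_completion by blast
  qed
  then have adm: "admissible q f" unfolding admissible_def using i1 i2 f0 by auto
  have fm': "f \<in> borel_measurable lebesgue" by (rule measurable_completion) simp
  have "(\<integral>x. \<rho> x \<partial>lebesgue) = (\<integral>x. f x \<partial>lebesgue)"
    by (rule integral_cong_AE) (use ae' fm' in auto)
  moreover have "(\<integral>x. \<rho> x powr q \<partial>lebesgue) = (\<integral>x. f x powr q \<partial>lebesgue)"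
  proof (rule integral_cong_AE)
    show "(\<lambda>x. f x powr q) \<in> borel_measurable lebesgue" using fm' by measurable
    show "AE x in lebesgue. \<rho> x powr q = f x powr q" using ae' by eventually_elim simp
  qed measurable
  moreover have "energy lam \<rho> = bienergy lam f f"
    unfolding energy_eq_bienergy[OF \<rho>m] by (rule bienergy_cong_AE[OF ae])
  ultimately show ?thesis using that[OF adm] admissible_densities[OF adm] by simp
qed

lemma ennreal_le_divide_iff:
  assumes "x > 0" shows "a \<le> b / ennreal x \<longleftrightarrow> a * ennreal x \<le> b"
proof -
  have x: "ennreal x \<noteq> 0" "ennreal x \<noteq> top" using assms by auto
  have 1: "b / ennreal x * ennreal x = b" for b :: ennreal
    using x by (simp add: ennreal_divide_times)
  show ?thesis
  proof
    assume "a \<le> b / ennreal x"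
    then have "a * ennreal x \<le> b / ennreal x * ennreal x" by (rule mult_right_mono) simp
    then show "a * ennreal x \<le> b" unfolding 1 .
  next
    assume "a * ennreal x \<le> b"
    then have "a * ennreal x / ennreal x \<le> b / ennreal x" by (rule divide_right_mono_ennreal)
    then show "a \<le> b / ennreal x" using x by (simp add: ennreal_mult_divide_eq)
  qed
qed

text \<open>The indicator of the unit ball is the competitor that makes the infimum finite.\<close>

lemma admissible_finite_energy:
  assumes lam: "lam > 0"
  obtains f :: "'a::euclidean_space \<Rightarrow> real" where "admissible q f" "bienergy lam f f < \<infinity>"
proof -
  define f where "f = (indicator (cball 0 1) :: 'a \<Rightarrow> real)"
  have cb: "cball 0 1 \<in> sets (borel :: 'a measure)" by auto
  have [measurable]: "f \<in> borel_measurable borel" unfolding f_def using cb by measurable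
  have f: "0 \<le> f x" "f x \<le> 1" "norm x > 1 \<Longrightarrow> f x = 0" for x by (auto simp: f_def indicator_def)
  have fq: "f x powr q = f x" for x by (auto simp: f_def indicator_def)
  have fi: "integrable lborel f" by (rule integrable_compact_support[OF _ f]) auto
  have m: "mass f > 0"
  proof -
    have "mass f = measure lborel (cball (0::'a) 1)" unfolding mass_def f_def by simp
    then show ?thesis by (simp add: content_cball)
  qed
  have "\<not> (AE x in lborel. f x = 0)"
  proof
    assume "AE x in lborel. f x = 0"
    then have "mass f = 0" unfolding mass_def by (rule integral_eq_zero_AE)
    with m show False by simp
  qed
  then have "admissible q f" unfolding admissible_def using f fi fq by simp
  moreover have "bienergy lam f f < \<infinity>"
  proof -
    have i: "integrable lborel (\<lambda>y. (norm y + 1) powr lam * f y)"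
    proof (rule integrable_compact_support[of _ "2 powr lam" 1])
      show "(norm x + 1) powr lam * f x \<le> 2 powr lam" for x
      proof (cases "norm x > 1")
        case False
        then have "(norm x + 1) powr lam * f x \<le> 2 powr lam * 1" using f lam by (intro mult_mono powr_mono2) auto
        then show ?thesis by simp
      qed (simp add: f)
    qed (use f in auto)
    have "bienergy lam f f \<le> (\<integral>\<^sup>+x. ennreal (f x) \<partial>lborel) * (\<integral>\<^sup>+y. ennreal ((norm y + 1) powr lam * f y) \<partial>lborel)"
      by (rule bienergy_near_origin) (use f lam in auto)
    also have "\<dots> < \<infinity>" using mass_nn_integral[OF fi f(1)] mass_nn_integral[OF i] f by (simp add: ennreal_mult_less_top)
    finally show ?thesis .
  qed
  ultimately show ?thesis by (rule that)
qed

lemma moment_pos: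
  assumes "admissible q f" shows "moment lam f > 0"
proof (rule ccontr)
  have [measurable]: "f \<in> borel_measurable borel" and f0: "\<And>x. 0 \<le> f x" and fn: "\<not> (AE x in lborel. f x = 0)"
    using assms unfolding admissible_def by auto
  assume "\<not> moment lam f > 0"
  then have "(\<integral>\<^sup>+x. ennreal (norm x powr lam * f x) \<partial>lborel) = 0" unfolding moment_def by (simp add: not_less)
  then have "AE x in lborel. ennreal (norm x powr lam * f x) = 0" by (subst (asm) nn_integral_0_iff_AE) auto
  moreover have "AE x in lborel. x \<noteq> 0" by (rule AE_lborel_singleton)
  ultimately have "AE x in lborel. f x = 0"
  proof eventually_elim
    case (elim x)
    then have "norm x powr lam * f x \<le> 0" by (simp add: ennreal_eq_0_iff)
    then show ?case using elim f0[of x] by (simp add: mult_le_0_iff)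
  qed
  with fn show False ..
qed

text \<open>If \<open>c\<close> were 0, the energy of the relaxed minimiser would vanish, although
  by \<open>bienergy_ge_moment\<close> it dominates half the product of its positive mass and
  moment. Once \<open>M = 0\<close>, its mass is 1 and its energy at most \<open>c\<close>.\<close>

theorem minimizer_exists:
  fixes lam q c N th al :: real
  assumes N_def: "N = real DIM('a::euclidean_space)"
    and th_def: "th = lam / (N * (1 - q))" and al_def: "al = 2 - q * th"
    and lam: "lam > 0" and q: "0 < q" "q < 1" and qN: "q > N / (N + lam)" and c: "c \<ge> 0"
    and hyp: "\<And>\<epsilon>. \<epsilon> > 0 \<Longrightarrow> \<exists>f::'a::euclidean_space \<Rightarrow> real. admissible q f \<and>
      bienergy lam f f < ennreal ((c + \<epsilon>) * mass f powr al * mass (\<lambda>x. f x powr q) powr th)"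
    and low: "\<And>f::'a \<Rightarrow> real. admissible q f \<Longrightarrow> ennreal (c * mass f powr al * mass (\<lambda>x. f x powr q) powr th) \<le> bienergy lam f f"
  shows "c > 0"
    and "al \<le> 0 \<or> N * (1 - q) \<le> min 2 lam \<Longrightarrow> \<exists>\<rho>::'a \<Rightarrow> real. admissible q \<rho> \<and> (\<forall>x y. norm x = norm y \<longrightarrow> \<rho> x = \<rho> y) \<and>
      mass \<rho> = 1 \<and> mass (\<lambda>x. \<rho> x powr q) = 1 \<and> bienergy lam \<rho> \<rho> \<le> ennreal c"
proof -
  have N: "N > 0" unfolding N_def by simp
  have "N < q * (N + lam)" using qN N lam by (simp add: pos_divide_less_eq)
  then have "N * (1 - q) < q * lam" by (simp add: algebra_simps)
  also have "\<dots> \<le> 1 * lam" using q lam by (intro mult_right_mono) auto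
  finally have th1: "th \<ge> 1" unfolding th_def using N q by (simp add: le_divide_eq)
  obtain \<rho> :: "'a \<Rightarrow> real" and M :: real
    where \<rho>: "\<rho> \<in> borel_measurable borel" "\<And>x. 0 \<le> \<rho> x" "\<And>x y. norm x = norm y \<Longrightarrow> \<rho> x = \<rho> y"
    "integrable lborel \<rho>" "integrable lborel (\<lambda>x. \<rho> x powr q)" "M \<ge> 0" "mass \<rho> + M = 1"
    "mass (\<lambda>x. \<rho> x powr q) = 1" "moment lam \<rho> < \<infinity>"
    "bienergy lam \<rho> \<rho> + moment lam \<rho> * ennreal (2 * M) \<le> ennreal c"
    using relaxed_minimizer[OF N_def th_def al_def lam q qN c hyp] by blast
  have "\<not> (AE x in lborel. \<rho> x = 0)"
  proof
    assume "AE x in lborel. \<rho> x = 0"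
    then have "AE x in lborel. \<rho> x powr q = 0" by eventually_elim simp
    then have "mass (\<lambda>x. \<rho> x powr q) = 0" unfolding mass_def by (rule integral_eq_zero_AE)
    with \<rho>(8) show False by simp
  qed
  then have adm: "admissible q \<rho>" unfolding admissible_def using \<rho>(1,2,4,5) by auto
  have ev: "\<rho> (- x) = \<rho> x" for x by (rule \<rho>(3)) simp
  have mom: "moment lam \<rho> > 0" by (rule moment_pos[OF adm])
  have m: "mass \<rho> > 0" by (rule admissible_pos[OF adm])
  have bc: "bienergy lam \<rho> \<rho> \<le> ennreal c" using \<rho>(10) by (rule order_trans[rotated]) simp
  show c0: "c > 0"
  proof (rule ccontr)
    assume "\<not> c > 0"
    then have "bienergy lam \<rho> \<rho> = 0" using bc by (simp add: ennreal_neg)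
    then have "(\<integral>\<^sup>+x. ennreal (\<rho> x) \<partial>lborel) * moment lam \<rho> \<le> 0"
      using bienergy_ge_moment[where g=\<rho>, OF \<rho>(1,2) ev lam] by simp
    then show False using mass_nn_integral[OF \<rho>(4,2)] m mom by simp
  qed
  assume cond: "al \<le> 0 \<or> N * (1 - q) \<le> min 2 lam"
  have "M = 0"
  proof (cases "al \<le> 0")
    case True
    \<comment> \<open>For \<open>al \<le> 0\<close> a mass below 1 does not decrease the right side
      of the inequality. The density alone therefore has energy at least \<open>c\<close>, leaving
      no room for the term with the positive moment.\<close>
    have "mass \<rho> \<le> 1" using \<rho>(6,7) by simp
    then have "1 \<le> mass \<rho> powr al" using powr_mono2'[of al "mass \<rho>" 1] True m by simp
    then have "c * 1 \<le> c * mass \<rho> powr al" using c0 by (intro mult_left_mono) auto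
    then have "ennreal c \<le> ennreal (c * mass \<rho> powr al * mass (\<lambda>x. \<rho> x powr q) powr th)" using \<rho>(8) by (simp add: ennreal_leI)
    also have "\<dots> \<le> bienergy lam \<rho> \<rho>" by (rule low[OF adm])
    finally have "bienergy lam \<rho> \<rho> = ennreal c" using bc by simp
    with \<rho>(10) have "ennreal c + moment lam \<rho> * ennreal (2 * M) \<le> ennreal c + 0" by simp
    then have "moment lam \<rho> * ennreal (2 * M) \<le> 0" by (subst (asm) ennreal_add_left_cancel_le) auto
    then show "M = 0" using mom \<rho>(6) by (auto simp: ennreal_eq_0_iff)
  next
    case False
    then have "N * (1 - q) \<le> min 2 lam" using cond by simp
    then show "M = 0"
      using no_point_mass[OF N_def lam q c0 th1 low adm ev \<rho>(6,7,8,9,10)] by simp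
  qed
  then show "\<exists>\<rho>::'a \<Rightarrow> real. admissible q \<rho> \<and> (\<forall>x y. norm x = norm y \<longrightarrow> \<rho> x = \<rho> y) \<and>
      mass \<rho> = 1 \<and> mass (\<lambda>x. \<rho> x powr q) = 1 \<and> bienergy lam \<rho> \<rho> \<le> ennreal c"
    using adm \<rho>(7,8) bc by (intro exI[of _ \<rho>] conjI allI impI \<rho>(3)) auto
qed

theorem theorem1:
  fixes lam q N \<alpha> :: real and C :: ennreal
  assumes "lam > 0" and "0 < q" and "q < 1"
    and "N = real CARD('n::finite)"
    and "\<alpha> = (2 * N - q * (2 * N + lam)) / (N * (1 - q))"
    and "C = optimal_constant TYPE('n) lam q"
  shows "(0 < C \<and> C < \<infinity> \<and>
          (\<forall>\<rho> \<in> (densities q :: (real ^ 'n \<Rightarrow> real) set).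
             energy lam \<rho> \<ge> C * ennreal ((\<integral>x. \<rho> x \<partial>lebesgue) powr \<alpha>
                                 * (\<integral>x. \<rho> x powr q \<partial>lebesgue) powr ((2 - \<alpha>) / q)))
          \<longleftrightarrow> q > N / (N + lam))
       \<and> (q > N / (N + lam) \<longrightarrow>
            N \<in> {1, 2} \<or> N \<ge> 3 \<and> q \<ge> min (1 - 2 / N) (2 * N / (2 * N + lam)) \<longrightarrow>
            (\<exists>\<rho> \<in> (densities q :: (real ^ 'n \<Rightarrow> real) set). radial \<rho> \<and>
               energy lam \<rho> = C * ennreal ((\<integral>x. \<rho> x \<partial>lebesgue) powr \<alpha>
                                   * (\<integral>x. \<rho> x powr q \<partial>lebesgue) powr ((2 - \<alpha>) / q))))"
proof -
  note lam = assms(1) and q = assms(2,3)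
  have N_def: "N = real DIM(real ^ 'n)" using assms(4) by simp
  have N: "N > 0" using assms(4) by simp
  define th where "th = lam / (N * (1 - q))"
  have Nq0: "N * (1 - q) > 0" using N q by simp
  \<comment> \<open>The exponent of the \<open>q\<close>-mass is the dilation exponent
    \<open>lam / (N * (1 - q))\<close>.\<close>
  have th: "(2 - \<alpha>) / q = th"
  proof -
    have "2 - \<alpha> = (2 * (N * (1 - q)) - (2 * N - q * (2 * N + lam))) / (N * (1 - q))"
      unfolding assms(5) using Nq0 by (simp only: diff_divide_distrib nonzero_mult_div_cancel_right)
    also have "2 * (N * (1 - q)) - (2 * N - q * (2 * N + lam)) = q * lam" by (simp add: algebra_simps)
    finally have "2 - \<alpha> = q * lam / (N * (1 - q))" .
    then show ?thesis unfolding th_def using q by simp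
  qed
  have al: "\<alpha> = 2 - q * th" using th q by (simp add: field_simps)
  have hls: "hls_exponent CARD('n) lam q = \<alpha>" unfolding hls_exponent_def assms(5) assms(4) ..
  define P where "P \<rho> = (\<integral>x. \<rho> x \<partial>lebesgue) powr \<alpha> * (\<integral>x. \<rho> x powr q \<partial>lebesgue) powr th" for \<rho> :: "real ^ 'n \<Rightarrow> real"
  have np: "norm_product lam q \<rho> = P \<rho>" for \<rho> :: "real ^ 'n \<Rightarrow> real"
    unfolding norm_product_def hls Let_def th P_def ..
  have C: "C = (INF \<rho> \<in> (densities q :: (real ^ 'n \<Rightarrow> real) set). energy lam \<rho> / ennreal (P \<rho>))"
    unfolding assms(6) optimal_constant_def np ..
  have Ppos: "P \<rho> > 0" if \<rho>: "\<rho> \<in> densities q" for \<rho>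
  proof -
    obtain f :: "real ^ 'n \<Rightarrow> real" where f: "admissible q f" "(\<integral>x. \<rho> x \<partial>lebesgue) = mass f" "(\<integral>x. \<rho> x powr q \<partial>lebesgue) = mass (\<lambda>x. f x powr q)"
      using densities_admissible[OF \<rho>] by metis
    show ?thesis unfolding P_def f(2,3) using admissible_pos[OF f(1)] by simp
  qed
  have ineq: "C * ennreal (P \<rho>) \<le> energy lam \<rho>" if "\<rho> \<in> densities q" for \<rho>
  proof -
    have "C \<le> energy lam \<rho> / ennreal (P \<rho>)" unfolding C using that by (rule INF_lower)
    then show ?thesis using ennreal_le_divide_iff[OF Ppos[OF that]] by simp
  qed
  have Cfin: "C < \<infinity>"
  proof -
    obtain f :: "real ^ 'n \<Rightarrow> real" where f: "admissible q f" "bienergy lam f f < \<infinity>"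
      using admissible_finite_energy[OF lam] by blast
    note fd = admissible_densities[OF f(1)]
    have "C * ennreal (P f) < \<infinity>" using ineq[OF fd(1)] f(2) unfolding fd(4)[of lam] by (rule le_less_trans)
    then show ?thesis using Ppos[OF fd(1)] by (auto simp: ennreal_mult_less_top)
  qed
  define c where "c = enn2real C"
  have c: "C = ennreal c" "c \<ge> 0" unfolding c_def using Cfin by auto
  have Padm: "P f = mass f powr \<alpha> * mass (\<lambda>x. f x powr q) powr th" if "admissible q f" for f
    unfolding P_def using admissible_densities(2,3)[OF that] by simp
  have low: "ennreal (c * mass f powr \<alpha> * mass (\<lambda>x. f x powr q) powr th) \<le> bienergy lam f f"
    if "admissible q f" for f :: "real ^ 'n \<Rightarrow> real"
    using ineq[OF admissible_densities(1)[OF that]] c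
    unfolding Padm[OF that] admissible_densities(4)[OF that] c(1) by (simp add: ennreal_mult' mult.assoc)
  have hyp: "\<exists>f::real ^ 'n \<Rightarrow> real. admissible q f \<and>
      bienergy lam f f < ennreal ((c + \<epsilon>) * mass f powr \<alpha> * mass (\<lambda>x. f x powr q) powr th)" if e: "\<epsilon> > 0" for \<epsilon>
  proof -
    have "C < ennreal (c + \<epsilon>)" unfolding c(1) using e c(2) by (simp add: ennreal_less_iff)
    then obtain \<rho> :: "real ^ 'n \<Rightarrow> real" where \<rho>: "\<rho> \<in> densities q" "energy lam \<rho> / ennreal (P \<rho>) < ennreal (c + \<epsilon>)"
      unfolding C INF_less_iff by blast
    obtain f :: "real ^ 'n \<Rightarrow> real" where f: "admissible q f" "(\<integral>x. \<rho> x \<partial>lebesgue) = mass f" "(\<integral>x. \<rho> x powr q \<partial>lebesgue) = mass (\<lambda>x. f x powr q)"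
      "energy lam \<rho> = bienergy lam f f"
      using densities_admissible[OF \<rho>(1)] by metis
    have "energy lam \<rho> < ennreal (c + \<epsilon>) * ennreal (P \<rho>)"
      using \<rho>(2) ennreal_le_divide_iff[OF Ppos[OF \<rho>(1)], of "ennreal (c + \<epsilon>)" "energy lam \<rho>"] by (simp add: not_le[symmetric])
    also have "\<dots> = ennreal ((c + \<epsilon>) * mass f powr \<alpha> * mass (\<lambda>x. f x powr q) powr th)"
      unfolding P_def f(2,3) using c(2) e by (subst ennreal_mult'[symmetric]) (auto simp: mult.assoc)
    finally show ?thesis using f(1,4) by auto
  qed
  have pos: "C > 0" if "q > N / (N + lam)"
    using minimizer_exists(1)[OF N_def th_def al lam q that c(2) hyp low] c by simp
  have zero: "q > N / (N + lam)" if "C > 0"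
  proof (rule ccontr)
    assume "\<not> q > N / (N + lam)"
    then have "c = 0" using exponent_necessary[OF N_def th_def al lam q c(2) _ low] by simp
    with that c show False by simp
  qed
  have attained: "\<exists>\<rho> \<in> (densities q :: (real ^ 'n \<Rightarrow> real) set). radial \<rho> \<and> energy lam \<rho> = C * ennreal (P \<rho>)"
    if qN: "q > N / (N + lam)" and cond: "N \<in> {1, 2} \<or> N \<ge> 3 \<and> q \<ge> min (1 - 2 / N) (2 * N / (2 * N + lam))"
  proof -
    have "N < q * (N + lam)" using qN N lam by (simp add: pos_divide_less_eq)
    then have "N * (1 - q) < q * lam" by (simp add: algebra_simps)
    also have "\<dots> \<le> 1 * lam" using q lam by (intro mult_right_mono) auto
    finally have l: "N * (1 - q) \<le> lam" by simp
    \<comment> \<open>The bound \<open>2 * N / (2 * N + lam)\<close> is the point where \<alpha>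
      changes sign, and \<open>1 - 2 / N\<close> encodes \<open>N * (1 - q) \<le> 2\<close>, which
      is automatic in dimensions 1 and 2. The companion bound by \<open>lam\<close> follows already
      from \<open>q > N / (N + lam)\<close>.\<close>
    have "\<alpha> \<le> 0 \<or> N * (1 - q) \<le> min 2 lam"
    proof (cases "q \<ge> 2 * N / (2 * N + lam)")
      case True
      then have "2 * N \<le> q * (2 * N + lam)" using N lam by (simp add: pos_divide_le_eq)
      then have "\<alpha> \<le> 0" unfolding assms(5) using Nq0 by (intro divide_nonpos_pos) auto
      then show ?thesis ..
    next
      case False
      then have "N \<in> {1, 2} \<or> q \<ge> 1 - 2 / N" using cond by auto
      then have "N * (1 - q) \<le> 2"
      proof
        assume "N \<in> {1, 2}"
        then show ?thesis using q by auto
      next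
        assume "q \<ge> 1 - 2 / N"
        then have "N * (1 - q) \<le> N * (2 / N)" using N by (intro mult_left_mono) auto
        then show ?thesis using N by simp
      qed
      then show ?thesis using l by simp
    qed
    then obtain \<rho> :: "real ^ 'n \<Rightarrow> real" where \<rho>: "admissible q \<rho>" "\<And>x y. norm x = norm y \<Longrightarrow> \<rho> x = \<rho> y"
      "mass \<rho> = 1" "mass (\<lambda>x. \<rho> x powr q) = 1" "bienergy lam \<rho> \<rho> \<le> ennreal c"
      using minimizer_exists(2)[OF N_def th_def al lam q qN c(2) hyp low] by blast
    note d = admissible_densities[OF \<rho>(1)]
    have P1: "P \<rho> = 1" unfolding Padm[OF \<rho>(1)] \<rho>(3,4) by simp
    have "energy lam \<rho> = C * ennreal (P \<rho>)"
      using ineq[OF d(1)] \<rho>(5) unfolding P1 d(4) c(1) by simp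
    moreover have "radial \<rho>"
      unfolding radial_def
    proof (intro exI allI)
      fix x show "\<rho> x = (\<lambda>r. \<rho> (SOME y. norm y = r)) (norm x)"
        by (rule \<rho>(2)) (metis (mono_tags, lifting) someI_ex)
    qed
    ultimately show ?thesis using d(1) by blast
  qed
  show ?thesis
    unfolding th P_def[symmetric]
    using pos zero Cfin ineq attained by blast
qed

end
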